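(* Let $X=\{0,1\}^{\mathbb{Z}}$ with Borel $\sigma$-algebra $\mathcal{B}$, let $T:X\to X$ be the full shift, and let $P=\prod_{k\in\mathbb{Z}}P_k$ be a half stationary product probability measure on $X$ such that $(X,\mathcal{B},P,T)$ is non singular. If $(X,\mathcal{B},P,T)$ is conservative and ergodic, then it is either of type ${\rm III}_1$ or of type ${\rm II}_1$.
   Context: The full shift is $(Tw)_k=w_{k+1}$. A product measure $P=\prod_{k\in\mathbb{Z}}P_k$ on $\{0,1\}^{\mathbb{Z}}$ is half stationary if there is $p\in(0,1)$ with $P_k(0)=1-P_k(1)=p$ for all $k\le 0$. (The full shift with a half stationary product measure for which it is non singular is called a non-singular $K$ Bernoulli shift.) All set equalities are modulo null sets. An invertible measurable transformation $T$ of a standard probability space $(X,\mathcal{B},\mu)$ is non singular if $\mu$ and $\mu\circ T^{-1}$ have the same null sets; then $T':=\frac{d\mu\circ T}{d\mu}$. A set $A\in\mathcal{B}$ is wandering if the sets $\{T^{-n}A\}_{n\ge1}$ are pairwise disjoint; $T$ is conservative if every wandering set is null. $T$ is ergodic if $T^{-1}A=A$ implies $A\in\{\emptyset,X\}$. The Maharam extension of $T$ is the measure preserving transformation $\tilde{T}(x,y)=(Tx,\,y+\log T'(x))$ of $(X\times\mathbb{R},\mathcal{B}\otimes\mathcal{B}_{\mathbb{R}},\mu\otimes e^{-s}ds)$. An ergodic $T$ is of type ${\rm III}_1$ if its Maharam extension is ergodic. An ergodic $T$ is of type ${\rm II}_1$ if there is a $T$-invariant probability measure absolutely continuous with respect to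 $\mu$. *)

theory Defs
  imports "HOL-Probability.Probability"
begin

definition eq_mod_null :: "'a measure \<Rightarrow> 'a set \<Rightarrow> 'a set \<Rightarrow> bool" where
  "eq_mod_null M A B \<longleftrightarrow> (A - B) \<union> (B - A) \<in> null_sets M"

text \<open>Invertibility is a genuine measurable bijection of the underlying space.\<close>
definition invertible_transformation :: "'a measure \<Rightarrow> ('a \<Rightarrow> 'a) \<Rightarrow> bool" where
  "invertible_transformation M T \<longleftrightarrow>
     bij_betw T (space M) (space M) \<and>
     T \<in> measurable M M \<and> the_inv_into (space M) T \<in> measurable M M"

definition nonsingular :: "'a measure \<Rightarrow> ('a \<Rightarrow> 'a) \<Rightarrow> bool" where
  "nonsingular M T \<longleftrightarrow>
     invertible_transformation M T \<and> null_sets (distr M M T) = null_sets M"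

text \<open>Set equalities are read modulo null sets throughout; in particular, disjoint means
  that the intersection is null.\<close>
definition wandering :: "'a measure \<Rightarrow> ('a \<Rightarrow> 'a) \<Rightarrow> 'a set \<Rightarrow> bool" where
  "wandering M T A \<longleftrightarrow> A \<in> sets M \<and>
     (\<forall>m\<ge>1. \<forall>n\<ge>1. m \<noteq> n \<longrightarrow>
        eq_mod_null M (((T ^^ m) -` A \<inter> space M) \<inter> ((T ^^ n) -` A \<inter> space M)) {})"

definition conservative :: "'a measure \<Rightarrow> ('a \<Rightarrow> 'a) \<Rightarrow> bool" where
  "conservative M T \<longleftrightarrow> (\<forall>A. wandering M T A \<longrightarrow> A \<in> null_sets M)"

definition ergodic :: "'a measure \<Rightarrow> ('a \<Rightarrow> 'a) \<Rightarrow> bool" where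
  "ergodic M T \<longleftrightarrow>
     (\<forall>A\<in>sets M. eq_mod_null M (T -` A \<inter> space M) A \<longrightarrow>
        eq_mod_null M A {} \<or> eq_mod_null M A (space M))"

text \<open>The measure \<open>A \<mapsto> \<mu> (T A)\<close> is the image of \<open>\<mu>\<close> under the inverse of \<open>T\<close>. For
  nonsingular \<open>T\<close> and \<open>\<sigma>\<close>-finite \<open>\<mu>\<close> the derivative takes values in \<open>(0, \<infinity>)\<close> almost
  everywhere, so the conversion to reals matters only on a null set.\<close>
definition transformation_deriv :: "'a measure \<Rightarrow> ('a \<Rightarrow> 'a) \<Rightarrow> 'a \<Rightarrow> real" where
  "transformation_deriv M T x =
     enn2real (RN_deriv M (distr M M (the_inv_into (space M) T)) x)"

definition maharam_measure :: "'a measure \<Rightarrow> ('a \<times> real) measure" where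
  "maharam_measure M = M \<Otimes>\<^sub>M density lborel (\<lambda>s. ennreal (exp (- s)))"

definition maharam_extension :: "'a measure \<Rightarrow> ('a \<Rightarrow> 'a) \<Rightarrow> 'a \<times> real \<Rightarrow> 'a \<times> real" where
  "maharam_extension M T = (\<lambda>(x, y). (T x, y + ln (transformation_deriv M T x)))"

definition type_III1 :: "'a measure \<Rightarrow> ('a \<Rightarrow> 'a) \<Rightarrow> bool" where
  "type_III1 M T \<longleftrightarrow> ergodic M T \<and> ergodic (maharam_measure M) (maharam_extension M T)"

definition type_II1 :: "'a measure \<Rightarrow> ('a \<Rightarrow> 'a) \<Rightarrow> bool" where
  "type_II1 M T \<longleftrightarrow> ergodic M T \<and>
     (\<exists>N. prob_space N \<and> sets N = sets M \<and> absolutely_continuous M N \<and> distr N N T = N)"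

text \<open>The alphabet \<open>{0, 1}\<close> is \<^typ>\<open>bool\<close>, with \<^term>\<open>False\<close> for 0 and \<^term>\<open>True\<close> for 1;
  a probability measure on it is a \<^typ>\<open>bool pmf\<close>.\<close>
definition full_shift :: "(int \<Rightarrow> bool) \<Rightarrow> int \<Rightarrow> bool" where
  "full_shift w = (\<lambda>k. w (k + 1))"

definition bernoulli_product :: "(int \<Rightarrow> bool pmf) \<Rightarrow> (int \<Rightarrow> bool) measure" where
  "bernoulli_product P = (\<Pi>\<^sub>M k\<in>UNIV. measure_pmf (P k))"

instance bool :: second_countable_topology
proof
  have "open = generate_topology (UNIV :: bool set set)"
    by (auto simp: fun_eq_iff Topological_Spaces.open_discrete intro: generate_topology.Basis)
  then show "\<exists>B :: bool set set. countable B \<and> open = generate_topology B"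
    by (intro exI[of _ UNIV]) (simp add: countable_finite)
qed

lemma sets_bernoulli_product: "sets (bernoulli_product P) = sets borel"
proof -
  have "sets (bernoulli_product P) = sets (\<Pi>\<^sub>M k\<in>(UNIV :: int set). (borel :: bool measure))"
    unfolding bernoulli_product_def by (intro sets_PiM_cong) (simp_all add: sets_borel_eq_count_space)
  then show ?thesis
    by (simp only: sets_PiM_equal_borel)
qed

definition half_stationary :: "(int \<Rightarrow> bool pmf) \<Rightarrow> bool" where
  "half_stationary P \<longleftrightarrow>
     (\<exists>p::real. 0 < p \<and> p < 1 \<and> (\<forall>k\<le>0. pmf (P k) False = p \<and> 1 - pmf (P k) True = p))"

end

theory Submission
  imports Defs
begin

text \<open>
  Let \<open>T\<close> be the shift, \<open>M\<close> the product measure and \<open>p\<close> the common weight of \<open>0\<close> under the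
  marginals \<open>P k\<close> with \<open>k \<le> 0\<close>. The type is decided by \<open>\<Sum>k. (P k(0) - p)\<^sup>2\<close>.

  If the sum converges, the stationary product measure \<open>N\<close> with marginals \<open>P 0\<close> is absolutely
  continuous with respect to \<open>M\<close>, as in Kakutani's theorem: the densities of \<open>N\<close> with respect to
  \<open>M\<close> on finitely many coordinates are bounded in \<open>L\<^sup>2\<close>, which bounds \<open>N\<close> by \<open>M\<close> on sets that
  depend on finitely many coordinates, and these approximate every measurable set. As \<open>N\<close> is
  \<open>T\<close>-invariant, the shift is of type II\<open>\<^sub>1\<close>.

  Suppose that the sum diverges, and let \<open>F\<close> be the indicator of a set that is invariant under
  the Maharam extension \<open>S(x, y) = (T x, y + log T'(x))\<close>. It has to be shown that \<open>F\<close> is constant.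

  \<^item> \<^emph>\<open>\<open>F\<close> depends only on \<open>y\<close> and the coordinates \<open>x k\<close> with \<open>k \<ge> 1\<close>\<close> (\<open>F_eq_cond_future\<close>). As the
    marginals with \<open>k \<le> 0\<close> agree, \<open>T'\<close> is a function of the positive coordinates (\<open>AE_jac_glue\<close>).
    Hence the conditional expectations \<open>g m\<close> of \<open>F\<close> given the coordinates above \<open>- m\<close> satisfy
    \<open>g (m + 1) \<circ> S = g m\<close>. Their increments are orthogonal, so for a function \<open>h\<close> of \<open>y\<close> that is
    integrable for \<open>exp (- y) dy\<close> the sum over \<open>m\<close> of \<open>\<integral>h (g (m + 1) - g m)\<^sup>2\<close> is finite. Because
    \<open>S\<close> preserves the measure, this sum is the integral of \<open>(g 1 - g 0)\<^sup>2\<close> times the sum of the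
    \<open>h \<circ> S\<^sup>m\<close>. Were \<open>g 1 \<noteq> g 0\<close> on a set of positive measure, then \<open>(T\<^sup>m)'\<close> would tend to \<open>0\<close> on a
    set of positive measure, and conservativity excludes that (\<open>not_drift\<close>).

  \<^item> \<^emph>\<open>\<open>F\<close> is invariant under flips\<close> (\<open>F_flip\<close>). The power \<open>T\<^sup>k\<close> moves coordinate \<open>k\<close> to a place on
    which \<open>F\<close> does not depend, so flipping \<open>x k\<close> is compensated by a translation of \<open>y\<close> by \<open>\<plusminus> d k\<close>,
    where \<open>d k\<close> is the difference of the log-odds of \<open>P k\<close> and \<open>P 0\<close>.

  \<^item> \<^emph>\<open>\<open>F\<close> does not depend on \<open>y\<close>\<close> (\<open>translation_invariant_of_flip_invariant\<close>). Smooth \<open>F\<close> in \<open>y\<close>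
    and consider the martingale of its conditional expectations given the coordinates up to \<open>k\<close>.
    Where \<open>d k\<close> is small, flip invariance makes its \<open>k\<close>-th increment comparable to \<open>d k\<close> times
    the conditional expectation of the \<open>y\<close>-derivative. The squared norms of the increments have a
    finite sum, while those of the conditional expectations of the derivative increase with \<open>k\<close>.
    Since the sum of \<open>(d k)\<^sup>2\<close> over the \<open>k\<close> with small \<open>d k\<close> diverges, the derivative vanishes.

  \<^item> Therefore \<open>F\<close> is a \<open>T\<close>-invariant function of \<open>x\<close> alone, and it is constant because \<open>T\<close> is
    ergodic (\<open>maharam_ergodic\<close>).

  The divergence used in the third step holds for the following reason. Nonsingularity forces
  \<open>P (k + 1)(0) - P k(0) \<longlonglongrightarrow> 0\<close> (\<open>steps_tendsto_0\<close>), and conservativity forces \<open>P k(0)\<close> to come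
  arbitrarily close to \<open>p\<close> for arbitrarily large \<open>k\<close> (\<open>frequently_close\<close>); if the sum of
  \<open>(P k(0) - p)\<^sup>2\<close> over the \<open>k\<close> with \<open>\<bar>P k(0) - p\<bar> \<le> \<eta>\<close> converged, the sequence would get trapped
  near \<open>p\<close> and the whole sum would converge (\<open>truncated_squares_not_summable\<close>).
\<close>

section \<open>Product measures on two-sided binary sequences\<close>

notation bernoulli_product ("\<mu>")

text \<open>The common \<open>\<sigma>\<close>-algebra of all these product measures, so that one measurability fact serves all
  of them.\<close>
definition cantor :: "(int \<Rightarrow> bool) measure" where
  "cantor = (\<Pi>\<^sub>M k\<in>UNIV. count_space UNIV)"

lemma space_cantor [simp]: "space cantor = UNIV"
  by (simp add: cantor_def space_PiM)

lemma sets_bernoulli [measurable_cong]: "sets (\<mu> A) = sets cantor"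
  unfolding bernoulli_product_def cantor_def by (intro sets_PiM_cong) auto

lemma space_bernoulli [simp]: "space (\<mu> A) = UNIV"
  by (simp add: bernoulli_product_def space_PiM)

lemma prob_space_bernoulli: "prob_space (\<mu> A)"
  unfolding bernoulli_product_def by (intro prob_space_PiM measure_pmf.prob_space_axioms)

lemma coordinate_measurable [measurable]: "(\<lambda>x. x k) \<in> measurable cantor (count_space UNIV)"
  unfolding cantor_def by (rule measurable_component_singleton) simp

lemma measurable_cantorI:
  "(\<And>k. (\<lambda>x. f x k) \<in> measurable M (count_space UNIV)) \<Longrightarrow> f \<in> measurable M cantor"
  unfolding cantor_def by (rule measurable_PiM_single') auto

definition cylinder :: "int set \<Rightarrow> (int \<Rightarrow> bool set) \<Rightarrow> (int \<Rightarrow> bool) set" where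
  "cylinder I B = {x. \<forall>k\<in>I. x k \<in> B k}"

lemma sets_cylinder [measurable]: "finite I \<Longrightarrow> cylinder I B \<in> sets cantor"
proof -
  assume "finite I"
  then have "{x \<in> space cantor. \<forall>k\<in>I. x k \<in> B k} \<in> sets cantor"
    by (intro sets.sets_Collect_finite_All) (simp_all add: measurable_sets[OF coordinate_measurable, of "B k" for k, simplified vimage_def, simplified])
  then show ?thesis by (simp add: cylinder_def)
qed

lemma emeasure_cylinder:
  assumes "finite I"
  shows "emeasure (\<mu> A) (cylinder I B) = (\<Prod>k\<in>I. emeasure (measure_pmf (A k)) (B k))"
proof -
  have "emeasure (PiM UNIV (\<lambda>k. measure_pmf (A k)))
      (prod_emb UNIV (\<lambda>k. measure_pmf (A k)) I (Pi\<^sub>E I B)) = (\<Prod>k\<in>I. emeasure (A k) (B k))"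
    by (rule emeasure_PiM_emb) (auto simp: assms measure_pmf.prob_space_axioms)
  moreover have "prod_emb UNIV (\<lambda>k. measure_pmf (A k)) I (Pi\<^sub>E I B) = cylinder I B"
    by (auto simp: prod_emb_def cylinder_def Pi_iff PiE_iff)
  ultimately show ?thesis by (simp add: bernoulli_product_def)
qed

lemma bernoulli_eqI:
  assumes "sets N = sets cantor"
    and "\<And>I B. finite I \<Longrightarrow> emeasure N (cylinder I B) = (\<Prod>k\<in>I. emeasure (measure_pmf (A k)) (B k))"
  shows "N = \<mu> A"
proof -
  have emb: "prod_emb UNIV (\<lambda>k. measure_pmf (A k)) I (Pi\<^sub>E I B) = cylinder I B" for I B
    by (auto simp: prod_emb_def cylinder_def Pi_iff PiE_iff)
  have "\<mu> A = N"
  proof (rule measure_eqI_PiM_infinite)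
    show "sets (\<mu> A) = sets (PiM UNIV (\<lambda>k. measure_pmf (A k)))"
      by (simp add: bernoulli_product_def)
    then show "sets N = sets (PiM UNIV (\<lambda>k. measure_pmf (A k)))"
      using assms(1) sets_bernoulli by metis
    show "finite_measure (\<mu> A)"
      using prob_space_bernoulli by (rule prob_space.finite_measure)
  qed (simp_all add: emb emeasure_cylinder assms(2))
  then show ?thesis by simp
qed

definition glue :: "int set \<Rightarrow> (int \<Rightarrow> bool) \<Rightarrow> (int \<Rightarrow> bool) \<Rightarrow> int \<Rightarrow> bool" where
  "glue J x w = (\<lambda>k. if k \<in> J then x k else w k)"

lemma glue_measurable [measurable]:
  assumes [measurable]: "f \<in> measurable M cantor" "g \<in> measurable M cantor"
  shows "(\<lambda>z. glue J (f z) (g z)) \<in> measurable M cantor"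
proof (rule measurable_cantorI)
  fix k
  have [measurable]: "(\<lambda>z. f z k) \<in> measurable M (count_space UNIV)"
    "(\<lambda>z. g z k) \<in> measurable M (count_space UNIV)"
    using measurable_compose[OF assms(1) coordinate_measurable]
      measurable_compose[OF assms(2) coordinate_measurable] by auto
  show "(\<lambda>x. glue J (f x) (g x) k) \<in> measurable M (count_space UNIV)"
    unfolding glue_def by (cases "k \<in> J") auto
qed

lemma glue_glue: "J \<subseteq> J' \<Longrightarrow> glue J (glue J' x w) v = glue J x v"
  by (auto simp: glue_def)

text \<open>The coordinates are independent, so two samples can be mixed coordinate by coordinate; on
  cylinders this is multiplication.\<close>
lemma distr_glue:
  "distr (\<mu> A \<Otimes>\<^sub>M \<mu> B) cantor (\<lambda>(x, w). glue J x w)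
    = \<mu> (\<lambda>k. if k \<in> J then A k else B k)"
proof (rule bernoulli_eqI)
  interpret B: prob_space "\<mu> B" by (rule prob_space_bernoulli)
  fix I :: "int set" and C assume I: "finite I"
  have "(\<lambda>(x, w). glue J x w) -` cylinder I C \<inter>
      space (\<mu> A \<Otimes>\<^sub>M \<mu> B) = cylinder (I \<inter> J) C \<times> cylinder (I - J) C"
    unfolding cylinder_def glue_def space_pair_measure by (fastforce split: if_split_asm)
  then have "emeasure (distr (\<mu> A \<Otimes>\<^sub>M \<mu> B) cantor
      (\<lambda>(x, w). glue J x w)) (cylinder I C) =
      emeasure (\<mu> A \<Otimes>\<^sub>M \<mu> B) (cylinder (I \<inter> J) C \<times> cylinder (I - J) C)"
    by (subst emeasure_distr) (auto simp: I)
  also have "\<dots> = (\<Prod>k\<in>I \<inter> J. emeasure (A k) (C k)) * (\<Prod>k\<in>I - J. emeasure (B k) (C k))"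
    by (subst B.emeasure_pair_measure_Times) (auto simp: I emeasure_cylinder sets_bernoulli)
  also have "\<dots> = (\<Prod>k\<in>I. emeasure (if k \<in> J then A k else B k) (C k))"
    using I by (subst prod.Int_Diff[of I _ J]) auto
  finally show "emeasure (distr (\<mu> A \<Otimes>\<^sub>M \<mu> B) cantor
      (\<lambda>(x, w). glue J x w)) (cylinder I C) = (\<Prod>k\<in>I. emeasure (if k \<in> J then A k else B k) (C k))" .
qed simp

lemma nn_integral_glue:
  assumes [measurable]: "g \<in> borel_measurable cantor"
  shows "(\<integral>\<^sup>+x. g x \<partial>\<mu> (\<lambda>k. if k \<in> J then A k else B k)) =
    (\<integral>\<^sup>+x. \<integral>\<^sup>+w. g (glue J x w) \<partial>\<mu> B \<partial>\<mu> A)"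
proof -
  interpret B: prob_space "\<mu> B" by (rule prob_space_bernoulli)
  show ?thesis
    unfolding distr_glue[symmetric]
    by (subst nn_integral_distr) (auto simp: B.nn_integral_fst[symmetric])
qed

lemma nn_integral_glue_same:
  assumes [measurable]: "g \<in> borel_measurable cantor"
  shows "(\<integral>\<^sup>+x. \<integral>\<^sup>+w. g (glue J x w) \<partial>\<mu> A \<partial>\<mu> A) =
    (\<integral>\<^sup>+x. g x \<partial>\<mu> A)"
  using nn_integral_glue[OF assms, of J A A] by simp

lemma AE_glue:
  assumes "AE x in \<mu> A. Q x"
  shows "AE x in \<mu> A. AE w in \<mu> A. Q (glue J x w)"
proof -
  interpret B: prob_space "\<mu> A" by (rule prob_space_bernoulli)
  interpret BB: pair_prob_space "\<mu> A" "\<mu> A" ..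
  have "AE x in distr (\<mu> A \<Otimes>\<^sub>M \<mu> A) cantor
      (\<lambda>(x, w). glue J x w). Q x"
    unfolding distr_glue if_cancel by (rule assms)
  then have "AE z in \<mu> A \<Otimes>\<^sub>M \<mu> A. Q (case z of (x, w) \<Rightarrow> glue J x w)"
    by (rule AE_distrD[rotated]) measurable
  from BB.AE_pair[OF this] show ?thesis by simp
qed

section \<open>Conditional expectation by resampling coordinates\<close>

text \<open>The conditional expectation of \<open>f\<close> given the coordinates in \<open>J\<close>, as a function defined at every
  point: the remaining coordinates are integrated out.\<close>
definition resample :: "int set \<Rightarrow> (int \<Rightarrow> bool) measure \<Rightarrow> ((int \<Rightarrow> bool) \<Rightarrow> real) \<Rightarrow> (int \<Rightarrow> bool) \<Rightarrow> real" where
  "resample J M f x = (\<integral>w. f (glue J x w) \<partial>M)"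

lemma integrable_bounded_bernoulli:
  assumes "f \<in> borel_measurable cantor" "\<And>x. \<bar>f x\<bar> \<le> (C::real)"
  shows "integrable (\<mu> A) f"
proof -
  interpret prob_space "\<mu> A" by (rule prob_space_bernoulli)
  show ?thesis using assms by (intro integrable_const_bound[of _ C]) auto
qed

lemma resample_measurable:
  assumes [measurable]: "f \<in> borel_measurable cantor"
  shows "resample J (\<mu> A) f \<in> borel_measurable cantor"
proof -
  interpret prob_space "\<mu> A" by (rule prob_space_bernoulli)
  show ?thesis unfolding resample_def by measurable
qed

lemma resample_bounded:
  assumes [measurable]: "f \<in> borel_measurable cantor" and "\<And>x. \<bar>f x\<bar> \<le> C"
  shows "\<bar>resample J (\<mu> A) f x\<bar> \<le> C"
proof -
  interpret prob_space "\<mu> A" by (rule prob_space_bernoulli)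
  have "\<bar>resample J (\<mu> A) f x\<bar> \<le> (\<integral>w. \<bar>f (glue J x w)\<bar> \<partial>\<mu> A)"
    unfolding resample_def by (rule integral_abs_bound)
  also have "\<dots> \<le> (\<integral>w. C \<partial>\<mu> A)"
    by (intro integral_mono integrable_bounded_bernoulli[where C=C]) (auto simp: assms order.trans[OF abs_ge_zero assms(2)])
  finally show ?thesis using prob_space by simp
qed

lemma resample_glue:
  "J \<subseteq> J' \<Longrightarrow> resample J M f (glue J' x w) = resample J M f x"
  by (simp add: resample_def glue_glue)

lemma integral_glue_same:
  assumes [measurable]: "f \<in> borel_measurable cantor" and C: "\<And>x. \<bar>f x\<bar> \<le> C"
  shows "(\<integral>x. resample J (\<mu> A) f x \<partial>\<mu> A) = (\<integral>x. f x \<partial>\<mu> A)"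
proof -
  interpret B: prob_space "\<mu> A" by (rule prob_space_bernoulli)
  interpret BB: pair_prob_space "\<mu> A" "\<mu> A" ..
  have "(\<integral>x. f x \<partial>\<mu> A) = (\<integral>x. f x \<partial>distr (\<mu> A \<Otimes>\<^sub>M \<mu> A) cantor
      (\<lambda>(x, w). glue J x w))"
    by (simp add: distr_glue)
  also have "\<dots> = (\<integral>z. f (glue J (fst z) (snd z)) \<partial>(\<mu> A \<Otimes>\<^sub>M \<mu> A))"
    by (subst integral_distr) (auto simp: split_beta)
  also have "\<dots> = (\<integral>x. \<integral>w. f (glue J x w) \<partial>\<mu> A \<partial>\<mu> A)"
    by (subst BB.integral_fst'[symmetric]) (auto intro!: BB.P.integrable_const_bound[of _ C] simp: C)
  finally show ?thesis by (simp add: resample_def)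
qed

text \<open>A function of the coordinates in \<open>J\<close> does not notice resampling off \<open>J'\<close>, so it can be moved inside
  the integral; then resampling leaves the total integral unchanged. With \<open>J' = J\<close> this is the
  self-adjointness of conditional expectation.\<close>
lemma integral_resample_mult:
  fixes A :: "int \<Rightarrow> bool pmf" and f g :: "(int \<Rightarrow> bool) \<Rightarrow> real"
  assumes [measurable]: "f \<in> borel_measurable cantor" "g \<in> borel_measurable cantor"
    and C: "\<And>x. \<bar>f x\<bar> \<le> C" "\<And>x. \<bar>g x\<bar> \<le> C" and J: "J \<subseteq> J'"
  defines "M \<equiv> \<mu> A"
  shows "(\<integral>x. resample J' M f x * resample J M g x \<partial>M) = (\<integral>x. f x * resample J M g x \<partial>M)"
proof -
  have eq: "resample J' M f x * resample J M g x = resample J' M (\<lambda>x. f x * resample J M g x) x" for x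
    unfolding resample_def[of J' M]
    by (simp add: resample_glue[OF J])
  have [measurable]: "resample J M g \<in> borel_measurable cantor"
    unfolding M_def by (rule resample_measurable) fact
  have "\<bar>f x * resample J M g x\<bar> \<le> C * C" for x
    unfolding abs_mult by (intro mult_mono C) (use resample_bounded[OF assms(2) C(2)] C(1)[of undefined] in \<open>auto simp: M_def\<close>)
  then show ?thesis
    unfolding eq unfolding M_def by (subst integral_glue_same[where C="C*C"]) (auto simp flip: M_def)
qed

text \<open>Pythagoras: the increment of a martingale is orthogonal to its past.\<close>
lemma integral_resample_diff_sq:
  fixes A :: "int \<Rightarrow> bool pmf" and f :: "(int \<Rightarrow> bool) \<Rightarrow> real"
  assumes [measurable]: "f \<in> borel_measurable cantor" and C: "\<And>x. \<bar>f x\<bar> \<le> C" and J: "J \<subseteq> J'"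
  defines "M \<equiv> \<mu> A"
  shows "(\<integral>x. (resample J' M f x - resample J M f x)\<^sup>2 \<partial>M) =
    (\<integral>x. (resample J' M f x)\<^sup>2 \<partial>M) - (\<integral>x. (resample J M f x)\<^sup>2 \<partial>M)"
proof -
  have m[measurable]: "resample K M f \<in> borel_measurable cantor" for K
    unfolding M_def by (rule resample_measurable) fact
  have b: "\<bar>resample K M f x\<bar> \<le> C" for K x
    unfolding M_def by (rule resample_bounded) (auto simp: C)
  have i: "integrable M (\<lambda>x. resample K M f x * resample K' M f x)" for K K'
    unfolding M_def
    by (rule integrable_bounded_bernoulli[where C="C*C"])
      (auto simp flip: M_def simp: abs_mult intro!: mult_mono b order.trans[OF abs_ge_zero b])
  have e1: "(\<integral>x. resample J' M f x * resample J M f x \<partial>M) = (\<integral>x. f x * resample J M f x \<partial>M)"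
    unfolding M_def by (rule integral_resample_mult[where C=C]) (auto simp: C J)
  have e2: "(\<integral>x. resample J M f x * resample J M f x \<partial>M) = (\<integral>x. f x * resample J M f x \<partial>M)"
    unfolding M_def by (rule integral_resample_mult[where C=C]) (auto simp: C J)
  have "(\<integral>x. (resample J' M f x - resample J M f x)\<^sup>2 \<partial>M) =
     (\<integral>x. resample J' M f x * resample J' M f x - 2 * (resample J' M f x * resample J M f x)
         + resample J M f x * resample J M f x \<partial>M)"
    by (intro Bochner_Integration.integral_cong) (auto simp: power2_eq_square algebra_simps)
  also have "\<dots> = (\<integral>x. resample J' M f x * resample J' M f x \<partial>M) - (\<integral>x. resample J M f x * resample J M f x \<partial>M)"
    using e1 e2 i by simp
  finally show ?thesis by (simp add: power2_eq_square)
qed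

lemma integral_resample_sq_mono:
  fixes A :: "int \<Rightarrow> bool pmf" and f :: "(int \<Rightarrow> bool) \<Rightarrow> real"
  assumes "f \<in> borel_measurable cantor" and "\<And>x. \<bar>f x\<bar> \<le> C" and "J \<subseteq> J'"
  defines "M \<equiv> \<mu> A"
  shows "(\<integral>x. (resample J M f x)\<^sup>2 \<partial>M) \<le> (\<integral>x. (resample J' M f x)\<^sup>2 \<partial>M)"
proof -
  have "0 \<le> (\<integral>x. (resample J' M f x - resample J M f x)\<^sup>2 \<partial>M)" by simp
  then show ?thesis
    using integral_resample_diff_sq[OF assms(1-3)] unfolding M_def by simp
qed

section \<open>Changing finitely many coordinates\<close>

lemma distr_coordinate:
  "distr (\<mu> A) (count_space UNIV) (\<lambda>x. x k) = measure_pmf (A k)"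
proof (rule measure_eqI)
  fix B :: "bool set"
  have "(\<lambda>x. x k) -` B = cylinder {k} (\<lambda>_. B)" by (auto simp: cylinder_def)
  then show "emeasure (distr (\<mu> A) (count_space UNIV) (\<lambda>x. x k)) B = emeasure (measure_pmf (A k)) B"
    by (subst emeasure_distr) (simp_all add: emeasure_cylinder)
qed simp

lemma nn_integral_bool_pmf:
  fixes q :: "bool pmf"
  shows
  "(\<integral>\<^sup>+b. h b \<partial>measure_pmf q) = (\<Sum>b\<in>UNIV. ennreal (pmf q b) * h b)"
  unfolding UNIV_bool
  by (subst nn_integral_measure_pmf_support[of "{False, True}"]) (auto simp: mult.commute)

lemma fun_upd_measurable [measurable]: "(\<lambda>x. x(k := b)) \<in> measurable cantor cantor"
  by (rule measurable_cantorI) (simp add: fun_upd_def)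

lemma nn_integral_fun_upd:
  assumes [measurable]: "g \<in> borel_measurable cantor"
  shows "(\<integral>\<^sup>+x. g x \<partial>\<mu> (A(k := q))) =
    (\<integral>\<^sup>+x. (\<Sum>b\<in>UNIV. ennreal (pmf q b) * g (x(k := b))) \<partial>\<mu> A)"
proof -
  have A: "A(k := q) = (\<lambda>j. if j \<in> - {k} then A j else q)" by auto
  have "(\<integral>\<^sup>+w. g (x(k := w k)) \<partial>\<mu> (\<lambda>_. q)) =
      (\<Sum>b\<in>UNIV. ennreal (pmf q b) * g (x(k := b)))" for x
    unfolding nn_integral_bool_pmf[symmetric] distr_coordinate[of "\<lambda>_. q" k, symmetric]
    by (subst nn_integral_distr) auto
  moreover have "glue (- {k}) x w = x(k := w k)" for x w by (auto simp: glue_def)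
  ultimately show ?thesis unfolding A by (subst nn_integral_glue) simp_all
qed

lemma nn_integral_coordinate:
  assumes "g \<in> borel_measurable cantor"
  shows "(\<integral>\<^sup>+x. g x \<partial>\<mu> A) =
    (\<integral>\<^sup>+x. (\<Sum>b\<in>UNIV. ennreal (pmf (A k) b) * g (x(k := b))) \<partial>\<mu> A)"
  using nn_integral_fun_upd[OF assms, of A k "A k"] by simp

definition flip :: "int \<Rightarrow> (int \<Rightarrow> bool) \<Rightarrow> int \<Rightarrow> bool" where
  "flip k x = x(k := \<not> x k)"

lemma flip_measurable [measurable]: "flip k \<in> measurable cantor cantor"
proof (rule measurable_cantorI)
  fix j show "Measurable.pred cantor (\<lambda>x. flip k x j)" by (cases "j = k") (auto simp: flip_def)
qed

lemma flip_flip [simp]: "flip k (flip k x) = x"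
  by (auto simp: flip_def)

lemma ennreal_mult_ratio:
  "0 < a \<Longrightarrow> 0 \<le> b \<Longrightarrow> ennreal a * (c * ennreal (b / a)) = ennreal b * c"
proof -
  assume ab: "0 < a" "0 \<le> b"
  have "ennreal a * (c * ennreal (b / a)) = (ennreal a * ennreal (b / a)) * c" by (simp add: mult_ac)
  also have "ennreal a * ennreal (b / a) = ennreal b" using ab by (simp add: ennreal_mult[symmetric])
  finally show ?thesis .
qed

text \<open>Both sides average over the value at \<open>k\<close>; the quotient exchanges the weights of the two values.\<close>
lemma nn_integral_flip:
  assumes [measurable]: "g \<in> borel_measurable cantor" and pos: "\<And>b. 0 < pmf (A k) b"
  shows "(\<integral>\<^sup>+x. g (flip k x) \<partial>\<mu> A) =
    (\<integral>\<^sup>+x. g x * ennreal (pmf (A k) (\<not> x k) / pmf (A k) (x k)) \<partial>\<mu> A)"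
proof -
  have "(\<integral>\<^sup>+x. g (flip k x) \<partial>\<mu> A) =
     (\<integral>\<^sup>+x. (\<Sum>b\<in>UNIV. ennreal (pmf (A k) b) * g (x(k := \<not> b))) \<partial>\<mu> A)"
    by (subst nn_integral_coordinate[where k=k]) (auto simp: flip_def)
  also have "\<dots> = (\<integral>\<^sup>+x. (\<Sum>b\<in>UNIV. ennreal (pmf (A k) b) * (g (x(k := b)) *
      ennreal (pmf (A k) (\<not> b) / pmf (A k) b))) \<partial>\<mu> A)"
    using pos by (intro nn_integral_cong) (simp add: ennreal_mult_ratio UNIV_bool add.commute)
  also have "\<dots> = (\<integral>\<^sup>+x. g x * ennreal (pmf (A k) (\<not> x k) / pmf (A k) (x k)) \<partial>\<mu> A)"
    by (subst nn_integral_coordinate[where k=k and g="\<lambda>x. g x * ennreal (pmf (A k) (\<not> x k) / pmf (A k) (x k))"]) auto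
  finally show ?thesis .
qed

lemma AE_bernoulli_compose:
  assumes [measurable]: "\<phi> \<in> measurable cantor cantor"
    and "\<And>N. N \<in> null_sets (\<mu> A) \<Longrightarrow>
      (\<integral>\<^sup>+x. indicator N (\<phi> x) \<partial>\<mu> A) = 0"
    and "AE x in \<mu> A. Q x"
  shows "AE x in \<mu> A. Q (\<phi> x)"
proof -
  have "AE x in distr (\<mu> A) cantor \<phi>. Q x"
  proof (rule absolutely_continuous_AE[OF _ _ assms(3)])
    show "absolutely_continuous (\<mu> A) (distr (\<mu> A) cantor \<phi>)"
      unfolding absolutely_continuous_def
    proof
      fix N assume N: "N \<in> null_sets (\<mu> A)"
      then have [measurable]: "N \<in> sets cantor" using sets_bernoulli by auto
      have "emeasure (distr (\<mu> A) cantor \<phi>) N = (\<integral>\<^sup>+x. indicator N x \<partial>distr (\<mu> A) cantor \<phi>)"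
        by simp
      also have "\<dots> = 0" using assms(2)[OF N] by (subst nn_integral_distr) auto
      finally show "N \<in> null_sets (distr (\<mu> A) cantor \<phi>)" by auto
    qed
  qed (simp add: sets_bernoulli)
  then show ?thesis by (rule AE_distrD[rotated]) measurable
qed

lemma AE_flip:
  assumes "\<And>b. 0 < pmf (A k) b" and "AE x in \<mu> A. Q x"
  shows "AE x in \<mu> A. Q (flip k x)"
proof (rule AE_bernoulli_compose[OF _ _ assms(2)])
  fix N assume N: "N \<in> null_sets (\<mu> A)"
  then have [measurable]: "N \<in> sets cantor" using sets_bernoulli by auto
  have "AE x in \<mu> A. x \<notin> N" using N by (rule AE_not_in)
  then show "(\<integral>\<^sup>+x. indicator N (flip k x) \<partial>\<mu> A) = 0"
    by (subst nn_integral_flip[where A=A and k=k, OF borel_measurable_indicator assms(1)], simp)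
      (subst nn_integral_0_iff_AE, measurable, auto elim!: eventually_mono)
qed measurable

lemma nn_integral_change_finite:
  assumes "finite I" and [measurable]: "g \<in> borel_measurable cantor"
    and pos: "\<And>k b. k \<in> I \<Longrightarrow> 0 < pmf (A k) b"
  shows "(\<integral>\<^sup>+x. g x \<partial>\<mu> (\<lambda>k. if k \<in> I then B k else A k)) =
    (\<integral>\<^sup>+x. g x * ennreal (\<Prod>k\<in>I. pmf (B k) (x k) / pmf (A k) (x k)) \<partial>\<mu> A)"
  using assms
proof (induction I arbitrary: g)
  case (insert k I)
  note [measurable] = insert.prems(1)
  let ?A = "\<lambda>k. if k \<in> I then B k else A k"
  have "(\<lambda>j. if j \<in> insert k I then B j else A j) = ?A(k := B k)" by auto
  then have "(\<integral>\<^sup>+x. g x \<partial>\<mu> (\<lambda>j. if j \<in> insert k I then B j else A j)) =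
     (\<integral>\<^sup>+x. (\<Sum>b\<in>UNIV. ennreal (pmf (B k) b) * g (x(k := b))) \<partial>\<mu> ?A)"
    by (simp only: nn_integral_fun_upd[OF insert.prems(1)])
  also have "\<dots> = (\<integral>\<^sup>+x. g x * ennreal (pmf (B k) (x k) / pmf (A k) (x k)) \<partial>\<mu> ?A)"
    by (subst nn_integral_coordinate[where k=k and g="\<lambda>x. g x * ennreal (pmf (B k) (x k) / pmf (A k) (x k))"])
      (use insert.hyps insert.prems(2) in \<open>simp_all add: ennreal_mult_ratio\<close>)
  also have "\<dots> = (\<integral>\<^sup>+x. g x * ennreal (pmf (B k) (x k) / pmf (A k) (x k)) *
      ennreal (\<Prod>k\<in>I. pmf (B k) (x k) / pmf (A k) (x k)) \<partial>\<mu> A)"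
    by (rule insert.IH) (use insert.prems in auto)
  also have "\<dots> = (\<integral>\<^sup>+x. g x * ennreal (\<Prod>k\<in>insert k I. pmf (B k) (x k) / pmf (A k) (x k)) \<partial>\<mu> A)"
    using insert.hyps by (simp add: mult.assoc prod_nonneg ennreal_mult[symmetric])
  finally show ?case .
qed simp

lemma nn_integral_prod_coordinates:
  assumes "finite I"
  shows "(\<integral>\<^sup>+x. (\<Prod>k\<in>I. u k (x k)) \<partial>\<mu> A) =
    (\<Prod>k\<in>I. \<Sum>b\<in>UNIV. ennreal (pmf (A k) b) * u k b)"
  using assms
proof (induction I)
  case empty
  show ?case using prob_space.emeasure_space_1[OF prob_space_bernoulli[of A]] by simp
next
  case (insert k I)
  have *: "(\<Prod>j\<in>insert k I. u j ((x(k := b)) j)) = u k b * (\<Prod>j\<in>I. u j (x j))" for x b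
    using insert.hyps by (subst prod.insert) (auto simp: fun_upd_other intro!: arg_cong2[where f="(*)"] prod.cong)
  have "(\<integral>\<^sup>+x. (\<Prod>k\<in>insert k I. u k (x k)) \<partial>\<mu> A) =
      (\<integral>\<^sup>+x. (\<Sum>b\<in>UNIV. ennreal (pmf (A k) b) * u k b) * (\<Prod>k\<in>I. u k (x k)) \<partial>\<mu> A)"
    by (subst nn_integral_coordinate[where k=k]) (simp_all del: fun_upd_apply add: * sum_distrib_right mult.assoc)
  also have "\<dots> = (\<Sum>b\<in>UNIV. ennreal (pmf (A k) b) * u k b) * (\<integral>\<^sup>+x. (\<Prod>k\<in>I. u k (x k)) \<partial>\<mu> A)"
    by (rule nn_integral_cmult) measurable
  finally show ?case using insert by simp
qed

text \<open>The Hellinger affinity.\<close>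
definition affinity :: "bool pmf \<Rightarrow> bool pmf \<Rightarrow> real" where
  "affinity a b = (\<Sum>c\<in>UNIV. sqrt (pmf a c * pmf b c))"

lemma affinity_nonneg: "0 \<le> affinity a b"
  unfolding affinity_def by (intro sum_nonneg) auto

lemma pmf_bool_True: "pmf a True = 1 - pmf a False"
  using sum_pmf_eq_1[of "{False, True}" a] by force

text \<open>Since \<open>\<surd>a + \<surd>b \<le> 2\<close>, the difference of square roots is at least half the difference.\<close>
lemma affinity_le: "affinity a b \<le> 1 - (pmf a False - pmf b False)\<^sup>2 / 4"
proof -
  have le: "sqrt (x * y) \<le> (x + y) / 2 - (x - y)\<^sup>2 / 8" if "0 \<le> x" "x \<le> 1" "0 \<le> y" "y \<le> 1" for x y :: real
  proof -
    define u v where "u = sqrt x" and "v = sqrt y"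
    have u: "0 \<le> u" "u \<le> 1" "0 \<le> v" "v \<le> 1" "x = u\<^sup>2" "y = v\<^sup>2" using that by (auto simp: u_def v_def)
    have "(u + v)\<^sup>2 \<le> 2\<^sup>2" using u by (intro power_mono) auto
    then have "(u - v)\<^sup>2 * (u + v)\<^sup>2 \<le> (u - v)\<^sup>2 * 4" by (intro mult_left_mono) auto
    moreover have "(u\<^sup>2 - v\<^sup>2)\<^sup>2 = (u - v)\<^sup>2 * (u + v)\<^sup>2" by (simp add: power2_eq_square algebra_simps)
    moreover have "(u - v)\<^sup>2 = u\<^sup>2 + v\<^sup>2 - 2 * (u * v)" by (simp add: power2_eq_square algebra_simps)
    moreover have "sqrt (x * y) = u * v" using u by (simp add: real_sqrt_mult)
    ultimately show ?thesis unfolding u(5,6) by (simp add: field_simps)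
  qed
  have "affinity a b \<le> (\<Sum>c\<in>UNIV. (pmf a c + pmf b c) / 2 - (pmf a c - pmf b c)\<^sup>2 / 8)"
    unfolding affinity_def by (intro sum_mono le) (auto simp: pmf_le_1)
  also have "\<dots> = 1 - (pmf a False - pmf b False)\<^sup>2 / 4"
    by (simp add: UNIV_bool pmf_bool_True power2_eq_square field_simps)
  finally show ?thesis .
qed

text \<open>Markov's inequality for the square root of the likelihood ratio, whose integral is the product of
  the affinities.\<close>
lemma emeasure_likelihood_ratio_le:
  assumes I: "finite I" and pos: "\<And>k b. k \<in> I \<Longrightarrow> 0 < pmf (A k) b" "\<And>k b. k \<in> I \<Longrightarrow> 0 < pmf (B k) b"
  shows "emeasure (\<mu> A) {x \<in> space cantor. 1 \<le> (\<Prod>k\<in>I. pmf (B k) (x k) / pmf (A k) (x k))}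
    \<le> ennreal (\<Prod>k\<in>I. affinity (A k) (B k))"
proof -
  define \<phi> where "\<phi> x = (\<Prod>k\<in>I. pmf (B k) (x k) / pmf (A k) (x k))" for x
  have [measurable]: "\<phi> \<in> borel_measurable cantor" unfolding \<phi>_def by measurable
  have sq: "ennreal p * ennreal (sqrt (q / p)) = ennreal (sqrt (p * q))" if "0 < p" "0 < q" for p q
    using that by (subst ennreal_mult[symmetric]) (auto simp: real_sqrt_divide real_sqrt_mult field_simps)
  have sp: "sqrt (\<phi> x) = (\<Prod>k\<in>I. sqrt (pmf (B k) (x k) / pmf (A k) (x k)))" for x
    unfolding \<phi>_def using I by (induction I) (auto simp: real_sqrt_mult real_sqrt_divide)
  have "emeasure (\<mu> A) {x \<in> space cantor. 1 \<le> \<phi> x} =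
      (\<integral>\<^sup>+x. indicator {x \<in> space cantor. 1 \<le> \<phi> x} x \<partial>\<mu> A)"
    by (rule nn_integral_indicator[symmetric]) measurable
  also have "\<dots> \<le> (\<integral>\<^sup>+x. (\<Prod>k\<in>I. ennreal (sqrt (pmf (B k) (x k) / pmf (A k) (x k)))) \<partial>\<mu> A)"
    by (intro nn_integral_mono) (auto simp: prod_ennreal sp[symmetric] ennreal_1[symmetric]
        simp del: ennreal_1 split: split_indicator intro!: ennreal_leI)
  also have "\<dots> = (\<Prod>k\<in>I. \<Sum>b\<in>UNIV. ennreal (pmf (A k) b) * ennreal (sqrt (pmf (B k) b / pmf (A k) b)))"
    by (rule nn_integral_prod_coordinates[OF I])
  also have "\<dots> = ennreal (\<Prod>k\<in>I. affinity (A k) (B k))"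
    by (subst prod_ennreal[symmetric])
      (auto simp: affinity_nonneg affinity_def[symmetric] sq pos sum_nonneg intro!: prod.cong)
  finally show ?thesis unfolding \<phi>_def .
qed

text \<open>On \<open>S\<close> the coordinates in \<open>I\<close> are at least as likely under \<open>B\<close> as under \<open>A\<close>, elsewhere they are less
  likely. When the affinities have a small product, \<open>S\<close> almost separates the two measures; this is
  the singular half of Kakutani's dichotomy.\<close>
lemma separating_set:
  assumes I: "finite I" and pos: "\<And>k b. k \<in> I \<Longrightarrow> 0 < pmf (A k) b" "\<And>k b. k \<in> I \<Longrightarrow> 0 < pmf (B k) b"
  obtains S where "S \<in> sets cantor"
    "emeasure (\<mu> A) S \<le> ennreal (\<Prod>k\<in>I. affinity (A k) (B k))"
    "emeasure (\<mu> B) (- S) \<le> ennreal (\<Prod>k\<in>I. affinity (A k) (B k))"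
proof -
  define S where "S = {x \<in> space cantor. 1 \<le> (\<Prod>k\<in>I. pmf (B k) (x k) / pmf (A k) (x k))}"
  define R where "R = {x \<in> space cantor. 1 \<le> (\<Prod>k\<in>I. pmf (A k) (x k) / pmf (B k) (x k))}"
  have [measurable]: "S \<in> sets cantor" "R \<in> sets cantor" unfolding S_def R_def by measurable
  have "- S \<subseteq> R"
  proof
    fix x assume x: "x \<in> - S"
    define u where "u = (\<Prod>k\<in>I. pmf (B k) (x k) / pmf (A k) (x k))"
    have "0 < u" unfolding u_def by (intro prod_pos) (simp add: pos)
    moreover have "(\<Prod>k\<in>I. pmf (A k) (x k) / pmf (B k) (x k)) = 1 / u"
      by (simp add: u_def prod_dividef)
    ultimately show "x \<in> R" using x by (simp add: R_def S_def u_def[symmetric])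
  qed
  then have "emeasure (\<mu> B) (- S) \<le> emeasure (\<mu> B) R"
    by (intro emeasure_mono) (simp_all add: sets_bernoulli)
  also have "\<dots> \<le> ennreal (\<Prod>k\<in>I. affinity (B k) (A k))"
    unfolding R_def by (rule emeasure_likelihood_ratio_le[OF I pos(2,1)])
  also have "\<dots> = ennreal (\<Prod>k\<in>I. affinity (A k) (B k))" by (simp add: affinity_def mult.commute)
  finally have "emeasure (\<mu> B) (- S) \<le> ennreal (\<Prod>k\<in>I. affinity (A k) (B k))" .
  moreover have "emeasure (\<mu> A) S \<le> ennreal (\<Prod>k\<in>I. affinity (A k) (B k))"
    unfolding S_def by (rule emeasure_likelihood_ratio_le[OF I pos])
  ultimately show thesis by (intro that[of S]) simp_all
qed

section \<open>The nonsingular shift and the derivatives of its iterates\<close>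

definition unshift :: "(int \<Rightarrow> bool) \<Rightarrow> int \<Rightarrow> bool" where
  "unshift w = (\<lambda>k. w (k - 1))"

lemma shift_unshift [simp]: "full_shift (unshift x) = x" "unshift (full_shift x) = x"
  by (auto simp: full_shift_def unshift_def)

lemma full_shift_measurable [measurable]: "full_shift \<in> measurable cantor cantor"
  by (rule measurable_cantorI) (simp add: full_shift_def)

lemma unshift_measurable [measurable]: "unshift \<in> measurable cantor cantor"
  by (rule measurable_cantorI) (simp add: unshift_def)

lemma inv_full_shift: "the_inv_into UNIV full_shift = unshift"
proof -
  have "inj full_shift" by (metis injI shift_unshift(2))
  then show ?thesis by (intro ext the_inv_into_f_eq) auto
qed

lemma full_shift_power: "(full_shift ^^ n) x = (\<lambda>k. x (k + int n))"
  by (induction n arbitrary: x) (auto simp: full_shift_def add_ac)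

lemma full_shift_power_measurable [measurable]: "full_shift ^^ n \<in> measurable cantor cantor"
  by (rule measurable_cantorI) (simp add: full_shift_power)

lemma distr_translate: "distr (\<mu> A) cantor (\<lambda>x k. x (k - int n)) = \<mu> (\<lambda>k. A (k - int n))"
proof (rule bernoulli_eqI)
  fix I :: "int set" and B assume I: "finite I"
  have [measurable]: "(\<lambda>x k. x (k - int n)) \<in> measurable cantor cantor"
    by (rule measurable_cantorI) simp
  have "(\<lambda>x k. x (k - int n)) -` cylinder I B = cylinder ((\<lambda>k. k - int n) ` I) (\<lambda>k. B (k + int n))"
    by (auto simp: cylinder_def)
  then have "emeasure (distr (\<mu> A) cantor (\<lambda>x k. x (k - int n))) (cylinder I B)
     = emeasure (\<mu> A) (cylinder ((\<lambda>k. k - int n) ` I) (\<lambda>k. B (k + int n)))"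
    using I by (subst emeasure_distr) simp_all
  also have "\<dots> = (\<Prod>k\<in>I. emeasure (measure_pmf (A (k - int n))) (B k))"
    using I by (subst emeasure_cylinder) (simp_all add: prod.reindex inj_on_def)
  finally show "emeasure (distr (\<mu> A) cantor (\<lambda>x k. x (k - int n))) (cylinder I B) =
      (\<Prod>k\<in>I. emeasure (measure_pmf (A (k - int n))) (B k))" .
qed simp

notation full_shift ("T")

locale nonsingular_shift =
  fixes P :: "int \<Rightarrow> bool pmf"
  assumes nonsingular: "nonsingular (\<mu> P) T"
begin

definition M :: "(int \<Rightarrow> bool) measure" where "M = \<mu> P"

lemma sets_M [measurable_cong]: "sets M = sets cantor"
  by (simp add: M_def sets_bernoulli)

lemma space_M [simp]: "space M = UNIV"
  by (simp add: M_def)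

sublocale prob_space M
  unfolding M_def by (rule prob_space_bernoulli)

lemma AE_shift:
  assumes "AE x in M. Q x" shows "AE x in M. Q (T x)"
proof -
  have "absolutely_continuous M (distr M M T)"
    using nonsingular unfolding nonsingular_def absolutely_continuous_def M_def by simp
  then have "AE x in distr M M T. Q x"
    by (rule absolutely_continuous_AE[rotated]) (simp_all add: assms)
  then show ?thesis by (rule AE_distrD[rotated]) measurable
qed

lemma AE_shift_power:
  assumes "AE x in M. Q x" shows "AE x in M. Q ((T ^^ n) x)"
proof (induction n)
  case (Suc n)
  from AE_shift[OF this] show ?case by (simp add: funpow_swap1)
qed (simp add: assms)

lemma absolutely_continuous_unshift: "absolutely_continuous M (distr M M unshift)"
  unfolding absolutely_continuous_def
proof
  fix N assume N: "N \<in> null_sets M"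
  then have [measurable]: "N \<in> sets M" by auto
  have "T -` (unshift -` N) = N" by (auto simp: vimage_def)
  then have "emeasure (distr M M T) (unshift -` N \<inter> space M) = emeasure M N"
    by (subst emeasure_distr) (auto simp del: space_M, simp)
  also have "\<dots> = 0" using N by auto
  finally have "unshift -` N \<inter> space M \<in> null_sets (distr M M T)"
    by (intro null_setsI) measurable
  then have "unshift -` N \<inter> space M \<in> null_sets M"
    using nonsingular by (simp add: nonsingular_def M_def)
  then show "N \<in> null_sets (distr M M unshift)"
    by (intro null_setsI) (auto simp: emeasure_distr)
qed

definition jac :: "(int \<Rightarrow> bool) \<Rightarrow> real" where
  "jac = transformation_deriv M T"

lemma jac_eq: "jac x = enn2real (RN_deriv M (distr M M unshift) x)"
  by (simp add: jac_def transformation_deriv_def inv_full_shift)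

lemma jac_measurable [measurable]: "jac \<in> borel_measurable cantor"
proof -
  have "jac \<in> borel_measurable M" unfolding jac_eq by measurable
  then show ?thesis by simp
qed

lemma density_jac: "density M (\<lambda>x. ennreal (jac x)) = distr M M unshift"
proof -
  interpret D: prob_space "distr M M unshift" by (rule prob_space_distr) measurable
  have "AE x in M. RN_deriv M (distr M M unshift) x \<noteq> \<infinity>"
    by (rule RN_deriv_finite[OF D.sigma_finite_measure_axioms absolutely_continuous_unshift]) simp
  then have "AE x in M. ennreal (jac x) = RN_deriv M (distr M M unshift) x"
    unfolding jac_eq by eventually_elim (auto simp: ennreal_enn2real top.not_eq_extremum)
  then have "density M (\<lambda>x. ennreal (jac x)) = density M (RN_deriv M (distr M M unshift))"
    by (intro density_cong) auto
  also have "\<dots> = distr M M unshift"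
    by (rule density_RN_deriv[OF absolutely_continuous_unshift]) simp
  finally show ?thesis .
qed

lemma nn_integral_unshift:
  assumes [measurable]: "g \<in> borel_measurable cantor"
  shows "(\<integral>\<^sup>+x. g (unshift x) \<partial>M) = (\<integral>\<^sup>+x. g x * ennreal (jac x) \<partial>M)"
proof -
  have "(\<integral>\<^sup>+x. g (unshift x) \<partial>M) = (\<integral>\<^sup>+x. g x \<partial>distr M M unshift)"
    by (subst nn_integral_distr) auto
  also have "\<dots> = (\<integral>\<^sup>+x. g x * ennreal (jac x) \<partial>M)"
    unfolding density_jac[symmetric] by (subst nn_integral_density) (auto simp: mult.commute)
  finally show ?thesis .
qed

lemma nn_integral_shift:
  assumes [measurable]: "g \<in> borel_measurable cantor"
  shows "(\<integral>\<^sup>+x. g x \<partial>M) = (\<integral>\<^sup>+x. g (T x) * ennreal (jac x) \<partial>M)"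
  using nn_integral_unshift[of "\<lambda>x. g (T x)"] by simp

lemma jac_nonneg: "0 \<le> jac x"
  by (simp add: jac_eq)

lemma AE_jac_pos: "AE x in M. 0 < jac x"
proof -
  have "(\<integral>\<^sup>+x. indicator {x\<in>space cantor. jac x = 0} (unshift x) \<partial>M) =
      (\<integral>\<^sup>+x. indicator {x\<in>space cantor. jac x = 0} x * ennreal (jac x) \<partial>M)"
    by (rule nn_integral_unshift) measurable
  also have "\<dots> = (\<integral>\<^sup>+x. 0 \<partial>M)" by (intro nn_integral_cong) (auto split: split_indicator)
  finally have "(\<integral>\<^sup>+x. indicator {x\<in>space cantor. jac x = 0} (unshift x) \<partial>M) = 0" by simp
  then have "AE x in M. indicator {x\<in>space cantor. jac x = 0} (unshift x) = (0::ennreal)"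
    by (subst nn_integral_0_iff_AE[symmetric]) simp_all
  from AE_shift[OF this] have "AE x in M. jac x \<noteq> 0"
    by (auto elim!: eventually_mono simp: indicator_def)
  then show ?thesis using jac_nonneg by (auto elim!: eventually_mono simp: less_le)
qed

text \<open>By the chain rule this is the logarithm of the derivative of the \<open>n\<close>-th iterate.\<close>
definition logjac :: "nat \<Rightarrow> (int \<Rightarrow> bool) \<Rightarrow> real" where
  "logjac n x = (\<Sum>j<n. ln (jac ((T ^^ j) x)))"

lemma logjac_measurable [measurable]: "logjac n \<in> borel_measurable cantor"
  unfolding logjac_def by measurable

lemma logjac_0 [simp]: "logjac 0 x = 0"
  by (simp add: logjac_def)

lemma logjac_add: "logjac (m + n) x = logjac m x + logjac n ((T ^^ m) x)"
proof -
  have "(\<Sum>j<m + n. ln (jac ((T ^^ j) x))) =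
     (\<Sum>j<m. ln (jac ((T ^^ j) x))) + (\<Sum>j<n. ln (jac ((T ^^ (j + m)) x)))"
    by (induction n) (auto simp: add_ac)
  then show ?thesis by (simp add: logjac_def funpow_add)
qed

lemma logjac_Suc: "logjac (Suc n) x = ln (jac x) + logjac n (T x)"
  using logjac_add[of 1 n x] by (simp add: logjac_def)

lemma nn_integral_shift_power:
  assumes [measurable]: "g \<in> borel_measurable cantor"
  shows "(\<integral>\<^sup>+x. g x \<partial>M) = (\<integral>\<^sup>+x. g ((T ^^ n) x) * ennreal (exp (logjac n x)) \<partial>M)"
proof (induction n)
  case (Suc n)
  have "(\<integral>\<^sup>+x. g x \<partial>M) = (\<integral>\<^sup>+x. g ((T ^^ n) x) * ennreal (exp (logjac n x)) \<partial>M)" by fact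
  also have "\<dots> = (\<integral>\<^sup>+x. g ((T ^^ n) (T x)) * ennreal (exp (logjac n (T x))) * ennreal (jac x) \<partial>M)"
    by (rule nn_integral_shift) measurable
  also have "\<dots> = (\<integral>\<^sup>+x. g ((T ^^ Suc n) x) * ennreal (exp (logjac (Suc n) x)) \<partial>M)"
  proof (rule nn_integral_cong_AE)
    show "AE x in M. g ((T ^^ n) (T x)) * ennreal (exp (logjac n (T x))) * ennreal (jac x)
        = g ((T ^^ Suc n) x) * ennreal (exp (logjac (Suc n) x))"
      using AE_jac_pos
    proof eventually_elim
      case (elim x)
      then have "ennreal (exp (logjac (Suc n) x)) = ennreal (exp (logjac n (T x))) * ennreal (jac x)"
        by (subst ennreal_mult[symmetric]) (auto simp: logjac_Suc exp_add mult.commute)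
      then show ?case
        by (simp add: funpow_swap1 mult.assoc)
    qed
  qed
  finally show ?case .
qed simp

lemma emeasure_coordinate: "emeasure M {x. x k = b} = ennreal (pmf (P k) b)"
proof -
  have "{x. x k = b} = cylinder {k} (\<lambda>_. {b})" by (auto simp: cylinder_def)
  then show ?thesis by (simp only: M_def emeasure_cylinder[OF finite.emptyI[THEN finite.insertI]]) (simp add: emeasure_pmf_single)
qed

text \<open>The shift pulls the event \<open>x k = b\<close> back to \<open>x (k + 1) = b\<close>, and it preserves null sets in both
  directions.\<close>
lemma pmf_pos_step: "pmf (P (k + 1)) b = 0 \<longleftrightarrow> pmf (P k) b = 0"
proof -
  let ?S = "{x \<in> space cantor. x k = b}"
  have sets: "?S \<in> sets M" by measurable
  have "T -` ?S \<inter> space M = {x. x (k + 1) = b}"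
    by (auto simp: full_shift_def)
  then have "emeasure (distr M M T) ?S = emeasure M {x. x (k + 1) = b}"
    using sets by (subst emeasure_distr) simp_all
  then have "emeasure (distr M M T) ?S = ennreal (pmf (P (k + 1)) b)"
    unfolding emeasure_coordinate .
  moreover have "emeasure M ?S = ennreal (pmf (P k) b)"
    using emeasure_coordinate[of k b] by simp
  moreover have "?S \<in> null_sets (distr M M T) \<longleftrightarrow> ?S \<in> null_sets M"
    using nonsingular unfolding nonsingular_def M_def[symmetric] by simp
  ultimately show ?thesis using sets by (simp add: null_sets_def)
qed

end

locale half_stationary_shift = nonsingular_shift +
  fixes p :: real
  assumes p: "0 < p" "p < 1" and past: "\<And>k. k \<le> 0 \<Longrightarrow> pmf (P k) False = p"
begin

lemma pmf_pos: "0 < pmf (P k) b"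
proof -
  have "pmf (P 0) b \<noteq> 0" using past[of 0] p pmf_bool_True[of "P 0"] by (cases b) auto
  then have "pmf (P k) b \<noteq> 0"
  proof (induction k rule: int_induct[where k=0])
    case (step1 i) then show ?case using pmf_pos_step by auto
  next
    case (step2 i) then show ?case using pmf_pos_step[of "i - 1"] by auto
  qed
  then show ?thesis by (simp add: less_le)
qed

lemma past_eq: "k \<le> 0 \<Longrightarrow> P k = P 0"
proof (rule pmf_eqI)
  fix b assume "k \<le> 0" then show "pmf (P k) b = pmf (P 0) b"
    using past[of k] past[of 0] pmf_bool_True[of "P 0"] pmf_bool_True[of "P k"] by (cases b) auto
qed

lemma AE_flip_M: "AE x in M. Q x \<Longrightarrow> AE x in M. Q (flip k x)"
  unfolding M_def by (rule AE_flip[OF pmf_pos])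

end

section \<open>The derivatives of the iterates do not tend to zero\<close>

definition translate :: "int \<Rightarrow> (int \<Rightarrow> bool) \<Rightarrow> int \<Rightarrow> bool" where
  "translate i x = (\<lambda>k. x (k + i))"

lemma translate_measurable [measurable]: "translate i \<in> measurable cantor cantor"
  by (rule measurable_cantorI) (simp add: translate_def)

lemma translate_translate [simp]: "translate i (translate j x) = translate (i + j) x"
  by (simp add: translate_def add_ac)

lemma translate_0 [simp]: "translate 0 x = x"
  by (simp add: translate_def)

lemma full_shift_power_translate: "(T ^^ n) x = translate (int n) x"
  by (simp add: full_shift_power translate_def)

text \<open>Divergence to \<open>- \<infinity>\<close>, with countable quantifiers only, so that the set of points where it occurs is
  measurable by inspection.\<close>
definition drift :: "(nat \<Rightarrow> real) \<Rightarrow> bool" where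
  "drift s \<longleftrightarrow> (\<forall>c::nat. \<exists>N. \<forall>n. N \<le> n \<longrightarrow> s n < - real c)"

context nonsingular_shift
begin

definition last_max :: "(int \<Rightarrow> bool) \<Rightarrow> bool" where
  "last_max x \<longleftrightarrow> (\<forall>n. logjac (Suc n) x < 0)"

lemma last_max_measurable [measurable]: "Measurable.pred cantor last_max"
  unfolding last_max_def by measurable

text \<open>A sequence that tends to \<open>- \<infinity>\<close> attains its maximum, and it does so for a last time \<open>m\<close>; the cocycle
  identity turns this into a statement about the point reached at time \<open>m\<close>.\<close>
lemma drift_last_max:
  assumes "drift (\<lambda>n. logjac n x)"
  shows "\<exists>m. last_max (translate (int m) x)"
proof -
  obtain N where N: "\<And>n. N \<le> n \<Longrightarrow> logjac n x < 0"
    using assms unfolding drift_def by (metis of_nat_0 neg_0_equal_iff_equal)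
  define v where "v = Max ((\<lambda>n. logjac n x) ` {..N})"
  define S where "S = {n. n \<le> N \<and> logjac n x = v}"
  have "v \<in> (\<lambda>n. logjac n x) ` {..N}" unfolding v_def by (intro Max_in) auto
  then have "S \<noteq> {}" "finite S" by (auto simp: S_def)
  then have m: "Max S \<in> S" "\<And>n. n \<in> S \<Longrightarrow> n \<le> Max S" by auto
  have le: "logjac n x \<le> v" if "n \<le> N" for n unfolding v_def using that by (intro Max_ge) auto
  have "logjac (Suc n) (translate (int (Max S)) x) < 0" for n
  proof -
    have "logjac (Max S + Suc n) x < v"
    proof (cases "Max S + Suc n \<le> N")
      case True
      then have "Max S + Suc n \<in> S" if "logjac (Max S + Suc n) x = v"
        using that unfolding S_def by blast
      then have "logjac (Max S + Suc n) x \<noteq> v" using m(2)[of "Max S + Suc n"] by linarith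
      then show ?thesis using le[OF True] by simp
    next
      case False
      then show ?thesis using N[of "Max S + Suc n"] le[of 0] by simp
    qed
    then show ?thesis
      using m(1) logjac_add[of "Max S" "Suc n" x] by (simp add: S_def full_shift_power_translate)
  qed
  then show ?thesis by (auto simp: last_max_def)
qed

lemma AE_last_max_drift:
  assumes "AE x in M. \<not> (last_max x \<and> drift (\<lambda>n. logjac n x))"
  shows "AE x in M. \<not> drift (\<lambda>n. logjac n x)"
proof -
  have "AE x in M. \<forall>m. \<not> (last_max (translate (int m) x) \<and> drift (\<lambda>n. logjac n (translate (int m) x)))"
    using AE_shift_power[OF assms] by (simp add: AE_all_countable full_shift_power_translate)
  moreover have "drift (\<lambda>n. logjac n (translate (int m) x))" if d: "drift (\<lambda>n. logjac n x)" for x m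
    unfolding drift_def
  proof
    fix c :: nat
    obtain d :: nat where e: "real c - logjac m x < real d" using reals_Archimedean2 by blast
    obtain N where N: "\<And>n. N \<le> n \<Longrightarrow> logjac n x < - real d" using d unfolding drift_def by blast
    have "logjac n (translate (int m) x) < - real c" if "N \<le> n" for n
      using N[of "m + n"] that e logjac_add[of m n x] by (simp add: full_shift_power_translate)
    then show "\<exists>N. \<forall>n. N \<le> n \<longrightarrow> logjac n (translate (int m) x) < - real c" by blast
  qed
  ultimately show ?thesis using drift_last_max by (fastforce elim!: eventually_mono)
qed

text \<open>Let \<open>B\<close> be the set of points with drift at which time \<open>0\<close> is the last maximum. By conservativity
  almost every point of \<open>B\<close> has visited \<open>B\<close> before. Decompose \<open>B\<close> according to the time since the
  latest earlier visit and transport each piece back to that visit: the transported pieces are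
  disjoint subsets of \<open>B\<close>, and the density \<open>exp (logjac n)\<close> of the transport is less than \<open>1\<close> on \<open>B\<close>.
  So \<open>M B\<close> would be smaller than itself if it were positive. Every orbit with drift meets \<open>B\<close>.\<close>
lemma not_drift:
  assumes cons: "conservative M T"
  shows "AE x in M. \<not> drift (\<lambda>n. logjac n x)"
proof (rule AE_last_max_drift)
  define B where "B x \<longleftrightarrow> last_max x \<and> drift (\<lambda>n. logjac n x)" for x
  have [measurable]: "Measurable.pred cantor B" unfolding B_def drift_def by measurable
  \<comment> \<open>the points of \<open>B\<close> that have not visited \<open>B\<close> before\<close>
  define W where "W = {x \<in> space cantor. B x \<and> (\<forall>n. \<not> B (translate (- int (Suc n)) x))}"
  have [measurable]: "W \<in> sets cantor" unfolding W_def by measurable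
  have disj: "\<not> (translate (int m) z \<in> W \<and> translate (int n) z \<in> W)" if "m < n" for m n z
  proof
    assume *: "translate (int m) z \<in> W \<and> translate (int n) z \<in> W"
    obtain d where d: "n = m + Suc d" using less_imp_Suc_add[OF \<open>m < n\<close>] by auto
    have "\<not> B (translate (- int (Suc d)) (translate (int n) z))" using * by (auto simp: W_def)
    then show False using * by (simp add: d W_def)
  qed
  have "wandering M T W"
    unfolding wandering_def eq_mod_null_def
  proof (intro conjI allI impI)
    show "W \<in> sets M" by measurable
    fix m n :: nat assume "m \<noteq> n"
    then have "((T ^^ m) -` W \<inter> space M) \<inter> ((T ^^ n) -` W \<inter> space M) = {}"
      using disj[of m n] disj[of n m] by (auto simp: full_shift_power_translate neq_iff)
    then show "((T ^^ m) -` W \<inter> space M) \<inter> ((T ^^ n) -` W \<inter> space M) - {} \<union>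
        ({} - ((T ^^ m) -` W \<inter> space M) \<inter> ((T ^^ n) -` W \<inter> space M)) \<in> null_sets M"
      by simp
  qed
  then have "W \<in> null_sets M" using cons by (simp add: conservative_def)
  then have W: "AE x in M. x \<notin> W" by (rule AE_not_in)
  \<comment> \<open>the latest earlier visit to \<open>B\<close> was \<open>n + 1\<close> steps ago\<close>
  define R where "R n x \<longleftrightarrow> B x \<and> B (translate (- int (Suc n)) x) \<and>
      (\<forall>j<n. \<not> B (translate (- int (Suc j)) x))" for n x
  have [measurable]: "Measurable.pred cantor (R n)" for n unfolding R_def by measurable
  define b :: "_ \<Rightarrow> ennreal" where "b x = indicator {x \<in> space cantor. B x} x" for x
  \<comment> \<open>the density that arises when all pieces are transported back\<close>
  define s :: "_ \<Rightarrow> ennreal" where "s x = (\<Sum>n. indicator {x \<in> space cantor. R n x} ((T ^^ Suc n) x)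
      * ennreal (exp (logjac (Suc n) x)))" for x
  have [measurable]: "b \<in> borel_measurable cantor" "s \<in> borel_measurable cantor"
    unfolding b_def s_def by measurable
  have first: "\<exists>n. R n x" if "B x" "x \<notin> W" for x
  proof -
    have ex: "\<exists>n. B (translate (- int (Suc n)) x)" using that by (auto simp: W_def)
    have "R (LEAST n. B (translate (- int (Suc n)) x)) x"
      unfolding R_def using LeastI_ex[OF ex] not_less_Least that by auto
    then show ?thesis ..
  qed
  \<comment> \<open>disjointness of the transported pieces: the sum has at most one nonzero term\<close>
  have s_single: "s x = ennreal (exp (logjac (Suc n) x))" if "R n (translate (int (Suc n)) x)" for n x
  proof -
    have "\<not> R m (translate (int (Suc m)) x)" if "m \<noteq> n" for m
    proof
      assume m: "R m (translate (int (Suc m)) x)"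
      have B: "B (translate (int (Suc m)) x)" "B (translate (int (Suc n)) x)"
        using m \<open>R n _\<close> by (auto simp: R_def)
      have "m < n \<or> n < m" using that by auto
      then show False
      proof
        assume "m < n"
        then have "n - Suc m < n" "translate (- int (Suc (n - Suc m))) (translate (int (Suc n)) x) = translate (int (Suc m)) x"
          by (auto simp: add.commute)
        then show False using \<open>R n _\<close> B(1) unfolding R_def by metis
      next
        assume "n < m"
        then have "m - Suc n < m" "translate (- int (Suc (m - Suc n))) (translate (int (Suc m)) x) = translate (int (Suc n)) x"
          by (auto simp: add.commute)
        then show False using m B(2) unfolding R_def by metis
      qed
    qed
    then have "s x = (\<Sum>m\<in>{n}. indicator {x \<in> space cantor. R m x} ((T ^^ Suc m) x)
      * ennreal (exp (logjac (Suc m) x)))"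
      unfolding s_def
      by (intro suminf_finite) (auto simp: full_shift_power_translate simp del: funpow.simps of_nat_Suc)
    then show ?thesis using that by (simp add: full_shift_power_translate del: funpow.simps of_nat_Suc)
  qed
  have s_zero: "s x = 0" if "\<And>n. \<not> R n (translate (int (Suc n)) x)" for x
    using that by (simp add: s_def full_shift_power_translate del: funpow.simps of_nat_Suc)
  have s_le: "s x \<le> b x \<and> (B x \<longrightarrow> s x < 1)" for x
  proof (cases "\<exists>n. R n (translate (int (Suc n)) x)")
    case True
    then obtain n where n: "R n (translate (int (Suc n)) x)" by blast
    then have B: "B x" by (simp add: R_def)
    then have "logjac (Suc n) x < 0" by (auto simp: B_def last_max_def)
    then have "s x < 1" unfolding s_single[OF n] by simp
    then show ?thesis using B by (auto simp: b_def less_imp_le)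
  next
    case False
    then show ?thesis using s_zero[of x] by simp
  qed
  have "(\<integral>\<^sup>+x. b x \<partial>M) \<le> (\<integral>\<^sup>+x. (\<Sum>n. indicator {x \<in> space cantor. R n x} x) \<partial>M)"
  proof (rule nn_integral_mono_AE)
    show "AE x in M. b x \<le> (\<Sum>n. indicator {x \<in> space cantor. R n x} x)"
      using W
    proof eventually_elim
      fix x assume "x \<notin> W"
      show "b x \<le> (\<Sum>n. indicator {x \<in> space cantor. R n x} x)"
      proof (cases "B x")
        case True
        then obtain n where n: "R n x" using first \<open>x \<notin> W\<close> by blast
        have "(\<Sum>m\<in>{n}. indicator {x \<in> space cantor. R m x} x) \<le> (\<Sum>m. indicator {x \<in> space cantor. R m x} x :: ennreal)"
          by (rule sum_le_suminf) auto
        then show ?thesis using n True by (simp add: b_def)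
      qed (simp add: b_def)
    qed
  qed
  also have "\<dots> = (\<Sum>n. \<integral>\<^sup>+x. indicator {x \<in> space cantor. R n x} x \<partial>M)"
    by (rule nn_integral_suminf) measurable
  also have "\<dots> = (\<Sum>n. \<integral>\<^sup>+x. indicator {x \<in> space cantor. R n x} ((T ^^ Suc n) x)
      * ennreal (exp (logjac (Suc n) x)) \<partial>M)"
    by (intro suminf_cong nn_integral_shift_power) measurable
  also have "\<dots> = (\<integral>\<^sup>+x. s x \<partial>M)"
    unfolding s_def by (rule nn_integral_suminf[symmetric]) measurable
  finally have le: "(\<integral>\<^sup>+x. b x \<partial>M) \<le> (\<integral>\<^sup>+x. s x \<partial>M)" .
  have fin: "(\<integral>\<^sup>+x. s x \<partial>M) \<noteq> \<infinity>"
  proof -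
    have "(\<integral>\<^sup>+x. s x \<partial>M) \<le> (\<integral>\<^sup>+x. 1 \<partial>M)"
    proof (rule nn_integral_mono)
      fix x
      have "b x \<le> 1" by (simp add: b_def indicator_def)
      then show "s x \<le> 1" using s_le[of x] order.trans by blast
    qed
    also have "\<dots> < \<infinity>" using emeasure_space_1 by simp
    finally show ?thesis by simp
  qed
  have "AE x in M. b x \<le> s x"
  proof (rule ccontr)
    assume "\<not> (AE x in M. b x \<le> s x)"
    then have "(\<integral>\<^sup>+x. s x \<partial>M) < (\<integral>\<^sup>+x. b x \<partial>M)"
      using s_le fin by (intro nn_integral_less) auto
    then show False using le by simp
  qed
  then show "AE x in M. \<not> (last_max x \<and> drift (\<lambda>n. logjac n x))"
  proof eventually_elim
    fix x assume le: "b x \<le> s x"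
    show "\<not> (last_max x \<and> drift (\<lambda>n. logjac n x))"
    proof
      assume "last_max x \<and> drift (\<lambda>n. logjac n x)"
      then have "B x" by (simp add: B_def)
      then have "b x = 1" "s x < 1" using s_le[of x] by (simp_all add: b_def)
      then show False using le by simp
    qed
  qed
qed

end

section \<open>The derivative depends only on the future\<close>

lemma nn_integral_glue_mult:
  assumes [measurable]: "f \<in> borel_measurable cantor" "g \<in> borel_measurable cantor"
  shows "(\<integral>\<^sup>+x. f x * (\<integral>\<^sup>+w. g (glue J x w) \<partial>\<mu> A) \<partial>\<mu> A) =
    (\<integral>\<^sup>+x. (\<integral>\<^sup>+w. f (glue J x w) \<partial>\<mu> A) * g x \<partial>\<mu> A)"
proof -
  interpret prob_space "\<mu> A" by (rule prob_space_bernoulli)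
  have eq: "(\<integral>\<^sup>+x. f x * (\<integral>\<^sup>+w. g (glue J x w) \<partial>\<mu> A) \<partial>\<mu> A) =
    (\<integral>\<^sup>+x. (\<integral>\<^sup>+w. f (glue J x w) \<partial>\<mu> A) *
      (\<integral>\<^sup>+w. g (glue J x w) \<partial>\<mu> A) \<partial>\<mu> A)"
    if [measurable]: "f \<in> borel_measurable cantor" "g \<in> borel_measurable cantor" for f g
  proof -
    have "(\<integral>\<^sup>+x. f x * (\<integral>\<^sup>+w. g (glue J x w) \<partial>\<mu> A) \<partial>\<mu> A) =
       (\<integral>\<^sup>+x. \<integral>\<^sup>+v. f (glue J x v) * (\<integral>\<^sup>+w. g (glue J (glue J x v) w) \<partial>\<mu> A)
         \<partial>\<mu> A \<partial>\<mu> A)"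
      by (rule nn_integral_glue_same[symmetric]) measurable
    also have "\<dots> = (\<integral>\<^sup>+x. (\<integral>\<^sup>+w. f (glue J x w) \<partial>\<mu> A) *
      (\<integral>\<^sup>+w. g (glue J x w) \<partial>\<mu> A) \<partial>\<mu> A)"
      by (simp add: glue_glue nn_integral_multc)
    finally show ?thesis .
  qed
  show ?thesis
    using eq[OF assms] eq[OF assms(2,1)] by (simp add: mult.commute)
qed

context nonsingular_shift
begin

lemma nn_integral_shifted_product:
  assumes [measurable]: "g \<in> borel_measurable cantor"
  shows "(\<integral>\<^sup>+x. g x \<partial>\<mu> (\<lambda>k. P (k - int n))) = (\<integral>\<^sup>+x. g x * ennreal (exp (logjac n x)) \<partial>M)"
proof -
  have m: "(\<lambda>x k. x (k - int n)) = translate (- int n)" by (auto simp: translate_def)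
  have "(\<integral>\<^sup>+x. g x \<partial>\<mu> (\<lambda>k. P (k - int n))) = (\<integral>\<^sup>+x. g (translate (- int n) x) \<partial>M)"
    unfolding distr_translate[symmetric] M_def m by (subst nn_integral_distr) auto
  also have "\<dots> = (\<integral>\<^sup>+x. g (translate (- int n) ((T ^^ n) x)) * ennreal (exp (logjac n x)) \<partial>M)"
    by (rule nn_integral_shift_power) measurable
  finally show ?thesis by (simp add: full_shift_power_translate)
qed

end

context half_stationary_shift
begin

text \<open>Averaging the derivative over the nonpositive coordinates yields a density of the same measure,
  because the shifted measure and \<open>M\<close> have the same marginals there. By uniqueness of densities the
  derivative coincides with its average.\<close>
lemma AE_jac_glue_future: "AE x in M. AE w in M. jac (glue {1..} x w) = jac x"
proof -
  define jac0 where "jac0 x = (\<integral>\<^sup>+w. ennreal (jac (glue {1..} x w)) \<partial>M)" for x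
  have [measurable]: "jac0 \<in> borel_measurable cantor" unfolding jac0_def by measurable
  have "density M jac0 = density M (\<lambda>x. ennreal (jac x))"
  proof (rule measure_eqI)
    fix S assume "S \<in> sets (density M jac0)"
    then have [measurable]: "S \<in> sets cantor" by (simp add: sets_M)
    have past': "(\<lambda>k. if k \<in> {1..} then P (k - int 1) else P k) = (\<lambda>k. P (k - int 1))"
    proof
      fix k show "(if k \<in> {1..} then P (k - int 1) else P k) = P (k - int 1)"
        using past_eq[of k] past_eq[of "k - 1"] by simp
    qed
    have "emeasure (density M jac0) S = (\<integral>\<^sup>+x. indicator S x * jac0 x \<partial>M)"
      by (subst emeasure_density) (simp_all add: mult.commute)
    also have "\<dots> = (\<integral>\<^sup>+x. (\<integral>\<^sup>+w. indicator S (glue {1..} x w) \<partial>M) * ennreal (jac x) \<partial>M)"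
      unfolding jac0_def M_def by (rule nn_integral_glue_mult) measurable
    also have "\<dots> = (\<integral>\<^sup>+x. (\<integral>\<^sup>+w. indicator S (glue {1..} x w) \<partial>M) * ennreal (exp (logjac 1 x)) \<partial>M)"
      using AE_jac_pos by (intro nn_integral_cong_AE) (auto elim!: eventually_mono simp: logjac_def)
    also have "\<dots> = (\<integral>\<^sup>+x. (\<integral>\<^sup>+w. indicator S (glue {1..} x w) \<partial>M) \<partial>\<mu> (\<lambda>k. P (k - int 1)))"
      by (rule nn_integral_shifted_product[symmetric]) measurable
    also have "\<dots> = (\<integral>\<^sup>+x. indicator S x \<partial>\<mu> (\<lambda>k. P (k - int 1)))"
      unfolding M_def by (subst nn_integral_glue[symmetric]) (simp_all only: past', measurable)
    also have "\<dots> = (\<integral>\<^sup>+x. indicator S x * ennreal (exp (logjac 1 x)) \<partial>M)"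
      by (rule nn_integral_shifted_product) measurable
    also have "\<dots> = (\<integral>\<^sup>+x. indicator S x * ennreal (jac x) \<partial>M)"
      using AE_jac_pos by (intro nn_integral_cong_AE) (auto elim!: eventually_mono simp: logjac_def)
    also have "\<dots> = emeasure (density M (\<lambda>x. ennreal (jac x))) S"
      by (subst emeasure_density) (simp_all add: mult.commute)
    finally show "emeasure (density M jac0) S = emeasure (density M (\<lambda>x. ennreal (jac x))) S" .
  qed simp
  then have eq: "AE x in M. jac0 x = ennreal (jac x)"
    by (subst (asm) density_unique_iff) auto
  have "AE x in M. AE w in M. jac0 (glue {1..} x w) = ennreal (jac (glue {1..} x w))"
    using AE_glue[of "\<lambda>x. jac0 x = ennreal (jac x)" P "{1..}"] eq unfolding M_def by simp
  then show ?thesis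
    using eq
  proof eventually_elim
    case (elim x)
    have "jac0 (glue {1..} x w) = jac0 x" for w by (simp add: jac0_def glue_glue)
    with elim show ?case
      by (auto elim!: eventually_mono simp: jac_nonneg)
  qed
qed

text \<open>Resampling off \<open>J\<close> and then off the positive coordinates amounts to the second resampling alone.\<close>
lemma AE_jac_glue:
  assumes J: "{1..} \<subseteq> J"
  shows "AE x in M. AE w in M. jac (glue J x w) = jac x"
proof -
  have "AE x in M. AE w in M. AE v in M. jac (glue {1..} (glue J x w) v) = jac (glue J x w)"
    using AE_glue[of "\<lambda>x. AE v in M. jac (glue {1..} x v) = jac x" P J] AE_jac_glue_future
    unfolding M_def by simp
  then show ?thesis
    using AE_jac_glue_future
  proof eventually_elim
    case (elim x)
    note x = elim(2)
    from elim(1) show ?case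
    proof eventually_elim
      case (elim w)
      then have "AE v in M. jac x = jac (glue J x w)"
        using x by eventually_elim (simp add: glue_glue J)
      then show ?case by simp
    qed
  qed
qed

text \<open>The difference of the log-odds of the \<open>k\<close>-th marginal and of the marginals in the past.\<close>
definition flip_gap :: "int \<Rightarrow> real" where
  "flip_gap k = ln (pmf (P k) False / pmf (P k) True) - ln (p / (1 - p))"

abbreviation signed_gap :: "int \<Rightarrow> (int \<Rightarrow> bool) \<Rightarrow> real" where
  "signed_gap k x \<equiv> if x k then flip_gap k else - flip_gap k"

text \<open>For \<open>n = k\<close> the function \<open>exp (logjac n)\<close> is the density, with respect to \<open>M\<close>, of the product measure
  with marginals \<open>P (i - k)\<close>. At coordinate \<open>k\<close> that measure has the marginal \<open>P 0\<close>. Flipping the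
  coordinate multiplies each of the two measures by its own ratio of weights, so by uniqueness of
  densities the density changes by the quotient of the ratios.\<close>
lemma AE_logjac_flip:
  assumes k: "1 \<le> k"
  shows "AE x in M. logjac (nat k) (flip k x) = logjac (nat k) x - signed_gap k x"
proof -
  let ?n = "nat k"
  let ?P = "\<lambda>i. P (i - int ?n)"
  define r where "r x = pmf (P k) (\<not> x k) / pmf (P k) (x k)" for x :: "int \<Rightarrow> bool"
  define r0 where "r0 x = pmf (P 0) (\<not> x k) / pmf (P 0) (x k)" for x :: "int \<Rightarrow> bool"
  have [measurable]: "r \<in> borel_measurable cantor" "r0 \<in> borel_measurable cantor"
    unfolding r_def r0_def by measurable
  have r_pos: "0 < r x" "0 < r0 x" for x by (auto simp: r_def r0_def pmf_pos)
  have P0: "?P k = P 0" using k by simp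
  have flipP: "(\<integral>\<^sup>+x. g (flip k x) \<partial>M) = (\<integral>\<^sup>+x. g x * ennreal (r x) \<partial>M)"
    if [measurable]: "g \<in> borel_measurable cantor" for g
    unfolding M_def r_def by (rule nn_integral_flip[OF that pmf_pos])
  have flipQ: "(\<integral>\<^sup>+x. g (flip k x) \<partial>\<mu> ?P) = (\<integral>\<^sup>+x. g x * ennreal (r0 x) \<partial>\<mu> ?P)"
    if [measurable]: "g \<in> borel_measurable cantor" for g
    unfolding r0_def P0[symmetric] by (rule nn_integral_flip[where A="?P", OF that pmf_pos])
  have "density M (\<lambda>x. ennreal (exp (logjac ?n (flip k x)) * r x)) = density M (\<lambda>x. ennreal (exp (logjac ?n x) * r0 x))"
  proof (rule measure_eqI)
    fix S assume "S \<in> sets (density M (\<lambda>x. ennreal (exp (logjac ?n (flip k x)) * r x)))"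
    then have [measurable]: "S \<in> sets cantor" by (simp add: sets_M)
    have "emeasure (density M (\<lambda>x. ennreal (exp (logjac ?n (flip k x)) * r x))) S =
        (\<integral>\<^sup>+x. indicator S x * ennreal (exp (logjac ?n (flip k x))) * ennreal (r x) \<partial>M)"
      by (subst emeasure_density) (simp_all add: ennreal_mult r_pos less_imp_le mult_ac)
    also have "\<dots> = (\<integral>\<^sup>+x. indicator S (flip k x) * ennreal (exp (logjac ?n x)) \<partial>M)"
      by (subst flipP[symmetric]) simp_all
    also have "\<dots> = (\<integral>\<^sup>+x. indicator S (flip k x) \<partial>\<mu> ?P)"
      by (rule nn_integral_shifted_product[symmetric]) measurable
    also have "\<dots> = (\<integral>\<^sup>+x. indicator S x * ennreal (r0 x) \<partial>\<mu> ?P)"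
      by (rule flipQ) measurable
    also have "\<dots> = (\<integral>\<^sup>+x. indicator S x * ennreal (r0 x) * ennreal (exp (logjac ?n x)) \<partial>M)"
      by (rule nn_integral_shifted_product) measurable
    also have "\<dots> = emeasure (density M (\<lambda>x. ennreal (exp (logjac ?n x) * r0 x))) S"
      by (subst emeasure_density) (simp_all add: ennreal_mult r_pos less_imp_le mult_ac)
    finally show "emeasure (density M (\<lambda>x. ennreal (exp (logjac ?n (flip k x)) * r x))) S =
       emeasure (density M (\<lambda>x. ennreal (exp (logjac ?n x) * r0 x))) S" .
  qed simp
  then have "AE x in M. ennreal (exp (logjac ?n (flip k x)) * r x) = ennreal (exp (logjac ?n x) * r0 x)"
    by (subst (asm) density_unique_iff) auto
  then show ?thesis
  proof eventually_elim
    fix x assume "ennreal (exp (logjac ?n (flip k x)) * r x) = ennreal (exp (logjac ?n x) * r0 x)"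
    then have "exp (logjac ?n (flip k x)) * r x = exp (logjac ?n x) * r0 x"
      using r_pos[of x] by (subst (asm) ennreal_inj) auto
    then have "logjac ?n (flip k x) + ln (r x) = logjac ?n x + ln (r0 x)"
      using r_pos[of x] by (metis exp_gt_zero ln_exp ln_mult_pos)
    moreover have "ln (r x) - ln (r0 x) = signed_gap k x"
      using pmf_pos[of k] past[of 0] p pmf_bool_True[of "P 0"]
      by (auto simp: r_def r0_def flip_gap_def ln_div)
    ultimately show "logjac ?n (flip k x) = logjac ?n x - signed_gap k x"
      by linarith
  qed
qed

end

section \<open>What nonsingularity and conservativity say about the marginals\<close>

lemma AE_eventually_geometric:
  assumes "prob_space N" and "\<And>n. S n \<in> sets N" and r: "0 \<le> r" "r < 1"
    and "\<And>n. emeasure N (S n) \<le> ennreal (r ^ n)"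
  shows "AE x in N. eventually (\<lambda>n. x \<notin> S n) sequentially"
proof -
  interpret prob_space N by fact
  have "AE x in N. \<forall>\<^sub>F n in sequentially. x \<in> space N - S n"
  proof (rule borel_cantelli_AE1)
    show "summable (\<lambda>n. measure N (S n))"
    proof (rule summable_comparison_test_ev[OF always_eventually])
      show "\<forall>n. norm (measure N (S n)) \<le> r ^ n"
        using assms(5) r(1) by (auto simp: emeasure_eq_measure)
    qed (use r in \<open>simp add: summable_geometric\<close>)
  qed (simp_all add: assms(2) less_top[symmetric])
  then show ?thesis by (auto elim!: eventually_mono)
qed

lemma AE_tendsto_0_of_summable_integrals:
  fixes f :: "nat \<Rightarrow> 'a \<Rightarrow> real"
  assumes [measurable]: "\<And>n. f n \<in> borel_measurable N" and f: "\<And>n x. 0 \<le> f n x"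
    and r: "0 \<le> r" "r < 1" and le: "\<And>n. (\<integral>\<^sup>+x. ennreal (f n x) \<partial>N) \<le> ennreal (r ^ n)"
  shows "AE x in N. (\<lambda>n. f n x) \<longlonglongrightarrow> 0"
proof -
  have "(\<integral>\<^sup>+x. (\<Sum>n. ennreal (f n x)) \<partial>N) = (\<Sum>n. \<integral>\<^sup>+x. ennreal (f n x) \<partial>N)"
    by (rule nn_integral_suminf) measurable
  also have "\<dots> \<le> (\<Sum>n. ennreal (r ^ n))"
    by (intro suminf_le le) auto
  also have "\<dots> = ennreal (\<Sum>n. r ^ n)"
    using r by (intro suminf_ennreal2) (auto simp: summable_geometric)
  also have "\<dots> < \<infinity>" by simp
  finally have "AE x in N. (\<Sum>n. ennreal (f n x)) \<noteq> \<infinity>"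
    by (intro nn_integral_PInf_AE) (auto simp: top.not_eq_extremum)
  then show ?thesis
  proof eventually_elim
    fix x assume "(\<Sum>n. ennreal (f n x)) \<noteq> \<infinity>"
    then have "summable (\<lambda>n. f n x)" using f by (intro summable_suminf_not_top) auto
    then show "(\<lambda>n. f n x) \<longlonglongrightarrow> 0" by (rule summable_LIMSEQ_zero)
  qed
qed

context half_stationary_shift
begin

lemma affinity_prod_le:
  assumes "finite I" "\<And>k. k \<in> I \<Longrightarrow> \<epsilon> \<le> \<bar>pmf (A k) False - pmf (B k) False\<bar>" "0 < \<epsilon>"
  shows "(\<Prod>k\<in>I. affinity (A k) (B k)) \<le> (1 - \<epsilon>\<^sup>2 / 4) ^ card I"
proof -
  have "(\<Prod>k\<in>I. affinity (A k) (B k)) \<le> (\<Prod>k\<in>I. 1 - \<epsilon>\<^sup>2 / 4)"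
  proof (rule prod_mono, intro conjI affinity_nonneg)
    fix k assume "k \<in> I"
    then have "\<epsilon>\<^sup>2 \<le> \<bar>pmf (A k) False - pmf (B k) False\<bar>\<^sup>2"
      using assms by (intro power_mono) auto
    then show "affinity (A k) (B k) \<le> 1 - \<epsilon>\<^sup>2 / 4"
      using affinity_le[of "A k" "B k"] by simp
  qed
  then show ?thesis by simp
qed

lemma AE_shifted_product:
  assumes "AE x in M. Q x"
  shows "AE x in \<mu> (\<lambda>k. P (k - int n)). Q x"
proof (rule absolutely_continuous_AE[OF _ _ assms])
  show "absolutely_continuous M (\<mu> (\<lambda>k. P (k - int n)))"
    unfolding absolutely_continuous_def
  proof
    fix S assume S: "S \<in> null_sets M"
    then have [measurable]: "S \<in> sets cantor" using sets_M by auto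
    have "emeasure (\<mu> (\<lambda>k. P (k - int n))) S = (\<integral>\<^sup>+x. indicator S x \<partial>\<mu> (\<lambda>k. P (k - int n)))"
      by simp
    also have "\<dots> = (\<integral>\<^sup>+x. indicator S x * ennreal (exp (logjac n x)) \<partial>M)"
      by (rule nn_integral_shifted_product) measurable
    also have "\<dots> = (\<integral>\<^sup>+x. 0 \<partial>M)"
      using AE_not_in[OF S] by (intro nn_integral_cong_AE) (auto elim!: eventually_mono)
    finally show "S \<in> null_sets (\<mu> (\<lambda>k. P (k - int n)))"
      by (intro null_setsI) auto
  qed
qed (simp add: M_def sets_bernoulli)

text \<open>If infinitely many steps were at least \<open>\<epsilon>\<close>, then \<open>N\<close> of the corresponding coordinates would give
  \<open>M\<close> and its shift an affinity of at most \<open>(1 - \<epsilon>\<^sup>2 / 4) ^ N\<close>. By Borel--Cantelli the separating sets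
  would make the two measures mutually singular, although the shift of \<open>M\<close> is absolutely continuous.\<close>
lemma steps_tendsto_0:
  "(\<lambda>n. pmf (P (int n + 1)) False - pmf (P (int n)) False) \<longlonglongrightarrow> 0"
proof (rule ccontr)
  let ?s = "\<lambda>n. pmf (P (int n + 1)) False - pmf (P (int n)) False"
  let ?Q = "\<mu> (\<lambda>k. P (k - int 1))"
  assume "\<not> ?s \<longlonglongrightarrow> 0"
  then obtain \<epsilon> where \<epsilon>: "0 < \<epsilon>" and inf: "\<And>N. \<exists>n\<ge>N. \<epsilon> \<le> \<bar>?s n\<bar>"
    unfolding LIMSEQ_iff by (auto simp: not_less)
  define K where "K = {n. \<epsilon> \<le> \<bar>?s n\<bar>}"
  have "infinite K" using inf unfolding K_def infinite_nat_iff_unbounded_le by auto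
  then have "\<forall>N. \<exists>F. finite F \<and> card F = N \<and> F \<subseteq> K" using infinite_arbitrarily_large by blast
  then obtain F where F: "\<And>N. finite (F N)" "\<And>N. card (F N) = N" "\<And>N. F N \<subseteq> K" by metis
  define r where "r = 1 - \<epsilon>\<^sup>2 / 4"
  have "\<epsilon> \<le> 1"
  proof -
    obtain n where "\<epsilon> \<le> \<bar>?s n\<bar>" using inf by blast
    also have "\<bar>?s n\<bar> \<le> 1" using pmf_le_1[of "P (int n + 1)" False] pmf_le_1[of "P (int n)" False]
      pmf_nonneg[of "P (int n + 1)" False] pmf_nonneg[of "P (int n)" False] by linarith
    finally show ?thesis .
  qed
  then have r: "0 \<le> r" "r < 1" using \<epsilon> power_le_one[of \<epsilon> 2] by (auto simp: r_def)
  have "\<exists>S. S \<in> sets cantor \<and> emeasure M S \<le> ennreal (r ^ N) \<and> emeasure ?Q (- S) \<le> ennreal (r ^ N)" for N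
  proof -
    let ?I = "(\<lambda>n. int n + 1) ` F N"
    have "(\<Prod>k\<in>?I. affinity (P k) (P (k - int 1))) \<le> (1 - \<epsilon>\<^sup>2 / 4) ^ card ?I"
      using F(1)[of N] F(3)[of N] \<epsilon> by (intro affinity_prod_le) (auto simp: K_def)
    also have "card ?I = N" using F(2)[of N] by (simp add: card_image inj_on_def)
    finally have le: "(\<Prod>k\<in>?I. affinity (P k) (P (k - int 1))) \<le> r ^ N" by (simp add: r_def)
    have "finite ?I" using F(1) by simp
    then obtain S where "S \<in> sets cantor"
      "emeasure (\<mu> P) S \<le> ennreal (\<Prod>k\<in>?I. affinity (P k) (P (k - int 1)))"
      "emeasure ?Q (- S) \<le> ennreal (\<Prod>k\<in>?I. affinity (P k) (P (k - int 1)))"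
      by (rule separating_set[where I="?I" and A=P and B="\<lambda>k. P (k - int 1)", OF _ pmf_pos pmf_pos])
    then show ?thesis
      using ennreal_leI[OF le] unfolding M_def by (blast intro: order.trans)
  qed
  then obtain S where S: "\<And>N. S N \<in> sets cantor" "\<And>N. emeasure M (S N) \<le> ennreal (r ^ N)"
    "\<And>N. emeasure ?Q (- S N) \<le> ennreal (r ^ N)" by metis
  have nS: "- S N \<in> sets cantor" for N
    using sets.compl_sets[OF S(1)[of N]] by (simp add: Compl_eq_Diff_UNIV)
  have "AE x in ?Q. eventually (\<lambda>n. x \<notin> - S n) sequentially"
    by (rule AE_eventually_geometric[OF prob_space_bernoulli _ r]) (simp_all only: sets_bernoulli S(3) nS)
  moreover have "AE x in M. eventually (\<lambda>n. x \<notin> S n) sequentially"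
    by (rule AE_eventually_geometric[OF prob_space_axioms _ r]) (simp_all only: sets_M S)
  from AE_shifted_product[OF this, of 1]
  have "AE x in ?Q. eventually (\<lambda>n. x \<notin> S n) sequentially" .
  ultimately have "AE x in ?Q. False"
  proof eventually_elim
    fix x assume "\<forall>\<^sub>F n in sequentially. x \<notin> - S n" "\<forall>\<^sub>F n in sequentially. x \<notin> S n"
    then have "\<forall>\<^sub>F n in sequentially :: nat filter. False" by eventually_elim auto
    then show False by simp
  qed
  then show False using prob_space.AE_False[OF prob_space_bernoulli] by blast
qed

text \<open>Otherwise about \<open>n\<close> marginals of \<open>M\<close> differ by at least \<open>\<delta>\<close> from those of its shift by \<open>n\<close>, which has
  the past marginal at these places. The affinities decay geometrically, so the densities
  \<open>exp (logjac n)\<close> tend to \<open>0\<close> almost everywhere, contrary to recurrence.\<close>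
lemma frequently_close:
  assumes cons: "conservative M T" and \<delta>: "0 < \<delta>"
  shows "\<exists>n\<ge>N. \<bar>pmf (P (int n)) False - p\<bar> < \<delta>"
proof (rule ccontr)
  assume "\<not> ?thesis"
  then have far: "\<delta> \<le> \<bar>pmf (P (int n)) False - p\<bar>" if "N \<le> n" for n using that by (auto simp: not_less)
  define r where "r = 1 - \<delta>\<^sup>2 / 4"
  have "\<delta> \<le> 1"
    using far[OF order.refl] p pmf_le_1[of "P (int N)" False] pmf_nonneg[of "P (int N)" False] by linarith
  then have r: "0 \<le> r" "r < 1" using \<delta> power_le_one[of \<delta> 2] by (auto simp: r_def)
  let ?Q = "\<lambda>n k. P (k - int (n + N))"
  have "\<exists>S. S \<in> sets cantor \<and> emeasure M S \<le> ennreal (r ^ n) \<and> emeasure (\<mu> (?Q n)) (- S) \<le> ennreal (r ^ n)" for n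
  proof -
    let ?I = "{int N <.. int (n + N)}"
    have "(\<Prod>k\<in>?I. affinity (P k) (?Q n k)) \<le> (1 - \<delta>\<^sup>2 / 4) ^ card ?I"
    proof (rule affinity_prod_le)
      fix k assume k: "k \<in> ?I"
      then show "\<delta> \<le> \<bar>pmf (P k) False - pmf (?Q n k) False\<bar>"
        using far[of "nat k"] past[of "k - int (n + N)"] by auto
    qed (auto simp: \<delta>)
    then have le: "(\<Prod>k\<in>?I. affinity (P k) (?Q n k)) \<le> r ^ n" by (simp add: r_def)
    obtain S where "S \<in> sets cantor"
      "emeasure (\<mu> P) S \<le> ennreal (\<Prod>k\<in>?I. affinity (P k) (?Q n k))"
      "emeasure (\<mu> (?Q n)) (- S) \<le> ennreal (\<Prod>k\<in>?I. affinity (P k) (?Q n k))"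
      by (rule separating_set[where I="?I" and A=P and B="?Q n",
            OF finite_greaterThanAtMost_int pmf_pos pmf_pos])
    then show ?thesis
      using ennreal_leI[OF le] unfolding M_def by (blast intro: order.trans)
  qed
  then obtain S where S: "\<And>n. S n \<in> sets cantor" "\<And>n. emeasure M (S n) \<le> ennreal (r ^ n)"
    "\<And>n. emeasure (\<mu> (?Q n)) (- S n) \<le> ennreal (r ^ n)" by metis
  note [measurable] = S(1)
  have nS[measurable]: "- S n \<in> sets cantor" for n
    using sets.compl_sets[OF S(1)[of n]] by (simp add: Compl_eq_Diff_UNIV)
  have "AE x in M. (\<lambda>n. indicator (- S n) x * exp (logjac (n + N) x)) \<longlonglongrightarrow> (0::real)"
  proof (rule AE_tendsto_0_of_summable_integrals[OF _ _ r])
    fix n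
    have "(\<integral>\<^sup>+x. ennreal (indicator (- S n) x * exp (logjac (n + N) x)) \<partial>M) =
      (\<integral>\<^sup>+x. indicator (- S n) x * ennreal (exp (logjac (n + N) x)) \<partial>M)"
      by (intro nn_integral_cong) (auto split: split_indicator)
    also have "\<dots> = (\<integral>\<^sup>+x. indicator (- S n) x \<partial>\<mu> (?Q n))"
      by (rule nn_integral_shifted_product[symmetric]) measurable
    also have "\<dots> \<le> ennreal (r ^ n)" using S(3) nS by (subst nn_integral_indicator) simp_all
    finally show "(\<integral>\<^sup>+x. ennreal (indicator (- S n) x * exp (logjac (n + N) x)) \<partial>M) \<le> ennreal (r ^ n)" .
  qed (use r in simp_all)
  moreover have "AE x in M. eventually (\<lambda>n. x \<notin> S n) sequentially"
    by (rule AE_eventually_geometric[OF prob_space_axioms _ r]) (simp_all only: sets_M S)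
  ultimately have "AE x in M. drift (\<lambda>n. logjac n x)"
  proof eventually_elim
    fix x assume lim: "(\<lambda>n. indicator (- S n) x * exp (logjac (n + N) x)) \<longlonglongrightarrow> (0::real)"
      and ev: "\<forall>\<^sub>F n in sequentially. x \<notin> S n"
    show "drift (\<lambda>n. logjac n x)"
      unfolding drift_def
    proof
      fix c :: nat
      have "\<forall>\<^sub>F n in sequentially. indicator (- S n) x * exp (logjac (n + N) x) < exp (- real c)"
        by (rule order_tendstoD(2)[OF lim]) simp
      with ev have "\<forall>\<^sub>F n in sequentially. logjac (n + N) x < - real c"
        by eventually_elim simp
      then obtain m where m: "\<And>n. m \<le> n \<Longrightarrow> logjac (n + N) x < - real c"
        unfolding eventually_sequentially by blast
      have "logjac n x < - real c" if "m + N \<le> n" for n using m[of "n - N"] that by simp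
      then show "\<exists>m. \<forall>n. m \<le> n \<longrightarrow> logjac n x < - real c" by blast
    qed
  qed
  with not_drift[OF cons] have "AE x in M. False" by eventually_elim simp
  then show False using AE_False by simp
qed

end

section \<open>Martingale increments and flips\<close>

text \<open>The measures with densities \<open>C\<close> and \<open>C + f\<close> agree on cylinders, hence everywhere.\<close>
lemma AE_zero_of_cylinders:
  fixes f :: "(int \<Rightarrow> bool) \<Rightarrow> real"
  assumes [measurable]: "f \<in> borel_measurable cantor" and C: "\<And>x. \<bar>f x\<bar> \<le> C"
    and zero: "\<And>I B. finite I \<Longrightarrow> (\<integral>x. indicator (cylinder I B) x * f x \<partial>\<mu> A) = 0"
  shows "AE x in \<mu> A. f x = 0"
proof -
  let ?M = "\<mu> A"
  interpret prob_space ?M by (rule prob_space_bernoulli)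
  have C0: "0 \<le> C" using order.trans[OF abs_ge_zero C] .
  have pos: "0 \<le> C + f x" for x using C[of x] by linarith
  have eq: "density ?M (\<lambda>x. ennreal C) = density ?M (\<lambda>x. ennreal (C + f x))"
  proof (rule measure_eqI_PiM_infinite)
    show "sets (density ?M (\<lambda>x. ennreal C)) = sets (PiM UNIV (\<lambda>k. measure_pmf (A k)))"
      "sets (density ?M (\<lambda>x. ennreal (C + f x))) = sets (PiM UNIV (\<lambda>k. measure_pmf (A k)))"
      by (simp_all add: bernoulli_product_def)
    show "finite_measure (density ?M (\<lambda>x. ennreal C))"
      using emeasure_space_1 sets.top[of ?M]
      by (intro finite_measureI) (simp add: emeasure_density nn_integral_const ennreal_mult_eq_top_iff)
    fix B and I :: "int set" assume "finite I"
    then have [measurable]: "cylinder I B \<in> sets cantor" by (rule sets_cylinder)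
    have emb: "prod_emb UNIV (\<lambda>k. measure_pmf (A k)) I (Pi\<^sub>E I B) = cylinder I B"
      by (auto simp: prod_emb_def cylinder_def Pi_iff PiE_iff)
    have eqi: "emeasure (density ?M (\<lambda>x. ennreal (h x))) (cylinder I B) = ennreal (\<integral>x. indicator (cylinder I B) x * h x \<partial>?M)"
      if [measurable]: "h \<in> borel_measurable cantor" and h: "\<And>x. 0 \<le> h x" "\<And>x. h x \<le> 2 * C" for h
    proof -
      have "emeasure (density ?M (\<lambda>x. ennreal (h x))) (cylinder I B) = (\<integral>\<^sup>+x. ennreal (indicator (cylinder I B) x * h x) \<partial>?M)"
        by (subst emeasure_density) (auto intro!: nn_integral_cong split: split_indicator)
      also have "\<dots> = ennreal (\<integral>x. indicator (cylinder I B) x * h x \<partial>?M)"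
        by (rule nn_integral_eq_integral[OF integrable_bounded_bernoulli[where C="2 * C"]])
          (use h C0 in \<open>auto split: split_indicator\<close>)
      finally show ?thesis .
    qed
    have i: "integrable ?M (\<lambda>x. indicator (cylinder I B) x * h x)"
      if "h \<in> borel_measurable cantor" "\<And>x. \<bar>h x\<bar> \<le> C" for h :: "_ \<Rightarrow> real"
      using that C0 by (intro integrable_bounded_bernoulli[where C="C"]) (auto split: split_indicator)
    have "(\<integral>x. indicator (cylinder I B) x * (C + f x) \<partial>?M) =
       (\<integral>x. indicator (cylinder I B) x * C + indicator (cylinder I B) x * f x \<partial>?M)"
      by (simp add: distrib_left)
    also have "\<dots> = (\<integral>x. indicator (cylinder I B) x * C \<partial>?M)"
      using i[of "\<lambda>_. C"] i[of f] C C0 zero[OF \<open>finite I\<close>] by (subst Bochner_Integration.integral_add) auto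
    finally show "emeasure (density ?M (\<lambda>x. ennreal C)) (prod_emb UNIV (\<lambda>k. measure_pmf (A k)) I (Pi\<^sub>E I B)) =
       emeasure (density ?M (\<lambda>x. ennreal (C + f x))) (prod_emb UNIV (\<lambda>k. measure_pmf (A k)) I (Pi\<^sub>E I B))"
      unfolding emb using eqi[of "\<lambda>_. C"] eqi[of "\<lambda>x. C + f x"] C0 C pos
      by (simp add: abs_le_iff)
  qed
  have "AE x in ?M. ennreal C = ennreal (C + f x)"
    using eq by (subst (asm) density_unique_iff) auto
  then show ?thesis
    using C0 pos by (auto elim!: eventually_mono)
qed

text \<open>The indicator of a cylinder over \<open>I\<close> is unchanged by resampling off \<open>J m\<close> once \<open>I \<subseteq> J m\<close>, so by
  self-adjointness \<open>f\<close> has integral \<open>0\<close> over it.\<close>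
lemma AE_zero_of_resample:
  fixes f :: "(int \<Rightarrow> bool) \<Rightarrow> real"
  assumes [measurable]: "f \<in> borel_measurable cantor" and C: "\<And>x. \<bar>f x\<bar> \<le> C"
    and cover: "\<And>I. finite I \<Longrightarrow> \<exists>m::nat. I \<subseteq> J m"
    and zero: "\<And>m. AE x in \<mu> A. resample (J m) (\<mu> A) f x = 0"
  shows "AE x in \<mu> A. f x = 0"
proof (rule AE_zero_of_cylinders[OF assms(1,2)])
  let ?M = "\<mu> A"
  interpret prob_space ?M by (rule prob_space_bernoulli)
  fix I :: "int set" and B assume I: "finite I"
  then obtain m where m: "I \<subseteq> J m" using cover by blast
  let ?g = "indicator (cylinder I B) :: _ \<Rightarrow> real"
  have [measurable]: "?g \<in> borel_measurable cantor" using I by simp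
  have "?g (glue (J m) x w) = ?g x" for x w
  proof -
    have "glue (J m) x w k = x k" if "k \<in> I" for k using m that by (auto simp: glue_def)
    then show ?thesis by (simp add: cylinder_def indicator_def)
  qed
  then have g: "resample (J m) ?M ?g x = ?g x" for x
    unfolding resample_def using prob_space by simp
  have "(\<integral>x. ?g x * f x \<partial>?M) = (\<integral>x. f x * resample (J m) ?M ?g x \<partial>?M)"
    by (simp add: g mult.commute)
  also have "\<dots> = (\<integral>x. resample (J m) ?M f x * resample (J m) ?M ?g x \<partial>?M)"
    by (rule integral_resample_mult[where C="max C 1", symmetric])
      (auto simp: C le_max_iff_disj split: split_indicator)
  also have "\<dots> = (\<integral>x. 0 \<partial>?M)"
  proof (rule integral_cong_AE)
    have [measurable]: "resample (J m) ?M f \<in> borel_measurable cantor" "resample (J m) ?M ?g \<in> borel_measurable cantor"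
      by (rule resample_measurable; measurable)+
    show "(\<lambda>x. resample (J m) ?M f x * resample (J m) ?M ?g x) \<in> borel_measurable ?M" by measurable
    show "AE x in ?M. resample (J m) ?M f x * resample (J m) ?M ?g x = 0"
      using zero[of m] by eventually_elim simp
  qed simp
  finally show "(\<integral>x. ?g x * f x \<partial>?M) = 0" by simp
qed

lemma resample_resample:
  fixes f :: "(int \<Rightarrow> bool) \<Rightarrow> real"
  assumes [measurable]: "f \<in> borel_measurable cantor" and C: "\<And>x. \<bar>f x\<bar> \<le> C" and J: "J \<subseteq> J'"
  shows "resample J (\<mu> A) (resample J' (\<mu> A) f) x = resample J (\<mu> A) f x"
proof -
  have *: "glue J' (glue J x w) v = glue J x (glue J' w v)" for w v using J by (auto simp: glue_def)
  have "resample J (\<mu> A) (resample J' (\<mu> A) f) x =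
     (\<integral>w. resample J' (\<mu> A) (\<lambda>w. f (glue J x w)) w \<partial>\<mu> A)"
    by (simp add: resample_def *)
  also have "\<dots> = resample J (\<mu> A) f x"
    unfolding resample_def[of J] by (rule integral_glue_same[where C=C]) (auto simp: C)
  finally show ?thesis .
qed

lemma integral_coordinate:
  fixes h :: "bool \<Rightarrow> real"
  shows "(\<integral>w. h (w k) \<partial>\<mu> A) = pmf (A k) True * h True + pmf (A k) False * h False"
proof -
  have "(\<integral>w. h (w k) \<partial>\<mu> A) = (\<integral>b. h b \<partial>measure_pmf (A k))"
    unfolding distr_coordinate[symmetric] by (subst integral_distr) auto
  also have "\<dots> = pmf (A k) True * h True + pmf (A k) False * h False"
    by (subst integral_measure_pmf[of "{True, False}"]) auto
  finally show ?thesis .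
qed

text \<open>The step from the coordinates below \<open>k\<close> to those up to \<open>k\<close> reveals one binary coordinate, so the
  increment is determined by the effect of flipping it.\<close>
lemma resample_increment:
  fixes f :: "(int \<Rightarrow> bool) \<Rightarrow> real" and A :: "int \<Rightarrow> bool pmf"
  assumes f: "f \<in> borel_measurable cantor" "\<And>x. \<bar>f x\<bar> \<le> C"
  defines "E \<equiv> \<lambda>k. resample {..k} (\<mu> A) f"
  shows "E k x - E (k - 1) x = pmf (A k) (\<not> x k) * (E k x - E k (flip k x))"
proof -
  have dep: "E k (glue {..k - 1} x w) = E k (x(k := w k))" for w
  proof -
    have "glue {..k} (glue {..k - 1} x w) v = glue {..k} (x(k := w k)) v" for v
      by (auto simp: glue_def)
    then show ?thesis by (simp add: E_def resample_def)
  qed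
  have "E (k - 1) x = resample {..k - 1} (\<mu> A) (E k) x"
    unfolding E_def by (rule resample_resample[OF f, symmetric]) auto
  also have "\<dots> = pmf (A k) True * E k (x(k := True)) + pmf (A k) False * E k (x(k := False))"
    unfolding resample_def[of "{..k - 1}"] dep by (rule integral_coordinate)
  finally have E: "E (k - 1) x = pmf (A k) True * E k (x(k := True)) + pmf (A k) False * E k (x(k := False))" .
  have upd: "x(k := x k) = x" "flip k x = x(k := \<not> x k)" by (auto simp: flip_def)
  show ?thesis
    unfolding E using upd by (cases "x k") (auto simp: pmf_bool_True algebra_simps)
qed

text \<open>Flipping a coordinate in \<open>J\<close> commutes with resampling off \<open>J\<close>, and the sign depends only on that
  coordinate; so the estimate survives integration.\<close>
lemma resample_flip:
  fixes f h :: "(int \<Rightarrow> bool) \<Rightarrow> real" and A :: "int \<Rightarrow> bool pmf"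
  assumes [measurable]: "f \<in> borel_measurable cantor" "h \<in> borel_measurable cantor"
    and C: "\<And>x. \<bar>f x\<bar> \<le> C" "\<And>x. \<bar>h x\<bar> \<le> C" and k: "k \<in> J"
    and le: "AE x in \<mu> A. \<bar>f (flip k x) - f x + (if x k then d else - d) * h x\<bar> \<le> e"
  defines "M \<equiv> \<mu> A"
  shows "AE x in M. \<bar>resample J M f (flip k x) - resample J M f x + (if x k then d else - d) * resample J M h x\<bar> \<le> e"
proof -
  interpret prob_space M unfolding M_def by (rule prob_space_bernoulli)
  have fl: "flip k (glue J x w) = glue J (flip k x) w" "glue J x w k = x k" for x w
    using k by (auto simp: flip_def glue_def fun_eq_iff)
  have int: "integrable M g" if "g \<in> borel_measurable cantor" "\<And>x. \<bar>g x\<bar> \<le> C" for g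
    unfolding M_def by (rule integrable_bounded_bernoulli) (use that in auto)
  have "AE x in M. AE w in M. \<bar>f (flip k (glue J x w)) - f (glue J x w) + (if glue J x w k then d else - d) * h (glue J x w)\<bar> \<le> e"
    using AE_glue[OF le, of J] unfolding M_def .
  then show ?thesis
  proof eventually_elim
    case (elim x)
    let ?s = "if x k then d else - d"
    let ?g = "\<lambda>w. f (glue J (flip k x) w) - f (glue J x w) + ?s * h (glue J x w)"
    have i: "integrable M (\<lambda>w. f (glue J (flip k x) w))" "integrable M (\<lambda>w. f (glue J x w))" "integrable M (\<lambda>w. h (glue J x w))"
      by (auto intro!: int simp: C)
    have "resample J M f (flip k x) - resample J M f x + ?s * resample J M h x = (\<integral>w. ?g w \<partial>M)"
      unfolding resample_def using i by simp
    also have "\<bar>\<dots>\<bar> \<le> (\<integral>w. \<bar>?g w\<bar> \<partial>M)" by (rule integral_abs_bound)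
    also have "\<dots> \<le> (\<integral>w. e \<partial>M)"
      using elim i by (intro integral_mono_AE) (auto simp: fl)
    finally show ?case
      using prob_space by simp
  qed
qed

text \<open>Mean value theorem: the derivative of the log-odds is \<open>1 / (z * (1 - z))\<close>.\<close>
lemma logit_diff_bounds:
  fixes u v :: real
  assumes u: "0 < u" "u < 1" and v: "0 < v" "v < 1"
  shows "\<bar>u - v\<bar> \<le> \<bar>ln (u / (1 - u)) - ln (v / (1 - v))\<bar>"
    and "c \<le> u \<Longrightarrow> c \<le> 1 - u \<Longrightarrow> c \<le> v \<Longrightarrow> c \<le> 1 - v \<Longrightarrow> 0 < c \<Longrightarrow>
      \<bar>ln (u / (1 - u)) - ln (v / (1 - v))\<bar> \<le> \<bar>u - v\<bar> / c\<^sup>2"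
proof -
  have ex: "\<exists>z. u \<le> z \<and> z \<le> v \<and> ln (v / (1 - v)) - ln (u / (1 - u)) = (v - u) * (1 / (z * (1 - z)))"
    if uv: "u < v" "0 < u" "v < 1" for u v :: real
  proof -
    have "\<exists>z. u < z \<and> z < v \<and> ln (v / (1 - v)) - ln (u / (1 - u)) = (v - u) * (1 / (z * (1 - z)))"
    proof (rule MVT2[OF uv(1)])
      fix x assume "u \<le> x" "x \<le> v"
      then have "0 < x" "x < 1" using uv by auto
      then show "((\<lambda>x. ln (x / (1 - x))) has_real_derivative 1 / (x * (1 - x))) (at x)"
        by (auto intro!: derivative_eq_intros simp: divide_simps) 
    qed
    then show ?thesis by (meson less_imp_le)
  qed
  have ex': "\<exists>z. min u v \<le> z \<and> z \<le> max u v \<and> \<bar>ln (u / (1 - u)) - ln (v / (1 - v))\<bar> = \<bar>u - v\<bar> * (1 / (z * (1 - z)))"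
  proof -
    consider "u < v" | "v < u" | "u = v" by linarith
    then show ?thesis
    proof cases
      case 1
      then obtain z where z: "u \<le> z" "z \<le> v" "ln (v / (1 - v)) - ln (u / (1 - u)) = (v - u) * (1 / (z * (1 - z)))"
        using ex[OF 1] u v by blast
      moreover have "0 < z" "z < 1" using z u v by auto
      ultimately show ?thesis using 1
        by (intro exI[of _ z])
          (simp add: abs_minus_commute[of "ln (u / (1 - u))"] abs_minus_commute[of u] abs_mult abs_of_pos)
    next
      case 2
      then obtain z where z: "v \<le> z" "z \<le> u" "ln (u / (1 - u)) - ln (v / (1 - v)) = (u - v) * (1 / (z * (1 - z)))"
        using ex[OF 2] u v by blast
      moreover have "0 < z" "z < 1" using z u v by auto
      ultimately show ?thesis using 2
        by (intro exI[of _ z]) (simp add: abs_mult)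
    next
      case 3 then show ?thesis by (intro exI[of _ u]) auto
    qed
  qed
  then obtain z where z: "min u v \<le> z" "z \<le> max u v"
    "\<bar>ln (u / (1 - u)) - ln (v / (1 - v))\<bar> = \<bar>u - v\<bar> * (1 / (z * (1 - z)))" by blast
  have z01: "0 < z" "z < 1" using z u v by auto
  then have "z * (1 - z) \<le> 1 * 1" by (intro mult_mono) auto
  then have "1 \<le> 1 / (z * (1 - z))" using z01 by simp
  then show "\<bar>u - v\<bar> \<le> \<bar>ln (u / (1 - u)) - ln (v / (1 - v))\<bar>"
    unfolding z(3) using mult_left_mono[of 1 "1 / (z * (1 - z))" "\<bar>u - v\<bar>"] by simp
  assume c: "c \<le> u" "c \<le> 1 - u" "c \<le> v" "c \<le> 1 - v" "0 < c"
  then have "c * c \<le> z * (1 - z)" using z by (intro mult_mono) auto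
  then have "1 / (z * (1 - z)) \<le> 1 / c\<^sup>2" using c by (intro divide_left_mono) (auto simp: power2_eq_square z01)
  then show "\<bar>ln (u / (1 - u)) - ln (v / (1 - v))\<bar> \<le> \<bar>u - v\<bar> / c\<^sup>2"
    unfolding z(3) using mult_left_mono[of "1 / (z * (1 - z))" "1 / c\<^sup>2" "\<bar>u - v\<bar>"] by simp
qed

context half_stationary_shift
begin

definition bias :: "nat \<Rightarrow> real" where
  "bias n = pmf (P (int n)) False - p"

lemma flip_gap_bounds:
  shows "\<bar>bias n\<bar> \<le> \<bar>flip_gap (int n)\<bar>"
    and "0 < c \<Longrightarrow> 2 * c \<le> p \<Longrightarrow> 2 * c \<le> 1 - p \<Longrightarrow> \<bar>bias n\<bar> \<le> c \<Longrightarrow> \<bar>flip_gap (int n)\<bar> \<le> \<bar>bias n\<bar> / c\<^sup>2"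
    and "0 < c \<Longrightarrow> 2 * c \<le> p \<Longrightarrow> 2 * c \<le> 1 - p \<Longrightarrow> \<bar>bias n\<bar> \<le> c \<Longrightarrow> c \<le> pmf (P (int n)) b"
proof -
  have P: "0 < pmf (P (int n)) False" "pmf (P (int n)) False < 1"
    using pmf_pos[of "int n" False] pmf_pos[of "int n" True] pmf_bool_True[of "P (int n)"] by auto
  have gap: "flip_gap (int n) = ln (pmf (P (int n)) False / (1 - pmf (P (int n)) False)) - ln (p / (1 - p))"
    by (simp add: flip_gap_def pmf_bool_True)
  show "\<bar>bias n\<bar> \<le> \<bar>flip_gap (int n)\<bar>"
    unfolding gap bias_def by (rule logit_diff_bounds) (use P p in auto)
  assume c: "0 < c" "2 * c \<le> p" "2 * c \<le> 1 - p" "\<bar>bias n\<bar> \<le> c"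
  then show "\<bar>flip_gap (int n)\<bar> \<le> \<bar>bias n\<bar> / c\<^sup>2"
    unfolding gap bias_def by (intro logit_diff_bounds) (use P p in auto)
  show "c \<le> pmf (P (int n)) b"
    using c unfolding bias_def by (cases b) (auto simp: pmf_bool_True)
qed

lemma integrable_M:
  fixes g :: "(int \<Rightarrow> bool) \<Rightarrow> real"
  assumes "g \<in> borel_measurable cantor" "\<And>x. \<bar>g x\<bar> \<le> D" shows "integrable M g"
  unfolding M_def using assms by (rule integrable_bounded_bernoulli)

text \<open>Flipping coordinate \<open>k\<close> changes \<open>U\<close> by \<open>\<plusminus> flip_gap k * H\<close> up to a quadratic error. Taking
  conditional expectations given the coordinates up to \<open>k\<close>, the martingale of \<open>U\<close> has an increment
  of squared norm at least a constant times \<open>(flip_gap k)\<^sup>2\<close> times the squared norm of the conditional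
  expectation of \<open>H\<close>, provided that \<open>flip_gap k\<close> is small. The increments of a bounded martingale
  are square summable, and the norm of the conditional expectation of \<open>H\<close> increases with \<open>k\<close>. So a
  nonzero \<open>H\<close> would make the squared biases below some threshold summable.\<close>
lemma zero_of_flip_increments:
  fixes U H :: "(int \<Rightarrow> bool) \<Rightarrow> real"
  assumes [measurable]: "U \<in> borel_measurable cantor" "H \<in> borel_measurable cantor"
    and C: "\<And>x. \<bar>U x\<bar> \<le> C" "\<And>x. \<bar>H x\<bar> \<le> C"
    and flip: "\<And>k. 1 \<le> k \<Longrightarrow> AE x in M. \<bar>U (flip k x) - U x + signed_gap k x * H x\<bar> \<le> C * (flip_gap k)\<^sup>2"
    and div: "\<And>\<eta>. 0 < \<eta> \<Longrightarrow> \<not> summable (\<lambda>n. if \<bar>bias n\<bar> \<le> \<eta> then (bias n)\<^sup>2 else 0)"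
  shows "AE x in M. H x = 0"
proof -
  define E where "E n = resample {..int n} M U" for n
  define F where "F n = resample {..int n} M H" for n
  have C0: "0 \<le> C" using order.trans[OF abs_ge_zero C(1)] .
  have [measurable]: "E n \<in> borel_measurable cantor" "F n \<in> borel_measurable cantor" for n
    unfolding E_def F_def M_def by (rule resample_measurable; measurable)+
  have b: "\<bar>E n x\<bar> \<le> C" "\<bar>F n x\<bar> \<le> C" for n x
    unfolding E_def F_def M_def by (rule resample_bounded; simp add: C)+
  have sq: "\<bar>u\<^sup>2\<bar> \<le> D\<^sup>2" if "\<bar>u\<bar> \<le> D" for u D :: real
    using power_mono[OF that, of 2] by simp
  define \<delta> where "\<delta> n = (\<integral>x. (E (Suc n) x - E n x)\<^sup>2 \<partial>M)" for n
  have \<delta>_nonneg: "0 \<le> \<delta> n" for n by (simp add: \<delta>_def)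
  have \<delta>_eq: "\<delta> n = (\<integral>x. (E (Suc n) x)\<^sup>2 \<partial>M) - (\<integral>x. (E n x)\<^sup>2 \<partial>M)" for n
    unfolding \<delta>_def E_def M_def by (rule integral_resample_diff_sq[OF assms(1) C(1)]) auto
  have "(\<Sum>n<N. \<delta> n) \<le> C\<^sup>2" for N
  proof -
    have "(\<Sum>n<N. \<delta> n) = (\<integral>x. (E N x)\<^sup>2 \<partial>M) - (\<integral>x. (E 0 x)\<^sup>2 \<partial>M)"
      unfolding \<delta>_eq by (rule sum_lessThan_telescope)
    also have "\<dots> \<le> (\<integral>x. (E N x)\<^sup>2 \<partial>M)" by simp
    also have "\<dots> \<le> (\<integral>x. C\<^sup>2 \<partial>M)"
      by (intro integral_mono integrable_M[where D="C\<^sup>2"]) (use sq[OF b(1)] in auto)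
    finally show ?thesis using prob_space by simp
  qed
  then have sum\<delta>: "summable \<delta>" by (intro summableI_nonneg_bounded[OF \<delta>_nonneg])
  have mono: "(\<integral>x. (F m x)\<^sup>2 \<partial>M) \<le> (\<integral>x. (F n x)\<^sup>2 \<partial>M)" if "m \<le> n" for m n
    unfolding F_def M_def by (rule integral_resample_sq_mono[OF assms(2) C(2)]) (use that in auto)
  have zero: "(\<integral>x. (F m x)\<^sup>2 \<partial>M) = 0" for m
  proof (rule ccontr)
    define L where "L = (\<integral>x. (F m x)\<^sup>2 \<partial>M)"
    assume "(\<integral>x. (F m x)\<^sup>2 \<partial>M) \<noteq> 0"
    then have L: "0 < L" by (simp add: L_def less_le)
    \<comment> \<open>a bias of at most \<open>c\<close> keeps both weights at coordinate \<open>k\<close> at least \<open>c\<close>; the other bound on \<open>\<eta>\<close> makes the quadratic error at most half of the main term\<close>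
    define c where "c = min p (1 - p) / 2"
    have c: "0 < c" "2 * c \<le> p" "2 * c \<le> 1 - p" using p by (auto simp: c_def)
    define \<eta> where "\<eta> = min c (c\<^sup>2 * sqrt L / (2 * (C + 1)))"
    have \<eta>: "0 < \<eta>" "\<eta> \<le> c" using c L C0 by (auto simp: \<eta>_def)
    have "(bias (Suc n))\<^sup>2 \<le> 4 / (c\<^sup>2 * L) * \<delta> n" if n: "m \<le> n" and close: "\<bar>bias (Suc n)\<bar> \<le> \<eta>" for n
    proof -
      define k where "k = int (Suc n)"
      define g where "g = flip_gap k"
      have "\<bar>bias (Suc n)\<bar> \<le> c" using close \<eta> by simp
      note gb = flip_gap_bounds(2)[OF c this] flip_gap_bounds(3)[OF c this] flip_gap_bounds(1)[of "Suc n"]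
      have "\<bar>g\<bar> \<le> \<eta> / c\<^sup>2" using gb(1) close c unfolding g_def k_def
        by (meson divide_right_mono order.trans zero_le_power2)
      also have "\<dots> \<le> sqrt L / (2 * (C + 1))"
      proof -
        have "\<eta> / c\<^sup>2 \<le> (c\<^sup>2 * sqrt L / (2 * (C + 1))) / c\<^sup>2"
          unfolding \<eta>_def by (intro divide_right_mono) auto
        then show ?thesis using c by simp
      qed
      finally have "\<bar>g\<bar> * (C + 1) \<le> sqrt L / (2 * (C + 1)) * (C + 1)"
        using C0 by (intro mult_right_mono) auto
      also have "\<dots> = sqrt L / 2" using C0 by (simp add: field_simps)
      finally have "\<bar>g\<bar> * (C + 1) \<le> sqrt L / 2" .
      moreover have "\<bar>g\<bar> * C \<le> \<bar>g\<bar> * (C + 1)" by (simp add: algebra_simps)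
      ultimately have "(\<bar>g\<bar> * C)\<^sup>2 \<le> (sqrt L / 2)\<^sup>2" using C0 by (intro power_mono) auto
      then have g: "g\<^sup>2 * C\<^sup>2 \<le> L / 4" using L by (simp add: power_mult_distrib power_divide)
      have k: "k - 1 = int n" "1 \<le> k" by (auto simp: k_def)
      have inc: "E (Suc n) x - E n x = pmf (P k) (\<not> x k) * (E (Suc n) x - E (Suc n) (flip k x))" for x
        using resample_increment[OF assms(1) C(1), of k P x] unfolding E_def M_def k k_def[symmetric] .
      have "AE x in M. \<bar>E (Suc n) (flip k x) - E (Suc n) x + (if x k then g else - g) * F (Suc n) x\<bar> \<le> C * g\<^sup>2"
        unfolding E_def F_def M_def k_def[symmetric] g_def
        by (rule resample_flip[OF assms(1,2) C _ flip[OF k(2), unfolded M_def]]) simp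
      then have "AE x in M. c\<^sup>2 * (g\<^sup>2 * (F (Suc n) x)\<^sup>2 / 2 - C\<^sup>2 * g^4) \<le> (E (Suc n) x - E n x)\<^sup>2"
      proof eventually_elim
        fix x
        define u where "u = E (Suc n) x - E (Suc n) (flip k x)"
        define w where "w = (if x k then g else - g) * F (Suc n) x"
        assume "\<bar>E (Suc n) (flip k x) - E (Suc n) x + (if x k then g else - g) * F (Suc n) x\<bar> \<le> C * g\<^sup>2"
        then have "\<bar>w - u\<bar> \<le> C * g\<^sup>2" by (simp add: u_def w_def)
        then have "\<bar>w - u\<bar>\<^sup>2 \<le> (C * g\<^sup>2)\<^sup>2" by (intro power_mono) auto
        moreover have "w\<^sup>2 \<le> 2 * u\<^sup>2 + 2 * (w - u)\<^sup>2"
          using zero_le_power2[of "w - 2 * u"] by (simp add: power2_eq_square algebra_simps)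
        moreover have "w\<^sup>2 = g\<^sup>2 * (F (Suc n) x)\<^sup>2" by (auto simp: w_def power_mult_distrib)
        moreover have "(C * g\<^sup>2)\<^sup>2 = C\<^sup>2 * g^4" by (simp add: power_mult_distrib flip: power_mult)
        ultimately have "g\<^sup>2 * (F (Suc n) x)\<^sup>2 / 2 - C\<^sup>2 * g^4 \<le> u\<^sup>2" by simp
        then have "c\<^sup>2 * (g\<^sup>2 * (F (Suc n) x)\<^sup>2 / 2 - C\<^sup>2 * g^4) \<le> c\<^sup>2 * u\<^sup>2" by (intro mult_left_mono) auto
        also have "\<dots> \<le> (pmf (P k) (\<not> x k))\<^sup>2 * u\<^sup>2"
          using gb(2)[of "\<not> x k"] c by (intro mult_right_mono power_mono) (auto simp: k_def)
        also have "\<dots> = (E (Suc n) x - E n x)\<^sup>2" by (simp add: inc u_def power_mult_distrib)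
        finally show "c\<^sup>2 * (g\<^sup>2 * (F (Suc n) x)\<^sup>2 / 2 - C\<^sup>2 * g^4) \<le> (E (Suc n) x - E n x)\<^sup>2" .
      qed
      moreover have i1: "integrable M (\<lambda>x. (F (Suc n) x)\<^sup>2)"
        by (intro integrable_M[where D="C\<^sup>2"]) (use sq[OF b(2)] in auto)
      moreover have i2: "integrable M (\<lambda>x. (E (Suc n) x - E n x)\<^sup>2)"
      proof (intro integrable_M[where D="(2 * C)\<^sup>2"])
        fix x show "\<bar>(E (Suc n) x - E n x)\<^sup>2\<bar> \<le> (2 * C)\<^sup>2"
          using b(1)[of "Suc n" x] b(1)[of n x]
          by (intro sq) linarith
      qed measurable
      ultimately have "(\<integral>x. c\<^sup>2 * (g\<^sup>2 * (F (Suc n) x)\<^sup>2 / 2 - C\<^sup>2 * g^4) \<partial>M) \<le> \<delta> n"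
        unfolding \<delta>_def by (intro integral_mono_AE) auto
      moreover have "(\<integral>x. c\<^sup>2 * (g\<^sup>2 * (F (Suc n) x)\<^sup>2 / 2 - C\<^sup>2 * g^4) \<partial>M) =
          c\<^sup>2 * (g\<^sup>2 * (\<integral>x. (F (Suc n) x)\<^sup>2 \<partial>M) / 2 - C\<^sup>2 * g^4)"
        using i1 prob_space by simp
      moreover have "g\<^sup>2 * L / 4 \<le> g\<^sup>2 * (\<integral>x. (F (Suc n) x)\<^sup>2 \<partial>M) / 2 - C\<^sup>2 * g^4"
      proof -
        have "g\<^sup>2 * L \<le> g\<^sup>2 * (\<integral>x. (F (Suc n) x)\<^sup>2 \<partial>M)"
          unfolding L_def using mono[of m "Suc n"] n by (intro mult_left_mono) auto
        moreover have "g\<^sup>2 * (g\<^sup>2 * C\<^sup>2) \<le> g\<^sup>2 * (L / 4)" using g by (intro mult_left_mono) auto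
        moreover have "g\<^sup>2 * (g\<^sup>2 * C\<^sup>2) = C\<^sup>2 * g^4" by (simp add: power2_eq_square power4_eq_xxxx)
        ultimately show ?thesis by linarith
      qed
      then have "c\<^sup>2 * (g\<^sup>2 * L / 4) \<le> c\<^sup>2 * (g\<^sup>2 * (\<integral>x. (F (Suc n) x)\<^sup>2 \<partial>M) / 2 - C\<^sup>2 * g^4)"
        by (intro mult_left_mono) auto
      moreover have "(bias (Suc n))\<^sup>2 \<le> g\<^sup>2"
        using power_mono[OF gb(3), of 2] unfolding g_def k_def by simp
      then have "c\<^sup>2 * ((bias (Suc n))\<^sup>2 * L / 4) \<le> c\<^sup>2 * (g\<^sup>2 * L / 4)"
        using L by (intro mult_left_mono divide_right_mono mult_right_mono) auto
      ultimately have "c\<^sup>2 * ((bias (Suc n))\<^sup>2 * L / 4) \<le> \<delta> n" by linarith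
      then show ?thesis using c L by (simp add: field_simps)
    qed
    then have "summable (\<lambda>n. if \<bar>bias (Suc n)\<bar> \<le> \<eta> then (bias (Suc n))\<^sup>2 else 0)"
      using \<delta>_nonneg c L
      by (intro summable_comparison_test_ev[OF _ summable_mult[OF sum\<delta>, of "4 / (c\<^sup>2 * L)"]]
          eventually_sequentiallyI[of m]) auto
    then have "summable (\<lambda>n. if \<bar>bias n\<bar> \<le> \<eta> then (bias n)\<^sup>2 else 0)"
      by (rule summable_Suc_iff[THEN iffD1])
    then show False using div[OF \<eta>(1)] by simp
  qed
  show ?thesis
    unfolding M_def
  proof (rule AE_zero_of_resample[where J="\<lambda>m. {..int m}" and C=C])
    show "\<exists>m::nat. I \<subseteq> {..int m}" if "finite I" for I
    proof (intro exI[of _ "nat (Max (insert 0 I))"] subsetI)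
      fix i assume "i \<in> I"
      then have "i \<le> Max (insert 0 I)" using that by (intro Max_ge) auto
      then show "i \<in> {..int (nat (Max (insert 0 I)))}" by simp
    qed
    show "AE x in \<mu> P. resample {..int m} (\<mu> P) H x = 0" for m
    proof -
      have "AE x in M. (F m x)\<^sup>2 = 0"
        using zero[of m] by (subst (asm) integral_nonneg_eq_0_iff_AE)
          (use sq[OF b(2)] in \<open>auto intro!: integrable_M[where D="C\<^sup>2"]\<close>)
      then show ?thesis unfolding F_def M_def by simp
    qed
  qed (use C in simp_all)
qed

end

section \<open>Moving integrals on the line\<close>

text \<open>The moving integral makes a bounded function Lipschitz and a Lipschitz function differentiable.\<close>
definition window :: "real \<Rightarrow> (real \<Rightarrow> real) \<Rightarrow> real \<Rightarrow> real" where
  "window \<tau> f y = (\<integral>s. indicator {0..\<tau>} s * f (y + s) \<partial>lborel)"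

lemma integrable_indicator_bounded:
  fixes f :: "real \<Rightarrow> real"
  assumes [measurable]: "f \<in> borel_measurable borel" and C: "\<And>u. \<bar>f u\<bar> \<le> C"
    and S: "S \<in> sets borel" "S \<subseteq> {a..b}"
  shows "integrable lborel (\<lambda>u. indicator S u * f u)"
proof (rule Bochner_Integration.integrable_bound)
  have "integrable lborel (\<lambda>u. indicator {a..b} u :: real)" by (rule integrable_real_indicator) (auto simp: emeasure_lborel_Icc_eq)
  then show "integrable lborel (\<lambda>u. C * indicator {a..b} u :: real)" by simp
  show "(\<lambda>u. indicator S u * f u) \<in> borel_measurable lborel" using S by measurable
  have "norm (indicator S u * f u) \<le> norm (C * indicator {a..b} u)" for u
    using C[of u] S(2) order.trans[OF abs_ge_zero C] by (auto split: split_indicator)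
  then show "AE u in lborel. norm (indicator S u * f u) \<le> norm (C * indicator {a..b} u)" by simp
qed

lemma integral_indicator_bounded:
  fixes f :: "real \<Rightarrow> real"
  assumes [measurable]: "f \<in> borel_measurable borel" and C: "\<And>u. u \<in> S \<Longrightarrow> \<bar>f u\<bar> \<le> C" "0 \<le> C"
    and S: "S \<in> sets borel" "S \<subseteq> {a..b}" "a \<le> b"
  shows "\<bar>\<integral>u. indicator S u * f u \<partial>lborel\<bar> \<le> C * (b - a)"
proof -
  have i: "integrable lborel (\<lambda>u. indicator {a..b} u :: real)" by (rule integrable_real_indicator) (auto simp: emeasure_lborel_Icc_eq)
  have "\<bar>\<integral>u. indicator S u * f u \<partial>lborel\<bar> \<le> (\<integral>u. \<bar>indicator S u * f u\<bar> \<partial>lborel)"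
    by (rule integral_abs_bound)
  also have "\<dots> \<le> (\<integral>u. C * indicator {a..b} u \<partial>lborel)"
    by (rule integral_mono') (use i C S in \<open>auto split: split_indicator simp: abs_mult\<close>)
  also have "\<dots> = C * (b - a)" using S by simp
  finally show ?thesis .
qed

lemma window_eq: "window \<tau> f y = (\<integral>u. indicator {y..y + \<tau>} u * f u \<partial>lborel)"
proof -
  have "(\<integral>u. indicator {y..y + \<tau>} u * f u \<partial>lborel) = (\<integral>s. indicator {y..y + \<tau>} (y + s) * f (y + s) \<partial>lborel)"
    by (subst lborel_integral_real_affine[where c=1 and t=y]) simp_all
  also have "\<dots> = window \<tau> f y" unfolding window_def
    by (intro Bochner_Integration.integral_cong) (auto split: split_indicator)
  finally show ?thesis ..
qed

context
  fixes f :: "real \<Rightarrow> real" and C :: real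
  assumes f [measurable]: "f \<in> borel_measurable borel" and C: "\<And>u. \<bar>f u\<bar> \<le> C"
begin

lemma window_bounded: "0 \<le> \<tau> \<Longrightarrow> \<bar>window \<tau> f y\<bar> \<le> C * \<tau>"
  unfolding window_eq using integral_indicator_bounded[OF f C, of "{y..y + \<tau>}" y "y + \<tau>"]
    order.trans[OF abs_ge_zero C] by simp

lemma window_measurable [measurable]: "window \<tau> f \<in> borel_measurable borel"
  unfolding window_def by measurable

lemma window_increment:
  assumes "0 \<le> \<tau>" "0 \<le> d"
  shows "window \<tau> f (y + d) - window \<tau> f y =
    (\<integral>u. indicator {y + \<tau><..y + \<tau> + d} u * f u \<partial>lborel) - (\<integral>u. indicator {y..<y + d} u * f u \<partial>lborel)"
proof -
  have i: "integrable lborel (\<lambda>u. indicator S u * f u)" if "S \<in> sets borel" "S \<subseteq> {y..y + \<tau> + d}" for S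
    using integrable_indicator_bounded[OF f C that] .
  have "window \<tau> f (y + d) - window \<tau> f y =
      (\<integral>u. indicator {y + d..y + d + \<tau>} u * f u - indicator {y..y + \<tau>} u * f u \<partial>lborel)"
    unfolding window_eq using assms by (intro Bochner_Integration.integral_diff[symmetric] i) auto
  also have "\<dots> = (\<integral>u. indicator {y + \<tau><..y + \<tau> + d} u * f u - indicator {y..<y + d} u * f u \<partial>lborel)"
    using assms by (intro Bochner_Integration.integral_cong) (auto split: split_indicator)
  also have "\<dots> = (\<integral>u. indicator {y + \<tau><..y + \<tau> + d} u * f u \<partial>lborel) - (\<integral>u. indicator {y..<y + d} u * f u \<partial>lborel)"
    using assms by (intro Bochner_Integration.integral_diff i) auto
  finally show ?thesis .
qed

lemma window_lipschitz:
  assumes "0 \<le> \<tau>"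
  shows "\<bar>window \<tau> f y - window \<tau> f y'\<bar> \<le> 2 * C * \<bar>y - y'\<bar>"
proof -
  have C0: "0 \<le> C" using order.trans[OF abs_ge_zero C] .
  have *: "\<bar>window \<tau> f (y + d) - window \<tau> f y\<bar> \<le> 2 * C * d" if d: "0 \<le> d" for y d
  proof -
    have "\<bar>\<integral>u. indicator {y + \<tau><..y + \<tau> + d} u * f u \<partial>lborel\<bar> \<le> C * d"
      using integral_indicator_bounded[OF f C C0, of "{y + \<tau><..y + \<tau> + d}" "y + \<tau>" "y + \<tau> + d"] d by (auto simp: subset_iff)
    moreover have "\<bar>\<integral>u. indicator {y..<y + d} u * f u \<partial>lborel\<bar> \<le> C * d"
      using integral_indicator_bounded[OF f C C0, of "{y..<y + d}" y "y + d"] d by (auto simp: subset_iff)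
    ultimately show ?thesis unfolding window_increment[OF assms d] by linarith
  qed
  show ?thesis
  proof (cases "y \<le> y'")
    case True then show ?thesis using *[of "y' - y" y] by (simp add: abs_minus_commute)
  next
    case False then show ?thesis using *[of "y - y'" y'] by simp
  qed
qed

text \<open>The derivative of the moving integral is \<open>f (y + \<sigma>) - f y\<close>. The increment is a difference of integrals
  over two intervals of length \<open>d\<close>, on each of which \<open>f\<close> varies by at most \<open>K * d\<close>.\<close>
lemma window_expansion:
  assumes L: "\<And>u v. \<bar>f u - f v\<bar> \<le> K * \<bar>u - v\<bar>" and \<sigma>: "0 \<le> \<sigma>"
  shows "\<bar>window \<sigma> f (y + d) - window \<sigma> f y - d * (f (y + \<sigma>) - f y)\<bar> \<le> 4 * K * d\<^sup>2"
proof -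
  have K: "0 \<le> K" using L[of 0 1] order.trans[OF abs_ge_zero, of "f 0 - f 1" "K * \<bar>0 - 1\<bar>"] by simp
  have one: "\<bar>(\<integral>u. indicator S u * f u \<partial>lborel) - d * f a\<bar> \<le> K * d * d"
    if d: "0 \<le> d" and S: "S = {a<..a + d} \<or> S = {a..<a + d}" for S a d
  proof -
    have S': "S \<in> sets borel" "S \<subseteq> {a..a + d}" using S by auto
    have "(\<integral>u. indicator S u * (f u - f a) \<partial>lborel) = (\<integral>u. indicator S u * f u - indicator S u * f a \<partial>lborel)"
      by (simp add: right_diff_distrib)
    also have "\<dots> = (\<integral>u. indicator S u * f u \<partial>lborel) - (\<integral>u. indicator S u * f a \<partial>lborel)"
      by (intro Bochner_Integration.integral_diff integrable_indicator_bounded[OF _ _ S', of _ C])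
        (simp_all add: C)
    also have "(\<integral>u. indicator S u * f a \<partial>lborel) = d * f a"
      using S d by (auto simp: mult.commute)
    finally have "(\<integral>u. indicator S u * f u \<partial>lborel) - d * f a = (\<integral>u. indicator S u * (f u - f a) \<partial>lborel)" by simp
    also have "\<bar>\<dots>\<bar> \<le> (K * d) * (a + d - a)"
    proof (rule integral_indicator_bounded[OF _ _ _ S'])
      fix u assume "u \<in> S"
      then have "\<bar>u - a\<bar> \<le> d" using S' by auto
      then show "\<bar>f u - f a\<bar> \<le> K * d" using L[of u a] K mult_left_mono[of "\<bar>u - a\<bar>" d K] by linarith
    qed (use d K in auto)
    finally show ?thesis by simp
  qed
  have pos: "\<bar>window \<sigma> f (y + d) - window \<sigma> f y - d * (f (y + \<sigma>) - f y)\<bar> \<le> 2 * K * d\<^sup>2" if d: "0 \<le> d" for y d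
    unfolding window_increment[OF \<sigma> d]
    using one[OF d, of "{y + \<sigma><..y + \<sigma> + d}" "y + \<sigma>"] one[OF d, of "{y..<y + d}" y]
    by (simp add: right_diff_distrib power2_eq_square mult.assoc)
  show ?thesis
  proof (cases "0 \<le> d")
    case True
    then show ?thesis using pos[OF True, of y] mult_nonneg_nonneg[OF K, of "d\<^sup>2"] by simp
  next
    case False
    define e where "e = - d"
    have e: "0 \<le> e" "d = - e" using False by (auto simp: e_def)
    have "\<bar>window \<sigma> f y - window \<sigma> f (y - e) - e * (f (y - e + \<sigma>) - f (y - e))\<bar> \<le> 2 * K * e\<^sup>2"
      using pos[OF e(1), of "y - e"] by simp
    moreover have "\<bar>e * (f (y - e + \<sigma>) - f (y + \<sigma>))\<bar> \<le> e * (K * e)"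
      unfolding abs_mult using L[of "y - e + \<sigma>" "y + \<sigma>"] e(1) by (intro mult_mono) auto
    moreover have "\<bar>e * (f (y - e) - f y)\<bar> \<le> e * (K * e)"
      unfolding abs_mult using L[of "y - e" y] e(1) by (intro mult_mono) auto
    ultimately show ?thesis
      unfolding e(2) by (simp add: power2_eq_square algebra_simps)
  qed
qed

end

text \<open>Integrals over intervals depend continuously on the endpoints, so they all vanish. Then the
  measure with density \<open>1 + f\<close> assigns every interval its length.\<close>
lemma AE_zero_of_windows:
  fixes f :: "real \<Rightarrow> real"
  assumes f[measurable]: "f \<in> borel_measurable borel" and C: "\<And>u. \<bar>f u\<bar> \<le> 1"
    and zero: "\<And>a r. a \<in> \<rat> \<Longrightarrow> r \<in> \<rat> \<Longrightarrow> 0 < r \<Longrightarrow> window r f a = 0"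
  shows "AE u in lborel. f u = 0"
proof -
  have zero': "window (v - u) f u = 0" if uv: "u < v" for u v
  proof (rule ccontr)
    assume nz: "window (v - u) f u \<noteq> 0"
    define W where "W = window (v - u) f u"
    \<comment> \<open>the second bound keeps the rational points \<open>a\<close> and \<open>b\<close> below in the right order\<close>
    define e where "e = min (\<bar>W\<bar> / 8) ((v - u) / 4)"
    have "0 < \<bar>W\<bar>" using nz by (simp add: W_def)
    then have e: "0 < e" "8 * e \<le> \<bar>W\<bar>" "4 * e \<le> v - u" using uv unfolding e_def by (auto simp: min_def)
    obtain a where a: "a \<in> \<rat>" "u < a" "a < u + e" using Rats_dense_in_real[of u "u + e"] e(1) by auto
    obtain b where b: "b \<in> \<rat>" "v < b" "b < v + e" using Rats_dense_in_real[of v "v + e"] e(1) by auto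
    have "0 < b - a" using a b e by linarith
    then have z: "window (b - a) f a = 0" using zero[of a "b - a"] a(1) b(1) by simp
    have i: "integrable lborel (\<lambda>s. indicator S s * f s)" if "S \<in> sets borel" "S \<subseteq> {u..b}" for S
      using integrable_indicator_bounded[OF f C that] .
    have "(\<integral>s. indicator {u..v} s * f s \<partial>lborel) - (\<integral>s. indicator {a..b} s * f s \<partial>lborel) =
        (\<integral>s. indicator {u..v} s * f s - indicator {a..b} s * f s \<partial>lborel)"
      using a b by (intro Bochner_Integration.integral_diff[symmetric] i) auto
    also have "\<dots> = (\<integral>s. indicator {u..<a} s * f s - indicator {v<..b} s * f s \<partial>lborel)"
      using a b e by (intro Bochner_Integration.integral_cong) (auto split: split_indicator)
    also have "\<dots> = (\<integral>s. indicator {u..<a} s * f s \<partial>lborel) - (\<integral>s. indicator {v<..b} s * f s \<partial>lborel)"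
      using a b e by (intro Bochner_Integration.integral_diff i) (auto simp: subset_iff)
    finally have "W = (\<integral>s. indicator {u..<a} s * f s \<partial>lborel) - (\<integral>s. indicator {v<..b} s * f s \<partial>lborel)"
      using z unfolding window_eq W_def by simp
    moreover have "\<bar>\<integral>s. indicator {u..<a} s * f s \<partial>lborel\<bar> \<le> 1 * (a - u)"
      using a by (intro integral_indicator_bounded[OF f]) (auto simp: C)
    moreover have "\<bar>\<integral>s. indicator {v<..b} s * f s \<partial>lborel\<bar> \<le> 1 * (b - v)"
      using b by (intro integral_indicator_bounded[OF f]) (auto simp: C)
    ultimately have "\<bar>W\<bar> \<le> (a - u) + (b - v)"
      using abs_triangle_ineq4 by (smt (verit) mult_1)
    then have "\<bar>W\<bar> \<le> 2 * e" using a b by linarith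
    then show False using e by linarith
  qed
  have pos: "0 \<le> 1 + f u" for u using C[of u] by linarith
  have "lborel = density lborel (\<lambda>u. ennreal (1 + f u))"
  proof (rule lborel_eqI)
    fix l u :: real assume "\<And>b. b \<in> Basis \<Longrightarrow> l \<bullet> b \<le> u \<bullet> b"
    then have lu: "l \<le> u" by simp
    have "emeasure (density lborel (\<lambda>u. ennreal (1 + f u))) (box l u) =
        (\<integral>\<^sup>+s. ennreal (indicator {l..u} s * (1 + f s)) \<partial>lborel)"
    proof (subst emeasure_density)
      show "(\<integral>\<^sup>+s. ennreal (1 + f s) * indicator (box l u) s \<partial>lborel) =
          (\<integral>\<^sup>+s. ennreal (indicator {l..u} s * (1 + f s)) \<partial>lborel)"
      proof (rule nn_integral_cong_AE)
        have "AE s in lborel. s \<noteq> l \<and> s \<noteq> u"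
          using AE_lborel_singleton[of l] AE_lborel_singleton[of u] by eventually_elim simp
        then show "AE s in lborel. ennreal (1 + f s) * indicator (box l u) s = ennreal (indicator {l..u} s * (1 + f s))"
          by eventually_elim (auto split: split_indicator simp: box_real)
      qed
    qed simp_all
    also have "\<dots> = ennreal (\<integral>s. indicator {l..u} s * (1 + f s) \<partial>lborel)"
      using C pos by (intro nn_integral_eq_integral integrable_indicator_bounded[where C=2 and a=l and b=u] always_eventually)
        (auto simp: abs_le_iff intro: order.trans[OF C])
    also have "(\<integral>s. indicator {l..u} s * (1 + f s) \<partial>lborel) =
        (\<integral>s. indicator {l..u} s * 1 + indicator {l..u} s * f s \<partial>lborel)" by (simp add: distrib_left)
    also have "\<dots> = (\<integral>s. indicator {l..u} s * 1 \<partial>lborel) + (\<integral>s. indicator {l..u} s * f s \<partial>lborel)"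
      by (intro Bochner_Integration.integral_add integrable_indicator_bounded[where C=1 and a=l and b=u]) (simp_all add: C)
    also have "\<dots> = u - l"
    proof (cases "l = u")
      case True
      have "AE s in lborel. indicator {u} s * f s = 0"
        using AE_lborel_singleton[of u] by eventually_elim simp
      then have "(\<integral>s. indicator {u} s * f s \<partial>lborel) = 0" by (rule integral_eq_zero_AE)
      then show ?thesis using True by simp
    next
      case False
      then show ?thesis using zero'[of l u] lu unfolding window_eq by simp
    qed
    finally show "emeasure (density lborel (\<lambda>u. ennreal (1 + f u))) (box l u) = (\<Prod>b\<in>Basis. (u - l) \<bullet> b)"
      by simp
  qed simp
  then have "density lborel (\<lambda>u. ennreal 1) = density lborel (\<lambda>u. ennreal (1 + f u))"
    by (simp add: density_1)
  then have "AE u in lborel. ennreal 1 = ennreal (1 + f u)"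
    by (subst (asm) sigma_finite_measure.density_unique_iff[OF sigma_finite_lborel]) auto
  then show ?thesis
  proof eventually_elim
    fix u assume "ennreal 1 = ennreal (1 + f u)"
    then show "f u = 0" using pos[of u] by (subst (asm) ennreal_inj) auto
  qed
qed

section \<open>From flip invariance to translation invariance\<close>

text \<open>If the truncated series converged, its terms would tend to \<open>0\<close>: eventually \<open>\<bar>a n\<bar> \<le> \<eta>\<close> would imply
  \<open>\<bar>a n\<bar> < \<eta> / 2\<close>. Steps smaller than \<open>\<eta> / 2\<close> cannot leave this range, so from some index on nothing
  would be truncated.\<close>
lemma truncated_squares_not_summable:
  fixes a :: "nat \<Rightarrow> real"
  assumes step: "(\<lambda>n. a (Suc n) - a n) \<longlonglongrightarrow> 0" and close: "\<And>\<delta> N. 0 < \<delta> \<Longrightarrow> \<exists>n\<ge>N. \<bar>a n\<bar> < \<delta>"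
    and ns: "\<not> summable (\<lambda>n. (a n)\<^sup>2)" and \<eta>: "0 < \<eta>"
  shows "\<not> summable (\<lambda>n. if \<bar>a n\<bar> \<le> \<eta> then (a n)\<^sup>2 else 0)"
proof
  assume s: "summable (\<lambda>n. if \<bar>a n\<bar> \<le> \<eta> then (a n)\<^sup>2 else 0)"
  have "\<forall>\<^sub>F n in sequentially. (if \<bar>a n\<bar> \<le> \<eta> then (a n)\<^sup>2 else 0) < (\<eta> / 2)\<^sup>2"
    by (rule order_tendstoD(2)[OF summable_LIMSEQ_zero[OF s]]) (use \<eta> in simp)
  moreover have "\<forall>\<^sub>F n in sequentially. \<bar>a (Suc n) - a n\<bar> < \<eta> / 2"
    using order_tendstoD(2)[OF tendsto_rabs_zero[OF step], of "\<eta> / 2"] \<eta> by simp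
  ultimately have "\<forall>\<^sub>F n in sequentially. (if \<bar>a n\<bar> \<le> \<eta> then (a n)\<^sup>2 else 0) < (\<eta> / 2)\<^sup>2 \<and> \<bar>a (Suc n) - a n\<bar> < \<eta> / 2"
    by (rule eventually_conj)
  then obtain N where N: "\<And>n. N \<le> n \<Longrightarrow> (if \<bar>a n\<bar> \<le> \<eta> then (a n)\<^sup>2 else 0) < (\<eta> / 2)\<^sup>2 \<and> \<bar>a (Suc n) - a n\<bar> < \<eta> / 2"
    unfolding eventually_sequentially by blast
  obtain m where m: "N \<le> m" "\<bar>a m\<bar> < \<eta>" using close[OF \<eta>] by blast
  have small: "\<bar>a n\<bar> \<le> \<eta>" if "m \<le> n" for n
    using that
  proof (induction n rule: dec_induct)
    case base
    show ?case using m by simp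
  next
    case (step n)
    have "(a n)\<^sup>2 < (\<eta> / 2)\<^sup>2" using N[of n] step m by simp
    then have "\<bar>a n\<bar>\<^sup>2 < (\<eta> / 2)\<^sup>2" by simp
    then have "\<bar>a n\<bar> < \<eta> / 2" by (rule power_less_imp_less_base) (use \<eta> in simp)
    moreover have "\<bar>a (Suc n) - a n\<bar> < \<eta> / 2" using N[of n] step m by simp
    ultimately show ?case by linarith
  qed
  have "summable (\<lambda>n. (a n)\<^sup>2)"
    by (rule summable_comparison_test_ev[OF eventually_sequentiallyI[of m] s]) (simp add: small)
  then show False using ns by simp
qed

context half_stationary_shift
begin

text \<open>Take for \<open>U\<close> the moving integral, of lengths \<open>t\<close> and \<open>\<tau>\<close>, of \<open>F x\<close> at a fixed \<open>y\<close>. Flip invariance turns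
  flipping a coordinate into translating \<open>y\<close>, and the derivative \<open>H\<close> in \<open>y\<close> is the difference of two
  integrals of \<open>F x\<close> over intervals of length \<open>\<tau>\<close> that are \<open>t\<close> apart. That \<open>H = 0\<close> for all \<open>y\<close> and \<open>\<tau>\<close>
  says that translation by \<open>t\<close> does not change \<open>F x\<close>.\<close>
lemma translation_invariant_of_flip_invariant:
  fixes F :: "(int \<Rightarrow> bool) \<Rightarrow> real \<Rightarrow> real"
  assumes meas: "(\<lambda>(x, y). F x y) \<in> borel_measurable (cantor \<Otimes>\<^sub>M borel)"
    and bound: "\<And>x y. \<bar>F x y\<bar> \<le> 1"
    and flip: "\<And>k. 1 \<le> k \<Longrightarrow> AE x in M. AE y in lborel.
      F (flip k x) (y + signed_gap k x) = F x y"
    and div: "\<And>\<eta>. 0 < \<eta> \<Longrightarrow> \<not> summable (\<lambda>n. if \<bar>bias n\<bar> \<le> \<eta> then (bias n)\<^sup>2 else 0)"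
    and t: "0 \<le> t"
  shows "AE x in M. AE y in lborel. F x (y + t) = F x y"
proof -
  have F_meas: "(\<lambda>z. F (f z) (g z)) \<in> borel_measurable N"
    if "f \<in> measurable N cantor" "g \<in> borel_measurable N" for f g and N :: "'z measure"
    using measurable_compose[OF measurable_Pair[OF that] meas] by simp
  have F1: "F x \<in> borel_measurable borel" for x by (rule F_meas) auto
  have W1: "window \<tau> (F x) \<in> borel_measurable borel" for \<tau> x
    by (rule window_measurable[OF F1 bound])
  have W_meas: "(\<lambda>z. window \<tau> (F (f z)) (g z)) \<in> borel_measurable N"
    if [measurable]: "f \<in> measurable N cantor" "g \<in> borel_measurable N" for f g \<tau> and N :: "'z measure"
  proof -
    have [measurable]: "(\<lambda>w. F (f (fst w)) (g (fst w) + snd w)) \<in> borel_measurable (N \<Otimes>\<^sub>M lborel)"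
      by (rule F_meas) measurable
    show ?thesis unfolding window_def by measurable
  qed
  have H0: "AE x in M. window \<tau> (F x) (y + t) - window \<tau> (F x) y = 0" if \<tau>: "0 \<le> \<tau>" for y \<tau>
  proof -
    define U where "U x = window t (window \<tau> (F x)) y" for x
    define H where "H x = window \<tau> (F x) (y + t) - window \<tau> (F x) y" for x
    have W_bound: "\<bar>window \<tau> (F x) u\<bar> \<le> \<tau>" for x u
      using window_bounded[OF F1 bound \<tau>, of x u] by simp
    have W_lip: "\<bar>window \<tau> (F x) u - window \<tau> (F x) v\<bar> \<le> 2 * \<bar>u - v\<bar>" for x u v
      using window_lipschitz[OF F1 bound \<tau>, of x u v] by simp
    have "AE x in M. H x = 0"
    \<comment> \<open>\<open>8\<close> is the constant of the quadratic error for the Lipschitz constant \<open>2\<close>; the other summands bound \<open>H\<close> and \<open>U\<close>\<close>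
    proof (rule zero_of_flip_increments[where C="8 + 2 * \<tau> + \<tau> * t"])
      have "(\<lambda>w. window \<tau> (F (fst w)) (y + snd w)) \<in> borel_measurable (cantor \<Otimes>\<^sub>M lborel)"
        by (rule W_meas) measurable
      then show "U \<in> borel_measurable cantor" unfolding U_def window_def[of t] by measurable
      show "H \<in> borel_measurable cantor" unfolding H_def
        by (intro borel_measurable_diff W_meas) auto
      fix x
      have "\<bar>U x\<bar> \<le> \<tau> * t" unfolding U_def by (rule window_bounded[OF W1 W_bound t])
      then show "\<bar>U x\<bar> \<le> 8 + 2 * \<tau> + \<tau> * t" using \<tau> by simp
      have "\<bar>H x\<bar> \<le> 2 * \<tau>" unfolding H_def using W_bound[of x "y + t"] W_bound[of x y] by linarith
      then show "\<bar>H x\<bar> \<le> 8 + 2 * \<tau> + \<tau> * t" using mult_nonneg_nonneg[OF \<tau> t] by simp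
    next
      fix k :: int assume k: "1 \<le> k"
      show "AE x in M. \<bar>U (flip k x) - U x + signed_gap k x * H x\<bar>
          \<le> (8 + 2 * \<tau> + \<tau> * t) * (flip_gap k)\<^sup>2"
        using flip[OF k]
      proof eventually_elim
        fix x
        define g where "g = signed_gap k x"
        assume "AE y in lborel. F (flip k x) (y + signed_gap k x) = F x y"
        then have inv: "AE u in lborel. F (flip k x) (u + g) = F x u" by (simp add: g_def)
        have pm: "Measurable.pred borel (\<lambda>u. F (flip k x) (u + g) = F x u)"
          using F1 by measurable
        have shift: "window \<tau> (F (flip k x)) (v + g) = window \<tau> (F x) v" for v
          unfolding window_def
        proof (rule integral_cong_AE)
          have "AE s in lborel. F (flip k x) ((v + 1 * s) + g) = F x (v + 1 * s)"
            by (rule AE_borel_affine[OF _ pm inv]) simp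
          then show "AE s in lborel. indicator {0..\<tau>} s * F (flip k x) (v + g + s) = indicator {0..\<tau>} s * F x (v + s)"
            by eventually_elim (simp add: ac_simps)
        qed (use F1 in measurable)
        have "window t (window \<tau> (F (flip k x))) (y - g + g) = window t (window \<tau> (F x)) (y - g)"
        proof -
          have "window \<tau> (F (flip k x)) (y - g + g + s) = window \<tau> (F x) (y - g + s)" for s
            using shift[of "y - g + s"] by (simp add: algebra_simps)
          then show ?thesis unfolding window_def[of t] by simp
        qed
        then have "U (flip k x) = window t (window \<tau> (F x)) (y + - g)" by (simp add: U_def)
        then have "\<bar>U (flip k x) - U x + g * H x\<bar> \<le> 4 * 2 * (- g)\<^sup>2"
          using window_expansion[OF W1 W_bound W_lip t, of x y "- g"] by (simp add: U_def H_def)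
        also have "\<dots> \<le> (8 + 2 * \<tau> + \<tau> * t) * (flip_gap k)\<^sup>2"
          using \<tau> t by (auto simp: g_def intro!: mult_right_mono)
        finally show "\<bar>U (flip k x) - U x + signed_gap k x * H x\<bar>
          \<le> (8 + 2 * \<tau> + \<tau> * t) * (flip_gap k)\<^sup>2" by (simp add: g_def)
      qed
    qed (fact div)
    then show ?thesis by (simp add: H_def)
  qed
  have "AE x in M. \<forall>a\<in>\<rat>. \<forall>r\<in>\<rat>. 0 \<le> r \<longrightarrow> window r (F x) (a + t) - window r (F x) a = 0"
    by (intro AE_ball_countable[THEN iffD2] countable_rat ballI AE_impI H0)
  then show ?thesis
  proof eventually_elim
    fix x assume *: "\<forall>a\<in>\<rat>. \<forall>r\<in>\<rat>. 0 \<le> r \<longrightarrow> window r (F x) (a + t) - window r (F x) a = 0"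
    let ?\<phi> = "\<lambda>u. (F x (u + t) - F x u) / 2"
    have "AE u in lborel. ?\<phi> u = 0"
    proof (rule AE_zero_of_windows)
      show "?\<phi> \<in> borel_measurable borel" using F1 by measurable
      show "\<bar>?\<phi> u\<bar> \<le> 1" for u using bound[of x "u + t"] bound[of x u] by simp
      fix a r :: real assume ar: "a \<in> \<rat>" "r \<in> \<rat>" "0 < r"
      have i: "integrable lborel (\<lambda>s. indicator {0..r} s * F x (b + s))" for b
        by (rule integrable_indicator_bounded[OF _ bound]) (use F1 in auto)
      have "window r ?\<phi> a = (\<integral>s. (indicator {0..r} s * F x (a + t + s) - indicator {0..r} s * F x (a + s)) / 2 \<partial>lborel)"
        unfolding window_def by (intro Bochner_Integration.integral_cong) (auto simp: ac_simps split: split_indicator)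
      also have "\<dots> = (window r (F x) (a + t) - window r (F x) a) / 2"
        unfolding window_def using i by simp
      also have "\<dots> = 0" using * ar by simp
      finally show "window r ?\<phi> a = 0" .
    qed
    then show "AE y in lborel. F x (y + t) = F x y" by eventually_elim simp
  qed
qed

end

section \<open>Invariant functions of the Maharam extension\<close>

lemma AE_lborel_shift:
  fixes c :: real
  assumes "Measurable.pred borel Q" "AE y in lborel. Q y"
  shows "AE y in lborel. Q (y + c)"
  using AE_borel_affine[OF _ assms, of 1 c] by (simp add: add.commute)

lemma integral_cong_marginals:
  fixes h :: "(int \<Rightarrow> bool) \<Rightarrow> real"
  assumes [measurable]: "h \<in> borel_measurable cantor" and C: "\<And>x. \<bar>h x\<bar> \<le> C"
    and dep: "\<And>x w. h (glue J x w) = h x" and AB: "\<And>k. k \<in> J \<Longrightarrow> A k = B k"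
  shows "(\<integral>x. h x \<partial>\<mu> A) = (\<integral>x. h x \<partial>\<mu> B)"
proof -
  interpret A: prob_space "\<mu> A" by (rule prob_space_bernoulli)
  interpret B: prob_space "\<mu> B" by (rule prob_space_bernoulli)
  interpret AB: pair_prob_space "\<mu> A" "\<mu> B" ..
  have "B = (\<lambda>k. if k \<in> J then A k else B k)" using AB by auto
  then have "(\<integral>x. h x \<partial>\<mu> B) = (\<integral>x. h x \<partial>distr (\<mu> A \<Otimes>\<^sub>M \<mu> B) cantor (\<lambda>(x, w). glue J x w))"
    unfolding distr_glue by simp
  also have "\<dots> = (\<integral>z. h (fst z) \<partial>(\<mu> A \<Otimes>\<^sub>M \<mu> B))"
    by (subst integral_distr) (auto simp: split_beta dep)
  also have "\<dots> = (\<integral>x. \<integral>w. h x \<partial>\<mu> B \<partial>\<mu> A)"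
    by (subst AB.integral_fst'[symmetric]) (auto intro!: AB.P.integrable_const_bound[of _ C] simp: C)
  also have "\<dots> = (\<integral>x. h x \<partial>\<mu> A)" using B.prob_space by simp
  finally show ?thesis ..
qed

locale invariant_function = half_stationary_shift +
  fixes F :: "(int \<Rightarrow> bool) \<Rightarrow> real \<Rightarrow> real"
  assumes meas: "(\<lambda>(x, y). F x y) \<in> borel_measurable (cantor \<Otimes>\<^sub>M borel)"
    and bound: "\<And>x y. \<bar>F x y\<bar> \<le> 1"
    and invariant: "AE x in M. AE y in lborel. F (T x) (y + ln (jac x)) = F x y"
begin

lemma F_measurable [measurable (raw)]:
  assumes "f \<in> measurable N cantor" "g \<in> borel_measurable N"
  shows "(\<lambda>z. F (f z) (g z)) \<in> borel_measurable N"
  using measurable_compose[OF measurable_Pair[OF assms] meas] by simp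

definition future :: "nat \<Rightarrow> int set" where "future m = {- int m <..}"

definition cond_future :: "nat \<Rightarrow> (int \<Rightarrow> bool) \<Rightarrow> real \<Rightarrow> real" where
  "cond_future m x y = resample (future m) M (\<lambda>x. F x y) x"

lemma cond_future_measurable [measurable (raw)]:
  assumes [measurable]: "f \<in> measurable N cantor" "g \<in> borel_measurable N"
  shows "(\<lambda>z. cond_future m (f z) (g z)) \<in> borel_measurable N"
proof -
  have "(\<lambda>w. F (glue (future m) (f (fst w)) (snd w)) (g (fst w))) \<in> borel_measurable (N \<Otimes>\<^sub>M M)"
    by measurable
  then show ?thesis unfolding cond_future_def resample_def by measurable
qed

lemma cond_future_bound: "\<bar>cond_future m x y\<bar> \<le> 1"
  unfolding cond_future_def M_def by (rule resample_bounded) (auto intro: bound)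

lemma cond_future_glue: "future n \<subseteq> J \<Longrightarrow> cond_future n (glue J x w) y = cond_future n x y"
  unfolding cond_future_def by (rule resample_glue)

lemma AE_commute_lborel:
  assumes "Measurable.pred (M \<Otimes>\<^sub>M lborel) (\<lambda>z. Q (fst z) (snd z))"
  shows "(AE x in M. AE y in lborel. Q x y) \<longleftrightarrow> (AE y in lborel. AE x in M. Q x y)"
proof -
  interpret pair_sigma_finite M lborel ..
  show ?thesis by (rule AE_commute) (use assms in \<open>simp only: pred_def\<close>)
qed

text \<open>Shifting \<open>x\<close> turns the coordinates above \<open>- m\<close> into those above \<open>- (m + 1)\<close>. The translation of \<open>y\<close>
  involves only the derivative, which ignores the resampled coordinates, and these have the same law
  before and after the shift.\<close>
lemma cond_future_shift: "AE x in M. AE y in lborel. cond_future (Suc m) (T x) (y + ln (jac x)) = cond_future m x y"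
proof -
  let ?J = "future m"
  have J: "{1..} \<subseteq> ?J" by (auto simp: future_def)
  have "AE x in M. AE w in M. AE y in lborel.
      F (T (glue ?J x w)) (y + ln (jac (glue ?J x w))) = F (glue ?J x w) y"
    using AE_glue[OF invariant[unfolded M_def], of ?J] unfolding M_def .
  moreover have "AE x in M. AE w in M. jac (glue ?J x w) = jac x" by (rule AE_jac_glue[OF J])
  ultimately show ?thesis
  proof eventually_elim
    case (elim x)
    have "AE w in M. AE y in lborel. F (T (glue ?J x w)) (y + ln (jac x)) = F (glue ?J x w) y"
      using elim by eventually_elim simp
    then have "AE y in lborel. AE w in M. F (T (glue ?J x w)) (y + ln (jac x)) = F (glue ?J x w) y"
      by (subst (asm) AE_commute_lborel) measurable
    then show ?case
    proof eventually_elim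
      case (elim y)
      define h where "h w = F (T (glue ?J x w)) (y + ln (jac x))" for w
      have [measurable]: "h \<in> borel_measurable cantor" unfolding h_def by measurable
      have hb: "\<bar>h w\<bar> \<le> 1" for w unfolding h_def by (rule bound)
      have "glue (future (Suc m)) (T x) w = T (glue ?J x (unshift w))" for w
        by (auto simp: glue_def full_shift_def unshift_def future_def)
      then have "cond_future (Suc m) (T x) (y + ln (jac x)) = (\<integral>w. h (unshift w) \<partial>M)"
        by (simp add: cond_future_def resample_def h_def)
      also have "\<dots> = (\<integral>w. h w \<partial>\<mu> (\<lambda>k. P (k - int 1)))"
      proof -
        have u: "(\<lambda>x k. x (k - int 1)) = unshift" by (auto simp: unshift_def)
        show ?thesis unfolding distr_translate[symmetric] u M_def by (subst integral_distr) auto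
      qed
      also have "\<dots> = (\<integral>w. h w \<partial>M)"
        unfolding M_def
      proof (rule integral_cong_marginals[OF _ hb, where J="- ?J"])
        fix v w
        have "glue ?J x (glue (- ?J) v w) = glue ?J x v" by (auto simp: glue_def)
        then show "h (glue (- ?J) v w) = h v" by (simp add: h_def)
      next
        fix k assume "k \<in> - ?J"
        then have "k \<le> 0" by (auto simp: future_def)
        then show "P (k - int 1) = P k" using past_eq[of k] past_eq[of "k - 1"] by simp
      qed measurable
      also have "\<dots> = cond_future m x y"
        unfolding cond_future_def resample_def h_def by (rule integral_cong_AE) (use elim in simp_all)
      finally show ?case .
    qed
  qed
qed

lemma iterate_shift_relation:
  assumes [measurable]: "\<And>m x. G m x \<in> borel_measurable borel"
    and G: "\<And>m. AE x in M. AE y in lborel. G (Suc m) (T x) (y + ln (jac x)) = (G m x y :: real)"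
  shows "AE x in M. AE y in lborel. G (n + m) ((T ^^ n) x) (y + logjac n x) = G m x y"
proof (induction n arbitrary: m)
  case (Suc n)
  show ?case
    using AE_shift[OF Suc[of "Suc m"]] G[of m]
  proof eventually_elim
    case (elim x)
    have "AE y in lborel. G (n + Suc m) ((T ^^ n) (T x)) (y + ln (jac x) + logjac n (T x)) =
        G (Suc m) (T x) (y + ln (jac x))"
      by (rule AE_lborel_shift[OF _ elim(1)]) measurable
    then show ?case
      using elim(2) by eventually_elim (simp add: logjac_Suc funpow_swap1 add.assoc)
  qed
qed simp

lemma cond_future_shift_power:
  "AE x in M. AE y in lborel. cond_future (n + m) ((T ^^ n) x) (y + logjac n x) = cond_future m x y"
  by (rule iterate_shift_relation[where G=cond_future, OF _ cond_future_shift]) measurable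

lemma F_shift_power:
  "AE x in M. AE y in lborel. F ((T ^^ n) x) (y + logjac n x) = F x y"
  by (rule iterate_shift_relation[where G="\<lambda>_. F", OF _ invariant]) measurable

definition incr :: "nat \<Rightarrow> (int \<Rightarrow> bool) \<Rightarrow> real \<Rightarrow> ennreal" where
  "incr m x y = ennreal ((cond_future (Suc m) x y - cond_future m x y)\<^sup>2)"

lemma incr_measurable [measurable (raw)]:
  assumes [measurable]: "f \<in> measurable N cantor" "g \<in> borel_measurable N"
  shows "(\<lambda>z. incr m (f z) (g z)) \<in> borel_measurable N"
  unfolding incr_def by measurable

text \<open>The squared norms of orthogonal increments telescope.\<close>
lemma incr_sum_le: "(\<Sum>m. \<integral>\<^sup>+x. incr m x y \<partial>M) \<le> 1"
proof (rule suminf_le_const)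
  fix N
  have Fy: "(\<lambda>x. F x y) \<in> borel_measurable cantor" by measurable
  have sq: "\<bar>(cond_future m x y)\<^sup>2\<bar> \<le> 1" for m x
    using power_mono[OF cond_future_bound[of m x y], of 2] by simp
  have "(\<integral>\<^sup>+x. incr m x y \<partial>M) = ennreal ((\<integral>x. (cond_future (Suc m) x y)\<^sup>2 \<partial>M) - (\<integral>x. (cond_future m x y)\<^sup>2 \<partial>M))" for m
  proof -
    have "(\<integral>\<^sup>+x. incr m x y \<partial>M) = ennreal (\<integral>x. (cond_future (Suc m) x y - cond_future m x y)\<^sup>2 \<partial>M)"
      unfolding incr_def
    proof (rule nn_integral_eq_integral)
      show "integrable M (\<lambda>x. (cond_future (Suc m) x y - cond_future m x y)\<^sup>2)"
      proof (rule integrable_M[where D="2\<^sup>2"])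
        fix x
        have "\<bar>cond_future (Suc m) x y - cond_future m x y\<bar> \<le> 2"
          using cond_future_bound[of m x y] cond_future_bound[of "Suc m" x y] by linarith
        from power_mono[OF this, of 2]
        show "\<bar>(cond_future (Suc m) x y - cond_future m x y)\<^sup>2\<bar> \<le> 2\<^sup>2" by simp
      qed measurable
    qed simp
    also have "(\<integral>x. (cond_future (Suc m) x y - cond_future m x y)\<^sup>2 \<partial>M) = (\<integral>x. (cond_future (Suc m) x y)\<^sup>2 \<partial>M) - (\<integral>x. (cond_future m x y)\<^sup>2 \<partial>M)"
      unfolding cond_future_def M_def by (rule integral_resample_diff_sq[OF Fy bound]) (auto simp: future_def)
    finally show ?thesis .
  qed
  moreover have "(\<integral>x. (cond_future m x y)\<^sup>2 \<partial>M) \<le> (\<integral>x. (cond_future (Suc m) x y)\<^sup>2 \<partial>M)" for m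
    unfolding cond_future_def M_def by (rule integral_resample_sq_mono[OF Fy bound]) (auto simp: future_def)
  ultimately have "(\<Sum>m<N. \<integral>\<^sup>+x. incr m x y \<partial>M) = ennreal (\<Sum>m<N. (\<integral>x. (cond_future (Suc m) x y)\<^sup>2 \<partial>M) - (\<integral>x. (cond_future m x y)\<^sup>2 \<partial>M))"
    by (subst sum_ennreal[symmetric]) auto
  also have "\<dots> = ennreal ((\<integral>x. (cond_future N x y)\<^sup>2 \<partial>M) - (\<integral>x. (cond_future 0 x y)\<^sup>2 \<partial>M))"
    by (subst sum_lessThan_telescope) simp
  also have "\<dots> \<le> ennreal 1"
  proof (rule ennreal_leI)
    have "(\<integral>x. (cond_future N x y)\<^sup>2 \<partial>M) \<le> (\<integral>x. 1 \<partial>M)"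
      by (rule integral_mono) (use sq in \<open>auto intro!: integrable_M[where D=1]\<close>)
    then have "(\<integral>x. (cond_future N x y)\<^sup>2 \<partial>M) \<le> 1" using prob_space by simp
    moreover have "0 \<le> (\<integral>x. (cond_future 0 x y)\<^sup>2 \<partial>M)" by simp
    ultimately show "(\<integral>x. (cond_future N x y)\<^sup>2 \<partial>M) - (\<integral>x. (cond_future 0 x y)\<^sup>2 \<partial>M) \<le> 1" by linarith
  qed
  finally show "(\<Sum>m<N. \<integral>\<^sup>+x. incr m x y \<partial>M) \<le> 1" by simp
qed simp

text \<open>The Maharam extension preserves the measure: \<open>exp (logjac m)\<close>, which accounts for the change of \<open>x\<close>,
  cancels against the translation of \<open>exp (- y)\<close>.\<close>
lemma incr_shift:
  assumes [measurable]: "\<phi> \<in> borel_measurable borel"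
  shows "(\<integral>\<^sup>+x. \<integral>\<^sup>+y. \<phi> y * ennreal (exp (- y)) * incr m x y \<partial>lborel \<partial>M) =
    (\<integral>\<^sup>+x. \<integral>\<^sup>+y. \<phi> (y + logjac m x) * ennreal (exp (- y)) * incr 0 x y \<partial>lborel \<partial>M)"
proof -
  let ?\<Psi> = "\<lambda>x. \<integral>\<^sup>+y. \<phi> y * ennreal (exp (- y)) * incr m x y \<partial>lborel"
  have [measurable]: "?\<Psi> \<in> borel_measurable cantor" by measurable
  have "(\<integral>\<^sup>+x. ?\<Psi> x \<partial>M) = (\<integral>\<^sup>+x. ?\<Psi> ((T ^^ m) x) * ennreal (exp (logjac m x)) \<partial>M)"
    by (rule nn_integral_shift_power) measurable
  also have "\<dots> = (\<integral>\<^sup>+x. \<integral>\<^sup>+y. \<phi> (y + logjac m x) * ennreal (exp (- y)) * incr 0 x y \<partial>lborel \<partial>M)"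
  proof (rule nn_integral_cong_AE)
    show "AE x in M. ?\<Psi> ((T ^^ m) x) * ennreal (exp (logjac m x)) =
        (\<integral>\<^sup>+y. \<phi> (y + logjac m x) * ennreal (exp (- y)) * incr 0 x y \<partial>lborel)"
      using cond_future_shift_power[of m 0] cond_future_shift_power[of m 1]
    proof eventually_elim
      case (elim x)
      let ?l = "logjac m x"
      have "?\<Psi> ((T ^^ m) x) * ennreal (exp ?l) =
         (\<integral>\<^sup>+y. \<phi> y * ennreal (exp (- y)) * incr m ((T ^^ m) x) y * ennreal (exp ?l) \<partial>lborel)"
        by (rule nn_integral_multc[symmetric]) measurable
      also have "\<dots> = (\<integral>\<^sup>+y. \<phi> (?l + 1 * y) * ennreal (exp (- (?l + 1 * y))) * incr m ((T ^^ m) x) (?l + 1 * y) * ennreal (exp ?l) \<partial>lborel)"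
        by (subst nn_integral_real_affine[where c=1 and t="?l"]) simp_all
      also have "\<dots> = (\<integral>\<^sup>+y. \<phi> (y + ?l) * ennreal (exp (- y)) * incr 0 x y \<partial>lborel)"
      proof (rule nn_integral_cong_AE)
        show "AE y in lborel. \<phi> (?l + 1 * y) * ennreal (exp (- (?l + 1 * y))) * incr m ((T ^^ m) x) (?l + 1 * y) * ennreal (exp ?l) =
            \<phi> (y + ?l) * ennreal (exp (- y)) * incr 0 x y"
          using elim
        proof eventually_elim
          case (elim y)
          then have i: "incr m ((T ^^ m) x) (?l + 1 * y) = incr 0 x y"
            by (simp add: incr_def add.commute)
          have e: "ennreal (exp (- (?l + 1 * y))) * ennreal (exp ?l) = ennreal (exp (- y))"
            by (subst ennreal_mult[symmetric]) (auto simp flip: exp_add)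
          show ?case
            unfolding i e[symmetric] by (simp add: ac_simps)
        qed
      qed
      finally show ?case .
    qed
  qed
  finally show ?thesis .
qed

end

lemma nn_integral_exp_atLeast:
  "(\<integral>\<^sup>+y. indicator {- c..} y * ennreal (exp (- y)) \<partial>lborel) < \<infinity>"
proof -
  have "(\<integral>\<^sup>+y. ennreal (exp (- y)) * indicator {- c..} y \<partial>lborel) = ennreal (0 - (- exp (- (- c))))"
  proof (rule nn_integral_FTC_atLeast)
    show "((\<lambda>y::real. - exp (- y)) \<longlongrightarrow> 0) at_top"
      using tendsto_minus[OF filterlim_compose[OF exp_at_bot filterlim_uminus_at_bot_at_top]] by simp
    show "((\<lambda>y. - exp (- y)) has_real_derivative exp (- y)) (at y)" for y :: real
      by (auto intro!: derivative_eq_intros)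
  qed auto
  then show ?thesis by (simp add: mult.commute)
qed

context invariant_function
begin

text \<open>The weighted number of visits of the orbit of \<open>(x, y)\<close> to the half-space where the second coordinate is
  at least \<open>- c\<close>; that half-space has finite measure.\<close>
definition visits :: "real \<Rightarrow> (int \<Rightarrow> bool) \<Rightarrow> real \<Rightarrow> ennreal" where
  "visits c x y = (\<Sum>m. indicator {- c..} (y + logjac m x) * ennreal (exp (- y)) * incr 0 x y)"

lemma visits_measurable [measurable (raw)]:
  assumes [measurable]: "f \<in> measurable N cantor" "g \<in> borel_measurable N"
  shows "(\<lambda>z. visits c (f z) (g z)) \<in> borel_measurable N"
  unfolding visits_def by measurable

lemma visits_integrable: "(\<integral>\<^sup>+x. \<integral>\<^sup>+y. visits c x y \<partial>lborel \<partial>M) < \<infinity>"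
proof -
  interpret pair_sigma_finite M lborel ..
  let ?\<phi> = "indicator {- c..} :: real \<Rightarrow> ennreal"
  have "(\<integral>\<^sup>+x. \<integral>\<^sup>+y. (\<Sum>m. ?\<phi> (y + logjac m x) * ennreal (exp (- y)) * incr 0 x y) \<partial>lborel \<partial>M) =
      (\<integral>\<^sup>+x. (\<Sum>m. \<integral>\<^sup>+y. ?\<phi> (y + logjac m x) * ennreal (exp (- y)) * incr 0 x y \<partial>lborel) \<partial>M)"
    by (intro nn_integral_cong nn_integral_suminf) measurable
  also have "\<dots> = (\<Sum>m. \<integral>\<^sup>+x. \<integral>\<^sup>+y. ?\<phi> (y + logjac m x) * ennreal (exp (- y)) * incr 0 x y \<partial>lborel \<partial>M)"
    by (rule nn_integral_suminf) measurable
  also have "\<dots> = (\<Sum>m. \<integral>\<^sup>+x. \<integral>\<^sup>+y. ?\<phi> y * ennreal (exp (- y)) * incr m x y \<partial>lborel \<partial>M)"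
    by (intro suminf_cong incr_shift[symmetric]) measurable
  also have "\<dots> = (\<Sum>m. \<integral>\<^sup>+y. \<integral>\<^sup>+x. ?\<phi> y * ennreal (exp (- y)) * incr m x y \<partial>M \<partial>lborel)"
    by (intro suminf_cong Fubini'[symmetric]) measurable
  also have "\<dots> = (\<Sum>m. \<integral>\<^sup>+y. ?\<phi> y * ennreal (exp (- y)) * (\<integral>\<^sup>+x. incr m x y \<partial>M) \<partial>lborel)"
    by (intro suminf_cong nn_integral_cong nn_integral_cmult) measurable
  also have "\<dots> = (\<integral>\<^sup>+y. (\<Sum>m. ?\<phi> y * ennreal (exp (- y)) * (\<integral>\<^sup>+x. incr m x y \<partial>M)) \<partial>lborel)"
    by (rule nn_integral_suminf[symmetric]) measurable
  also have "\<dots> = (\<integral>\<^sup>+y. ?\<phi> y * ennreal (exp (- y)) * (\<Sum>m. \<integral>\<^sup>+x. incr m x y \<partial>M) \<partial>lborel)"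
    by simp
  also have "\<dots> \<le> (\<integral>\<^sup>+y. ?\<phi> y * ennreal (exp (- y)) * 1 \<partial>lborel)"
    by (intro nn_integral_mono mult_left_mono incr_sum_le) auto
  also have "\<dots> < \<infinity>" using nn_integral_exp_atLeast[of c] by simp
  finally show ?thesis unfolding visits_def .
qed

text \<open>An orbit that visits each of these half-spaces only finitely often escapes to \<open>- \<infinity>\<close>.\<close>
lemma drift_of_finite_visits:
  assumes fin: "\<And>c::nat. visits (real c) x y \<noteq> \<infinity>"
    and nz: "incr 0 x y \<noteq> 0"
  shows "drift (\<lambda>m. logjac m x)"
  unfolding drift_def
proof
  fix c :: nat
  define d where "d = exp (- y) * (cond_future (Suc 0) x y - cond_future 0 x y)\<^sup>2"
  have d: "0 < d" using nz by (simp add: d_def incr_def)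
  obtain c' :: nat where c': "real c - y \<le> real c'" using real_arch_simple by blast
  have "indicator {- real c'..} (y + logjac m x) * ennreal (exp (- y)) * incr 0 x y =
      ennreal (indicator {- real c'..} (y + logjac m x) * d)" for m
    by (auto simp: d_def incr_def ennreal_mult split: split_indicator)
  then have "(\<Sum>m. ennreal (indicator {- real c'..} (y + logjac m x) * d)) \<noteq> \<infinity>"
    using fin[of c'] by (simp add: visits_def)
  then have "summable (\<lambda>m. indicator {- real c'..} (y + logjac m x) * d)"
    using d by (intro summable_suminf_not_top) auto
  then have "(\<lambda>m. indicator {- real c'..} (y + logjac m x) * d) \<longlonglongrightarrow> 0" by (rule summable_LIMSEQ_zero)
  then have "\<forall>\<^sub>F m in sequentially. indicator {- real c'..} (y + logjac m x) * d < d"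
    using d by (rule order_tendstoD(2))
  then have "\<forall>\<^sub>F m in sequentially. logjac m x < - real c"
  proof eventually_elim
    fix m assume "indicator {- real c'..} (y + logjac m x) * d < d"
    then have "y + logjac m x \<notin> {- real c'..}" using d by (auto simp: indicator_def)
    then show "logjac m x < - real c" using c' by simp
  qed
  then show "\<exists>N. \<forall>n. N \<le> n \<longrightarrow> logjac n x < - real c" by (simp add: eventually_sequentially)
qed

context
  assumes cons: "conservative M T"
begin

lemma incr_0_zero: "AE x in M. AE y in lborel. incr 0 x y = 0"
proof -
  have fin: "AE x in M. \<forall>c::nat. (\<integral>\<^sup>+y. visits (real c) x y \<partial>lborel) \<noteq> \<infinity>"
    unfolding AE_all_countable
  proof
    fix c :: nat
    show "AE x in M. (\<integral>\<^sup>+y. visits (real c) x y \<partial>lborel) \<noteq> \<infinity>"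
      using visits_integrable[of "real c"] by (intro nn_integral_PInf_AE) auto
  qed
  show ?thesis
    using fin not_drift[OF cons]
  proof eventually_elim
    case (elim x)
    note f = elim(1) and nd = elim(2)
    have "AE y in lborel. \<forall>c::nat. visits (real c) x y \<noteq> \<infinity>"
      unfolding AE_all_countable
    proof
      fix c :: nat
      show "AE y in lborel. visits (real c) x y \<noteq> \<infinity>"
        by (rule nn_integral_PInf_AE[OF _ f[rule_format]]) measurable
    qed
    then show ?case
    proof eventually_elim
      case (elim y)
      then show ?case using nd drift_of_finite_visits[of x y] by blast
    qed
  qed
qed

lemma incr_zero: "AE x in M. AE y in lborel. incr m x y = 0"
proof -
  have "(\<integral>\<^sup>+x. \<integral>\<^sup>+y. 1 * ennreal (exp (- y)) * incr m x y \<partial>lborel \<partial>M) =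
      (\<integral>\<^sup>+x. \<integral>\<^sup>+y. 1 * ennreal (exp (- y)) * incr 0 x y \<partial>lborel \<partial>M)"
    using incr_shift[of "\<lambda>_. 1" m] by simp
  also have "\<dots> = (\<integral>\<^sup>+x. 0 \<partial>M)"
  proof (rule nn_integral_cong_AE)
    show "AE x in M. (\<integral>\<^sup>+y. 1 * ennreal (exp (- y)) * incr 0 x y \<partial>lborel) = 0"
      using incr_0_zero
    proof eventually_elim
      case (elim x)
      then show ?case
        by (subst nn_integral_0_iff_AE) (auto elim!: eventually_mono)
    qed
  qed
  finally have "(\<integral>\<^sup>+x. \<integral>\<^sup>+y. 1 * ennreal (exp (- y)) * incr m x y \<partial>lborel \<partial>M) = 0" by simp
  then have "AE x in M. (\<integral>\<^sup>+y. 1 * ennreal (exp (- y)) * incr m x y \<partial>lborel) = 0"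
    by (subst (asm) nn_integral_0_iff_AE) measurable
  then show ?thesis
  proof eventually_elim
    case (elim x)
    then have "AE y in lborel. 1 * ennreal (exp (- y)) * incr m x y = 0"
      by (subst (asm) nn_integral_0_iff_AE) auto
    then show ?case by eventually_elim simp
  qed
qed

text \<open>All increments vanish, so the difference of both sides has conditional expectation \<open>0\<close> given the
  coordinates above \<open>- m\<close>, for every \<open>m\<close>.\<close>
lemma F_eq_cond_future: "AE x in M. AE y in lborel. F x y = cond_future 0 x y"
proof -
  have "AE x in M. AE y in lborel. \<forall>m. incr m x y = 0"
    using incr_zero by (simp add: AE_all_countable)
  then have "AE y in lborel. AE x in M. \<forall>m. incr m x y = 0"
    by (subst (asm) AE_commute_lborel) measurable
  then have "AE y in lborel. AE x in M. F x y = cond_future 0 x y"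
  proof eventually_elim
    fix y assume z: "AE x in M. \<forall>m. incr m x y = 0"
    have eq: "AE x in M. cond_future m x y = cond_future 0 x y" for m
      using z
    proof eventually_elim
      fix x assume z: "\<forall>m. incr m x y = 0"
      have "cond_future (Suc m) x y = cond_future m x y" for m using z by (simp add: incr_def)
      then show "cond_future m x y = cond_future 0 x y" by (induction m) auto
    qed
    define f where "f x = F x y - cond_future 0 x y" for x
    have "AE x in \<mu> P. f x = 0"
    proof (rule AE_zero_of_resample[where J=future and C=2])
      show "f \<in> borel_measurable cantor" unfolding f_def by measurable
      show "\<bar>f x\<bar> \<le> 2" for x using bound[of x y] cond_future_bound[of 0 x y] unfolding f_def by linarith
      show "\<exists>m. I \<subseteq> future m" if "finite I" for I
      proof (intro exI[of _ "nat (1 - Min (insert 0 I))"] subsetI)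
        fix i assume "i \<in> I"
        then have "Min (insert 0 I) \<le> i" "Min (insert 0 I) \<le> 0" using that by (auto intro!: Min_le)
        then show "i \<in> future (nat (1 - Min (insert 0 I)))" by (simp add: future_def)
      qed
      fix m
      have "resample (future m) M f x = cond_future m x y - cond_future 0 x y" for x
      proof -
        have "cond_future 0 (glue (future m) x w) y = cond_future 0 x y" for w
          by (rule cond_future_glue) (auto simp: future_def)
        moreover have "integrable M (\<lambda>w. F (glue (future m) x w) y)"
          by (rule integrable_M[where D=1]) (auto intro: bound)
        ultimately show ?thesis
          unfolding resample_def f_def using prob_space by (simp add: cond_future_def resample_def)
      qed
      then have "AE x in M. resample (future m) M f x = 0" using eq[of m] by simp
      then show "AE x in \<mu> P. resample (future m) (\<mu> P) f x = 0"
        unfolding M_def .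
    qed
    then show "AE x in M. F x y = cond_future 0 x y" unfolding M_def f_def by simp
  qed
  then show ?thesis by (subst AE_commute_lborel) measurable
qed

lemma F_flip_past: "AE x in M. AE y in lborel. F (flip 0 x) y = F x y"
  using F_eq_cond_future AE_flip_M[OF F_eq_cond_future, of 0]
proof eventually_elim
  fix x
  have eq: "cond_future 0 (flip 0 x) y = cond_future 0 x y" for y
  proof -
    have "glue (future 0) (flip 0 x) w = glue (future 0) x w" for w
      by (auto simp: glue_def future_def flip_def)
    then show ?thesis by (simp add: cond_future_def resample_def)
  qed
  assume "AE y in lborel. F x y = cond_future 0 x y" "AE y in lborel. F (flip 0 x) y = cond_future 0 (flip 0 x) y"
  then show "AE y in lborel. F (flip 0 x) y = F x y" by eventually_elim (simp add: eq)
qed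

text \<open>The \<open>k\<close>-th power of the shift moves coordinate \<open>k\<close> to coordinate \<open>0\<close>, on which \<open>F\<close> does not depend. What
  remains is the effect of the flip on \<open>logjac k\<close>, compensated by translating \<open>y\<close>.\<close>
lemma F_flip:
  assumes k: "1 \<le> k"
  shows "AE x in M. AE y in lborel. F (flip k x) (y + signed_gap k x) = F x y"
  using F_shift_power[of "nat k"] AE_flip_M[OF F_shift_power[of "nat k"], of k]
    AE_logjac_flip[OF k] AE_shift_power[OF F_flip_past, of "nat k"]
proof eventually_elim
  fix x
  define n where "n = nat k"
  define \<alpha> where "\<alpha> = signed_gap k x"
  let ?S = "T ^^ n"
  assume 1: "AE y in lborel. F ((T ^^ nat k) x) (y + logjac (nat k) x) = F x y"
    and 2: "AE y in lborel. F ((T ^^ nat k) (flip k x)) (y + logjac (nat k) (flip k x)) = F (flip k x) y"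
    and 3: "logjac (nat k) (flip k x) = logjac (nat k) x - signed_gap k x"
    and 4: "AE y in lborel. F (flip 0 ((T ^^ nat k) x)) y = F ((T ^^ nat k) x) y"
  have S: "?S (flip k x) = flip 0 (?S x)" using k by (auto simp: full_shift_power flip_def n_def fun_eq_iff)
  have "AE y in lborel. F (?S (flip k x)) (y + \<alpha> + logjac n (flip k x)) = F (flip k x) (y + \<alpha>)"
    by (rule AE_lborel_shift[OF _ 2[folded n_def]]) measurable
  moreover have "AE y in lborel. F (flip 0 (?S x)) (y + logjac n x) = F (?S x) (y + logjac n x)"
    by (rule AE_lborel_shift[OF _ 4[folded n_def]]) measurable
  ultimately have "AE y in lborel. F (flip k x) (y + \<alpha>) = F x y"
    using 1[folded n_def]
  proof eventually_elim
    case (elim y)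
    moreover have "y + \<alpha> + logjac n (flip k x) = y + logjac n x" using 3 by (simp add: \<alpha>_def n_def)
    ultimately show ?case by (simp add: S)
  qed
  then show "AE y in lborel. F (flip k x) (y + signed_gap k x) = F x y"
    by (simp add: \<alpha>_def)
qed

end

end

section \<open>Ergodicity of the Maharam extension\<close>

lemma AE_maharam_iff:
  assumes "sigma_finite_measure M" and "Measurable.pred (M \<Otimes>\<^sub>M borel) (\<lambda>z. Q (fst z) (snd z))"
  shows "(AE z in maharam_measure M. Q (fst z) (snd z)) \<longleftrightarrow> (AE x in M. AE y in lborel. Q x y)"
proof -
  let ?L = "density lborel (\<lambda>s. ennreal (exp (- s)))"
  interpret M: sigma_finite_measure M by fact
  interpret L: sigma_finite_measure ?L
    by (subst sigma_finite_measure.sigma_finite_iff_density_finite[OF sigma_finite_lborel]) auto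
  interpret pair_sigma_finite M ?L ..
  have "{z \<in> space (M \<Otimes>\<^sub>M ?L). Q (fst z) (snd z)} \<in> sets (M \<Otimes>\<^sub>M ?L)"
    using assms(2) unfolding pred_def by (simp add: space_pair_measure cong: sets_pair_measure_cong)
  from AE_pair_iff[OF this] show ?thesis
    unfolding maharam_measure_def by (simp add: AE_density)
qed

text \<open>By Fubini, for almost every \<open>x\<close> there is a \<open>y\<close> with \<open>F x (y + t) = F x y\<close> for almost every \<open>t\<close>.\<close>
lemma AE_constant_of_translation_invariant:
  fixes F :: "'a \<Rightarrow> real \<Rightarrow> real"
  assumes "sigma_finite_measure M"
    and meas: "(\<lambda>z. F (fst z) (snd z)) \<in> borel_measurable (M \<Otimes>\<^sub>M borel)"
    and inv: "\<And>t. 0 \<le> t \<Longrightarrow> AE x in M. AE y in lborel. F x (y + t) = F x y"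
  shows "AE x in M. \<exists>c. AE y in lborel. F x y = c"
proof -
  interpret M: sigma_finite_measure M by fact
  interpret X: pair_sigma_finite M lborel ..
  interpret T: pair_sigma_finite lborel "M \<Otimes>\<^sub>M lborel" ..
  have [measurable (raw)]: "(\<lambda>z. F (f z) (g z)) \<in> borel_measurable N"
    if "f \<in> measurable N M" "g \<in> borel_measurable N" for f g and N :: "'z measure"
    using measurable_compose[OF measurable_Pair[OF that] meas] by simp
  have sec: "F x \<in> borel_measurable borel" if "x \<in> space M" for x
    using measurable_compose[OF measurable_Pair1'[OF that] meas] by simp
  have all: "AE x in M. AE y in lborel. F x (y + t) = F x y" for t
  proof (cases "0 \<le> t")
    case True then show ?thesis by (rule inv)
  next
    case False
    then have "AE x in M. AE y in lborel. F x (y + - t) = F x y" by (intro inv) simp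
    then show ?thesis
      using AE_space
    proof eventually_elim
      fix x assume a: "AE y in lborel. F x (y + - t) = F x y" and x: "x \<in> space M"
      have "AE y in lborel. F x (y + t + - t) = F x (y + t)"
        by (rule AE_lborel_shift[OF _ a]) (use sec[OF x] in measurable)
      then show "AE y in lborel. F x (y + t) = F x y" by eventually_elim simp
    qed
  qed
  have prod: "AE z in M \<Otimes>\<^sub>M lborel. F (fst z) (snd z + t) = F (fst z) (snd z)" for t
  proof (rule X.AE_pair_measure)
    have "Measurable.pred (M \<Otimes>\<^sub>M lborel) (\<lambda>z. F (fst z) (snd z + t) = F (fst z) (snd z))" by measurable
    then show "{z \<in> space (M \<Otimes>\<^sub>M lborel). F (fst z) (snd z + t) = F (fst z) (snd z)} \<in> sets (M \<Otimes>\<^sub>M lborel)"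
      by (simp only: pred_def)
  qed (use all in simp)
  have "Measurable.pred (lborel \<Otimes>\<^sub>M (M \<Otimes>\<^sub>M lborel))
      (\<lambda>w. F (fst (snd w)) (snd (snd w) + fst w) = F (fst (snd w)) (snd (snd w)))" by measurable
  then have "(AE t in lborel. AE z in M \<Otimes>\<^sub>M lborel. F (fst z) (snd z + t) = F (fst z) (snd z)) \<longleftrightarrow>
      (AE z in M \<Otimes>\<^sub>M lborel. AE t in lborel. F (fst z) (snd z + t) = F (fst z) (snd z))"
    by (intro T.AE_commute) (simp only: pred_def)
  then have "AE z in M \<Otimes>\<^sub>M lborel. AE t in lborel. F (fst z) (snd z + t) = F (fst z) (snd z)"
    using prod by simp
  from X.AE_pair[OF this] show ?thesis
    using AE_space
  proof eventually_elim
    fix x assume a: "AE y in lborel. AE t in lborel. F (fst (x, y)) (snd (x, y) + t) = F (fst (x, y)) (snd (x, y))"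
      and x: "x \<in> space M"
    have "\<exists>y. AE t in lborel. F x (y + t) = F x y"
    proof (rule ccontr)
      assume "\<nexists>y. AE t in lborel. F x (y + t) = F x y"
      then have none: "\<not> (AE t in lborel. F x (y + t) = F x y)" for y by blast
      from a have "AE y in lborel :: real measure. False" by eventually_elim (simp add: none)
      then show False by (simp add: eventually_False ae_filter_eq_bot_iff)
    qed
    then obtain y where y: "AE t in lborel. F x (y + t) = F x y" ..
    have "AE u in lborel. F x (y + (u + - y)) = F x y"
      by (rule AE_lborel_shift[OF _ y]) (use sec[OF x] in measurable)
    then show "\<exists>c. AE y in lborel. F x y = c" by (intro exI[of _ "F x y"]) simp
  qed
qed


context half_stationary_shift
begin

lemma maharam_ergodic:
  assumes cons: "conservative M T" and erg: "ergodic M T"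
    and ns: "\<not> summable (\<lambda>n. (bias n)\<^sup>2)"
  shows "ergodic (maharam_measure M) (maharam_extension M T)"
  unfolding ergodic_def
proof (intro ballI impI)
  let ?N = "maharam_measure M" and ?T = "maharam_extension M T"
  fix A assume A: "A \<in> sets ?N" and inv: "eq_mod_null ?N (?T -` A \<inter> space ?N) A"
  have setsN: "sets ?N = sets (cantor \<Otimes>\<^sub>M borel)"
    unfolding maharam_measure_def by (intro sets_pair_measure_cong sets_M) simp
  have spaceN: "space ?N = UNIV" using sets_eq_imp_space_eq[OF setsN] by (simp add: space_pair_measure)
  have A' [measurable]: "A \<in> sets (cantor \<Otimes>\<^sub>M borel)" using A setsN by simp
  define F :: "(int \<Rightarrow> bool) \<Rightarrow> real \<Rightarrow> real" where "F x y = indicator A (x, y)" for x y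
  have F01: "F x y = 0 \<or> F x y = 1" for x y by (simp add: F_def indicator_def)
  have meas: "(\<lambda>(x, y). F x y) \<in> borel_measurable (cantor \<Otimes>\<^sub>M borel)" unfolding F_def by measurable
  have "AE z in ?N. z \<notin> (?T -` A \<inter> space ?N - A) \<union> (A - ?T -` A \<inter> space ?N)"
    using inv unfolding eq_mod_null_def by (rule AE_not_in)
  then have "AE z in ?N. ?T z \<in> A \<longleftrightarrow> z \<in> A"
    by eventually_elim (auto simp: spaceN)
  then have "AE z in ?N. F (T (fst z)) (snd z + ln (jac (fst z))) = F (fst z) (snd z)"
    by eventually_elim (auto simp: F_def maharam_extension_def jac_def split_beta indicator_def)
  moreover have [measurable (raw)]: "(\<lambda>z. F (f z) (g z)) \<in> borel_measurable N"
    if "f \<in> measurable N cantor" "g \<in> borel_measurable N" for f g and N :: "'z measure"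
    using measurable_compose[OF measurable_Pair[OF that] meas] by simp
  have "Measurable.pred (M \<Otimes>\<^sub>M borel) (\<lambda>z. F (T (fst z)) (snd z + ln (jac (fst z))) = F (fst z) (snd z))"
    by measurable
  ultimately have invF: "AE x in M. AE y in lborel. F (T x) (y + ln (jac x)) = F x y"
    using AE_maharam_iff[OF sigma_finite_measure_axioms, of "\<lambda>x y. F (T x) (y + ln (jac x)) = F x y"] by simp
  interpret invariant_function P p F
    by unfold_locales (use meas invF in \<open>auto simp: F_def indicator_def\<close>)
  have bias_step: "(\<lambda>n. bias (Suc n) - bias n) \<longlonglongrightarrow> 0"
    using steps_tendsto_0 by (simp add: bias_def add.commute)
  have div: "\<not> summable (\<lambda>n. if \<bar>bias n\<bar> \<le> \<eta> then (bias n)\<^sup>2 else 0)" if "0 < \<eta>" for \<eta>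
    by (rule truncated_squares_not_summable[OF bias_step _ ns that])
      (use frequently_close[OF cons] in \<open>simp add: bias_def\<close>)
  have "AE x in M. AE y in lborel. F x (y + t) = F x y" if "0 \<le> t" for t
    by (rule translation_invariant_of_flip_invariant[OF meas bound F_flip[OF cons] div that])
  then have const: "AE x in M. \<exists>c. AE y in lborel. F x y = c"
    by (intro AE_constant_of_translation_invariant[OF sigma_finite_measure_axioms]) measurable
  \<comment> \<open>the points over which \<open>A\<close> contains almost the whole line\<close>
  define B where "B = {x \<in> space cantor. (\<integral>\<^sup>+y. ennreal (1 - F x y) \<partial>lborel) = 0}"
  have B_sets: "B \<in> sets cantor" unfolding B_def by measurable
  have B_iff: "x \<in> B \<longleftrightarrow> (AE y in lborel. F x y = 1)" for x
  proof -
    have "F x \<in> borel_measurable borel" by measurable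
    then have "(\<integral>\<^sup>+y. ennreal (1 - F x y) \<partial>lborel) = 0 \<longleftrightarrow> (AE y in lborel. ennreal (1 - F x y) = 0)"
      by (intro nn_integral_0_iff_AE) auto
    also have "\<dots> \<longleftrightarrow> (AE y in lborel. F x y = 1)"
    proof -
      have "ennreal (1 - F x y) = 0 \<longleftrightarrow> F x y = 1" for y using F01[of x y] by auto
      then show ?thesis by simp
    qed
    finally show ?thesis by (simp add: B_def)
  qed
  have B_inv: "AE x in M. T x \<in> B \<longleftrightarrow> x \<in> B"
    using invF
  proof eventually_elim
    fix x assume i: "AE y in lborel. F (T x) (y + ln (jac x)) = F x y"
    show "T x \<in> B \<longleftrightarrow> x \<in> B"
      unfolding B_iff
    proof
      assume "AE y in lborel. F (T x) y = 1"
      then have "AE y in lborel. F (T x) (y + ln (jac x)) = 1"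
        by (rule AE_lborel_shift[rotated]) measurable
      then show "AE y in lborel. F x y = 1" using i by eventually_elim simp
    next
      assume "AE y in lborel. F x y = 1"
      then have "AE y in lborel. F (T x) (y + ln (jac x)) = 1" using i by eventually_elim simp
      then have "AE y in lborel. F (T x) (y + - ln (jac x) + ln (jac x)) = 1"
        by (rule AE_lborel_shift[rotated]) measurable
      then show "AE y in lborel. F (T x) y = 1" by simp
    qed
  qed
  have "eq_mod_null M (T -` B \<inter> space M) B"
    unfolding eq_mod_null_def
  proof (rule AE_iff_null_sets[THEN iffD2])
    have [measurable]: "B \<in> sets cantor" by (rule B_sets)
    show "T -` B \<inter> space M - B \<union> (B - T -` B \<inter> space M) \<in> sets M"
      by measurable
    show "AE x in M. x \<notin> T -` B \<inter> space M - B \<union> (B - T -` B \<inter> space M)"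
      using B_inv by eventually_elim auto
  qed
  then have "eq_mod_null M B {} \<or> eq_mod_null M B (space M)"
    using erg B_sets unfolding ergodic_def sets_M by blast
  then show "eq_mod_null ?N A {} \<or> eq_mod_null ?N A (space ?N)"
  proof
    assume "eq_mod_null M B {}"
    then have "AE x in M. x \<notin> B" unfolding eq_mod_null_def by (intro AE_not_in) simp
    then have "AE x in M. AE y in lborel. F x y = 0"
      using const
    proof eventually_elim
      fix x assume x: "x \<notin> B" and "\<exists>c. AE y in lborel. F x y = c"
      then obtain c where c: "AE y in lborel. F x y = c" by blast
      then have "c \<noteq> 1" using x B_iff by auto
      show "AE y in lborel. F x y = 0" using c
      proof eventually_elim
        fix y assume "F x y = c" then show "F x y = 0" using F01[of x y] \<open>c \<noteq> 1\<close> by auto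
      qed
    qed
    then have "AE z in ?N. F (fst z) (snd z) = 0"
      by (subst AE_maharam_iff[OF sigma_finite_measure_axioms]) measurable
    then have "AE z in ?N. z \<notin> A" by eventually_elim (auto simp: F_def indicator_def)
    then have "A \<in> null_sets ?N" using A by (subst AE_iff_null_sets) auto
    then show ?thesis by (simp add: eq_mod_null_def)
  next
    assume "eq_mod_null M B (space M)"
    then have "AE x in M. x \<notin> (B - space M) \<union> (space M - B)" unfolding eq_mod_null_def by (rule AE_not_in)
    then have "AE x in M. AE y in lborel. F x y = 1"
      by eventually_elim (auto simp: B_iff[symmetric])
    then have "AE z in ?N. F (fst z) (snd z) = 1"
      by (subst AE_maharam_iff[OF sigma_finite_measure_axioms]) measurable
    then have "AE z in ?N. z \<notin> space ?N - A" by eventually_elim (auto simp: F_def indicator_def)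
    then have "space ?N - A \<in> null_sets ?N" using A by (subst AE_iff_null_sets) auto
    then show ?thesis using sets.sets_into_space[OF A] by (simp add: eq_mod_null_def Diff_eq_empty_iff[THEN iffD2])
  qed
qed

end

section \<open>Absolute continuity of the stationary measure\<close>

definition finitary :: "(int \<Rightarrow> bool) set \<Rightarrow> bool" where
  "finitary C \<longleftrightarrow> C \<in> sets cantor \<and> (\<exists>I. finite I \<and> (\<forall>x w. glue I x w \<in> C \<longleftrightarrow> x \<in> C))"

lemma finitary_Un:
  assumes "finitary C" "finitary D" shows "finitary (C \<union> D)"
proof -
  obtain I J where I: "finite I" "\<And>x w. glue I x w \<in> C \<longleftrightarrow> x \<in> C"
    and J: "finite J" "\<And>x w. glue J x w \<in> D \<longleftrightarrow> x \<in> D"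
    using assms unfolding finitary_def by blast
  have g: "glue I (glue (I \<union> J) x w) x = glue I x x" "glue J (glue (I \<union> J) x w) x = glue J x x" for x w
    by (auto simp: glue_def)
  have "glue (I \<union> J) x w \<in> C \<longleftrightarrow> x \<in> C" "glue (I \<union> J) x w \<in> D \<longleftrightarrow> x \<in> D" for x w
    using g I(2) J(2) by metis+
  then show ?thesis using assms I(1) J(1) unfolding finitary_def
    by (intro conjI exI[of _ "I \<union> J"]) auto
qed

lemma finitary_Compl: "finitary C \<Longrightarrow> finitary (- C)"
  unfolding finitary_def using sets.compl_sets[of C cantor] by (auto simp: Compl_eq_Diff_UNIV)

lemma finitary_UN: "finitary (\<Union>i<n. C i)" if "\<And>i. finitary (C i)" for n :: nat
proof (induction n)
  case 0
  then show ?case by (auto simp: finitary_def)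
next
  case (Suc n)
  then show ?case using finitary_Un[OF Suc that[of n]] by (simp add: lessThan_Suc Un_commute)
qed

text \<open>The sets that can be approximated form a \<open>\<sigma>\<close>-algebra that contains the coordinate sets. The index
  \<open>i\<close> allows for two measures with a common approximation.\<close>
lemma finitary_approximation:
  assumes A: "A \<in> sets cantor" and fin: "\<And>i::bool. finite_measure (\<nu> i)" "\<And>i. sets (\<nu> i) = sets cantor" and e: "0 < e"
  shows "\<exists>C. finitary C \<and> (\<forall>i. measure (\<nu> i) (sym_diff A C) < e)"
proof -
  have gen: "sets cantor = sigma_sets UNIV {{x. x k \<in> B} | k B. True}"
    unfolding cantor_def by (subst sets_PiM_single) (simp add: PiE_UNIV_domain)
  show ?thesis
    using A[unfolded gen] e
  proof (induction arbitrary: e rule: sigma_sets.induct)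
    case (Basic a)
    then obtain k B where a: "a = {x. x k \<in> B}" by blast
    have "finitary a"
      unfolding finitary_def a
      using measurable_sets[OF coordinate_measurable, of B k]
      by (auto simp: vimage_def glue_def intro!: exI[of _ "{k}"])
    then show ?case using Basic by (intro exI[of _ a]) auto
  next
    case Empty
    then show ?case by (intro exI[of _ "{}"]) (auto simp: finitary_def)
  next
    case (Compl a)
    then obtain C where C: "finitary C" "\<forall>i. measure (\<nu> i) (sym_diff a C) < e" by blast
    have "((UNIV - a) - (- C)) \<union> (- C - (UNIV - a)) = sym_diff a C" by auto
    then show ?case using C finitary_Compl by (intro exI[of _ "- C"]) simp
  next
    case (Union a)
    have "\<exists>C. finitary C \<and> (\<forall>i. measure (\<nu> i) ((a n - C) \<union> (C - a n)) < e / 4 * (1 / 2) ^ n)" for n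
      using Union.IH[of "e / 4 * (1 / 2) ^ n" n] Union.prems by simp
    then obtain C where C: "\<And>n. finitary (C n)"
      "\<And>n i. measure (\<nu> i) (sym_diff (a n) (C n)) < e / 4 * (1 / 2) ^ n" by metis
    have am: "a n \<in> sets cantor" for n using Union.hyps gen by blast
    have Cm: "C n \<in> sets cantor" for n using C(1) by (auto simp: finitary_def)
    have "\<exists>N. measure (\<nu> i) ((\<Union>n. a n) - (\<Union>n<N. a n)) < e / 2" for i
    proof -
      interpret finite_measure "\<nu> i" by (rule fin)
      have "(\<lambda>N. measure (\<nu> i) (\<Union>n<N. a n)) \<longlonglongrightarrow> measure (\<nu> i) (\<Union>N. \<Union>n<N. a n)"
        using am fin(2) by (intro finite_Lim_measure_incseq) (auto simp: incseq_def intro: less_le_trans)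
      moreover have "(\<Union>N. \<Union>n<N. a n) = (\<Union>n. a n)" by auto
      ultimately have "\<forall>\<^sub>F N in sequentially. measure (\<nu> i) (\<Union>n. a n) - e / 2 < measure (\<nu> i) (\<Union>n<N. a n)"
        using Union.prems by (intro order_tendstoD(1)) auto
      then obtain N where "measure (\<nu> i) (\<Union>n. a n) - e / 2 < measure (\<nu> i) (\<Union>n<N. a n)"
        unfolding eventually_sequentially by blast
      moreover have "measure (\<nu> i) ((\<Union>n. a n) - (\<Union>n<N. a n)) = measure (\<nu> i) (\<Union>n. a n) - measure (\<nu> i) (\<Union>n<N. a n)"
        using am fin(2) by (intro finite_measure_Diff) auto
      ultimately show ?thesis by (intro exI[of _ N]) simp
    qed
    then obtain K where K: "\<And>i. measure (\<nu> i) ((\<Union>n. a n) - (\<Union>n<K i. a n)) < e / 2" by metis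
    define N where "N = max (K True) (K False)"
    have NK: "K i \<le> N" for i by (cases i) (auto simp: N_def)
    have "measure (\<nu> i) (sym_diff (\<Union>n. a n) (\<Union>n<N. C n)) < e" for i
    proof -
      interpret finite_measure "\<nu> i" by (rule fin)
      let ?D = "\<lambda>n. sym_diff (a n) (C n)"
      have "measure (\<nu> i) (sym_diff (\<Union>n. a n) (\<Union>n<N. C n))
          \<le> measure (\<nu> i) (((\<Union>n. a n) - (\<Union>n<K i. a n)) \<union> (\<Union>n<N. ?D n))"
      proof (rule finite_measure_mono)
        show "sym_diff (\<Union>n. a n) (\<Union>n<N. C n) \<subseteq> ((\<Union>n. a n) - (\<Union>n<K i. a n)) \<union> (\<Union>n<N. ?D n)"
        proof
          fix x assume x: "x \<in> sym_diff (\<Union>n. a n) (\<Union>n<N. C n)"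
          show "x \<in> ((\<Union>n. a n) - (\<Union>n<K i. a n)) \<union> (\<Union>n<N. ?D n)"
          proof (cases "x \<in> (\<Union>n<K i. a n)")
            case True
            then obtain n where "n < K i" "x \<in> a n" by auto
            then have "n < N" "x \<in> ?D n" using NK[of i] x by auto
            then show ?thesis by blast
          qed (use x in auto)
        qed
      qed (use am Cm fin(2) in auto)
      also have "\<dots> \<le> measure (\<nu> i) ((\<Union>n. a n) - (\<Union>n<K i. a n)) + measure (\<nu> i) (\<Union>n<N. ?D n)"
        using am Cm fin(2) by (intro measure_Un_le) auto
      also have "measure (\<nu> i) (\<Union>n<N. ?D n) \<le> (\<Sum>n<N. measure (\<nu> i) (?D n))"
        using am Cm fin(2) by (intro finite_measure_subadditive_finite) auto
      also have "\<dots> \<le> (\<Sum>n<N. e / 4 * (1 / 2) ^ n)"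
        by (intro sum_mono less_imp_le C(2))
      also have "\<dots> \<le> e / 4 * 2"
      proof -
        have "(\<Sum>n<N. (1 / 2 :: real) ^ n) \<le> 2"
          by (subst sum_gp_strict) (simp add: field_simps)
        then show ?thesis unfolding sum_distrib_left[symmetric] using Union.prems by (intro mult_left_mono) auto
      qed
      finally show ?thesis using K[of i] by simp
    qed
    then show ?case using finitary_UN[of C N] C(1) by (intro exI[of _ "\<Union>n<N. C n"]) auto
  qed
qed

context half_stationary_shift
begin

definition stationary :: "(int \<Rightarrow> bool) measure" where
  "stationary = \<mu> (\<lambda>_. P 0)"

text \<open>The \<open>\<chi>\<^sup>2\<close>-divergence between the past marginal and the \<open>k\<close>-th one.\<close>
definition chi2 :: "int \<Rightarrow> real" where
  "chi2 k = (pmf (P k) False - p)\<^sup>2 / (pmf (P k) False * pmf (P k) True)"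

lemma chi2_nonneg: "0 \<le> chi2 k"
  by (simp add: chi2_def)

lemma chi2_eq: "(\<Sum>b\<in>UNIV. ennreal (pmf (P k) b) * (ennreal (pmf (P 0) b / pmf (P k) b))\<^sup>2) = ennreal (1 + chi2 k)"
proof -
  have "ennreal (pmf (P k) b) * (ennreal (pmf (P 0) b / pmf (P k) b))\<^sup>2 = ennreal ((pmf (P 0) b)\<^sup>2 / pmf (P k) b)" for b
    using pmf_pos[of k b] by (simp add: ennreal_power ennreal_mult[symmetric] power2_eq_square)
  then have "(\<Sum>b\<in>UNIV. ennreal (pmf (P k) b) * (ennreal (pmf (P 0) b / pmf (P k) b))\<^sup>2) =
      ennreal ((pmf (P 0) True)\<^sup>2 / pmf (P k) True + (pmf (P 0) False)\<^sup>2 / pmf (P k) False)"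
    by (simp add: UNIV_bool ennreal_plus[symmetric] add.commute del: ennreal_plus)
  also have "(pmf (P 0) True)\<^sup>2 / pmf (P k) True + (pmf (P 0) False)\<^sup>2 / pmf (P k) False = 1 + chi2 k"
    using pmf_pos[of k True] pmf_pos[of k False] past[of 0] unfolding chi2_def pmf_bool_True
    by (simp add: divide_simps power2_eq_square) (simp add: algebra_simps)
  finally show ?thesis .
qed

lemma summable_chi2:
  assumes s: "summable (\<lambda>n. (bias n)\<^sup>2)"
  shows "summable (\<lambda>n. chi2 (int n))"
proof -
  define c where "c = min p (1 - p) / 2"
  have c: "0 < c" "2 * c \<le> p" "2 * c \<le> 1 - p" using p by (auto simp: c_def)
  have "\<forall>\<^sub>F n in sequentially. (bias n)\<^sup>2 < c\<^sup>2"
    by (rule order_tendstoD(2)[OF summable_LIMSEQ_zero[OF s]]) (use c in simp)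
  then have "\<forall>\<^sub>F n in sequentially. norm (chi2 (int n)) \<le> (bias n)\<^sup>2 / c\<^sup>2"
  proof eventually_elim
    fix n assume "(bias n)\<^sup>2 < c\<^sup>2"
    then have "\<bar>bias n\<bar>\<^sup>2 < c\<^sup>2" by simp
    then have "\<bar>bias n\<bar> < c" by (rule power_less_imp_less_base) (use c in simp)
    then have "\<bar>bias n\<bar> \<le> c" by simp
    then have "c * c \<le> pmf (P (int n)) False * pmf (P (int n)) True"
      using flip_gap_bounds(3)[OF c, of n] c by (intro mult_mono) auto
    then have "(bias n)\<^sup>2 / (pmf (P (int n)) False * pmf (P (int n)) True) \<le> (bias n)\<^sup>2 / (c * c)"
      using c pmf_pos by (intro divide_left_mono) auto
    then show "norm (chi2 (int n)) \<le> (bias n)\<^sup>2 / c\<^sup>2"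
      using chi2_nonneg[of "int n"] by (simp add: chi2_def bias_def power2_eq_square)
  qed
  then show ?thesis using summable_divide[OF s] by (rule summable_comparison_test_ev)
qed

text \<open>The integral is the product of the factors \<open>1 + chi2 k\<close>; those with \<open>k \<le> 0\<close> are \<open>1\<close>.\<close>
lemma square_density_bound:
  assumes s: "summable (\<lambda>n. (bias n)\<^sup>2)" and I: "finite I"
  shows "(\<integral>\<^sup>+x. (ennreal (\<Prod>k\<in>I. pmf (P 0) (x k) / pmf (P k) (x k)))\<^sup>2 \<partial>M) \<le> ennreal (exp (\<Sum>n. chi2 (int n)))"
proof -
  have "(\<integral>\<^sup>+x. (ennreal (\<Prod>k\<in>I. pmf (P 0) (x k) / pmf (P k) (x k)))\<^sup>2 \<partial>M) =
      (\<integral>\<^sup>+x. (\<Prod>k\<in>I. (ennreal (pmf (P 0) (x k) / pmf (P k) (x k)))\<^sup>2) \<partial>M)"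
    by (simp add: prod_ennreal prod_power_distrib[symmetric])
  also have "\<dots> = (\<Prod>k\<in>I. ennreal (1 + chi2 k))"
    unfolding M_def chi2_eq[symmetric] by (rule nn_integral_prod_coordinates[OF I])
  also have "\<dots> = ennreal (\<Prod>k\<in>I. 1 + chi2 k)"
    by (rule prod_ennreal) (simp add: chi2_nonneg add_nonneg_nonneg)
  also have "\<dots> \<le> ennreal (exp (\<Sum>n. chi2 (int n)))"
  proof (rule ennreal_leI)
    have "(\<Sum>k\<in>I. chi2 k) = (\<Sum>k\<in>{k\<in>I. 0 \<le> k}. chi2 k)"
    proof (rule sum.mono_neutral_right[OF I])
      show "\<forall>i\<in>I - {k \<in> I. 0 \<le> k}. chi2 i = 0"
      proof
        fix i assume "i \<in> I - {k \<in> I. 0 \<le> k}"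
        then have "i \<le> 0" by auto
        then show "chi2 i = 0" using past[of i] by (simp add: chi2_def)
      qed
    qed auto
    also have "{k\<in>I. 0 \<le> k} = int ` nat ` {k\<in>I. 0 \<le> k}" by (force simp: image_image)
    also have "(\<Sum>k\<in>int ` nat ` {k\<in>I. 0 \<le> k}. chi2 k) = (\<Sum>n\<in>nat ` {k\<in>I. 0 \<le> k}. chi2 (int n))"
      by (subst sum.reindex) auto
    also have "\<dots> \<le> (\<Sum>n. chi2 (int n))"
      using I by (intro sum_le_suminf summable_chi2[OF s]) (auto simp: chi2_nonneg)
    finally have le: "(\<Sum>k\<in>I. chi2 k) \<le> (\<Sum>n. chi2 (int n))" .
    have "(\<Prod>k\<in>I. 1 + chi2 k) \<le> (\<Prod>k\<in>I. exp (chi2 k))"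
      by (intro prod_mono) (auto simp: chi2_nonneg add_nonneg_nonneg exp_ge_add_one_self)
    also have "\<dots> = exp (\<Sum>k\<in>I. chi2 k)" using I by (rule exp_sum[symmetric])
    also have "\<dots> \<le> exp (\<Sum>n. chi2 (int n))" using le by simp
    finally show "(\<Prod>k\<in>I. 1 + chi2 k) \<le> exp (\<Sum>n. chi2 (int n))" .
  qed
  finally show ?thesis .
qed

text \<open>On sets that depend on \<open>I\<close> the stationary measure has the density \<open>\<phi>\<close>, and \<open>\<phi> \<le> t + \<phi>\<^sup>2 / t\<close>. This
  replaces the Cauchy--Schwarz inequality.\<close>
lemma stationary_finitary_bound:
  assumes s: "summable (\<lambda>n. (bias n)\<^sup>2)" and C: "finitary C" and t: "0 < t"
  shows "measure stationary C \<le> t * measure M C + exp (\<Sum>n. chi2 (int n)) / t"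
proof -
  obtain I where I: "finite I" "\<And>x w. glue I x w \<in> C \<longleftrightarrow> x \<in> C" and [measurable]: "C \<in> sets cantor"
    using C unfolding finitary_def by blast
  define \<phi> where "\<phi> x = (\<Prod>k\<in>I. pmf (P 0) (x k) / pmf (P k) (x k))" for x
  have [measurable]: "\<phi> \<in> borel_measurable cantor" unfolding \<phi>_def by measurable
  have \<phi>: "0 \<le> \<phi> x" for x unfolding \<phi>_def by (intro prod_nonneg) simp
  interpret B: prob_space "\<mu> P" by (rule prob_space_bernoulli)
  have "emeasure stationary C = (\<integral>\<^sup>+x. \<integral>\<^sup>+w. indicator C (glue I x w) \<partial>\<mu> P \<partial>stationary)"
  proof -
    have "indicator C (glue I x w) = (indicator C x :: ennreal)" for x w using I(2) by (simp add: indicator_def)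
    moreover have "C \<in> sets stationary" by (simp add: stationary_def sets_bernoulli)
    ultimately show ?thesis using B.emeasure_space_1 by simp
  qed
  also have "\<dots> = (\<integral>\<^sup>+x. indicator C x \<partial>\<mu> (\<lambda>k. if k \<in> I then P 0 else P k))"
    unfolding stationary_def by (rule nn_integral_glue[symmetric]) measurable
  also have "\<dots> = (\<integral>\<^sup>+x. indicator C x * ennreal (\<phi> x) \<partial>M)"
    unfolding \<phi>_def M_def by (rule nn_integral_change_finite[OF I(1) _ pmf_pos]) measurable
  also have "\<dots> \<le> (\<integral>\<^sup>+x. ennreal t * indicator C x + (ennreal (\<phi> x))\<^sup>2 * ennreal (1 / t) \<partial>M)"
  proof (rule nn_integral_mono)
    fix x
    have "\<phi> x \<le> t + (\<phi> x)\<^sup>2 * (1 / t)"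
    proof (cases "\<phi> x \<le> t")
      case True then show ?thesis using t by (intro add_increasing2) auto
    next
      case False
      then have "t * \<phi> x \<le> \<phi> x * \<phi> x" using \<phi>[of x] by (intro mult_right_mono) auto
      then have "\<phi> x \<le> (\<phi> x)\<^sup>2 * (1 / t)" using t by (simp add: field_simps power2_eq_square)
      then show ?thesis using t by simp
    qed
    from ennreal_leI[OF this]
    have "ennreal (\<phi> x) \<le> ennreal t + (ennreal (\<phi> x))\<^sup>2 * ennreal (1 / t)"
      using t \<phi>[of x] by (simp add: ennreal_plus ennreal_power ennreal_mult[symmetric])
    then show "indicator C x * ennreal (\<phi> x) \<le> ennreal t * indicator C x + (ennreal (\<phi> x))\<^sup>2 * ennreal (1 / t)"
      by (auto split: split_indicator)
  qed
  also have "\<dots> = ennreal t * emeasure M C + (\<integral>\<^sup>+x. (ennreal (\<phi> x))\<^sup>2 \<partial>M) * ennreal (1 / t)"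
    by (subst nn_integral_add) (auto simp: nn_integral_cmult nn_integral_multc)
  also have "\<dots> \<le> ennreal t * emeasure M C + ennreal (exp (\<Sum>n. chi2 (int n))) * ennreal (1 / t)"
    unfolding \<phi>_def by (intro add_left_mono mult_right_mono square_density_bound[OF s I(1)]) simp
  also have "\<dots> = ennreal (t * measure M C + exp (\<Sum>n. chi2 (int n)) / t)"
    using t by (simp add: emeasure_eq_measure ennreal_mult[symmetric] ennreal_plus[symmetric] del: ennreal_plus)
  finally have le: "emeasure stationary C \<le> ennreal (t * measure M C + exp (\<Sum>n. chi2 (int n)) / t)" .
  interpret S: prob_space stationary unfolding stationary_def by (rule prob_space_bernoulli)
  show ?thesis
    using le t by (simp add: S.emeasure_eq_measure ennreal_le_iff del: ennreal_plus)
qed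

text \<open>For an \<open>M\<close>-null set, choose \<open>t\<close> so large that the second term of the bound is small, and then an
  approximation so good that \<open>t\<close> times its measure is small.\<close>
lemma absolutely_continuous_stationary:
  assumes s: "summable (\<lambda>n. (bias n)\<^sup>2)"
  shows "absolutely_continuous M stationary"
  unfolding absolutely_continuous_def
proof
  interpret S: prob_space stationary unfolding stationary_def by (rule prob_space_bernoulli)
  have setsS: "sets stationary = sets cantor" by (simp add: stationary_def sets_bernoulli)
  fix A assume A: "A \<in> null_sets M"
  then have Am: "A \<in> sets cantor" and A0: "measure M A = 0"
    using sets_M by (auto simp: measure_def)
  define K where "K = exp (\<Sum>n. chi2 (int n))"
  have K: "0 < K" by (simp add: K_def)
  have "measure stationary A \<le> 3 * e" if e: "0 < e" for e
  proof -
    define t where "t = max 1 (K / e)"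
    have t: "0 < t" "K / t \<le> e"
      using K e by (auto simp: t_def max_def field_simps)
    define d where "d = min e (e / t)"
    have d: "0 < d" "d \<le> e" "t * d \<le> e"
      using e t by (auto simp: d_def min_def field_simps)
    define \<nu> where "\<nu> i = (if i then stationary else M)" for i
    have "finite_measure (\<nu> i)" "sets (\<nu> i) = sets cantor" for i
      unfolding \<nu>_def using S.finite_measure_axioms finite_measure_axioms setsS sets_M by auto
    then obtain C where C: "finitary C" "\<And>i. measure (\<nu> i) (sym_diff A C) < d"
      using finitary_approximation[OF Am, of \<nu> d] d(1) by blast
    have Cm: "C \<in> sets cantor" using C(1) by (simp add: finitary_def)
    have "measure stationary A \<le> measure stationary (C \<union> (sym_diff A C))"
      using Am Cm setsS by (intro S.finite_measure_mono) auto
    also have "\<dots> \<le> measure stationary C + measure stationary (sym_diff A C)"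
      using Am Cm setsS by (intro measure_Un_le) auto
    also have "\<dots> \<le> measure stationary C + e" using C(2)[of True] d by (simp add: \<nu>_def)
    also have "measure stationary C \<le> t * measure M C + K / t"
      unfolding K_def by (rule stationary_finitary_bound[OF s C(1) t(1)])
    also have "measure M C \<le> measure M (A \<union> (sym_diff A C))"
      using Am Cm sets_M by (intro finite_measure_mono) auto
    also have "\<dots> \<le> measure M A + measure M (sym_diff A C)"
      using Am Cm sets_M by (intro measure_Un_le) auto
    also have "\<dots> \<le> d" using C(2)[of False] A0 by (simp add: \<nu>_def)
    finally have "measure stationary A \<le> t * d + K / t + e" using t by simp
    then show ?thesis using t d by linarith
  qed
  from this[of "measure stationary A / 6"] have "measure stationary A \<le> 0"
    using measure_nonneg[of stationary A] by (cases "measure stationary A = 0") auto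
  then have "emeasure stationary A = 0" by (simp add: S.emeasure_eq_measure measure_le_0_iff)
  then show "A \<in> null_sets stationary" using Am setsS by auto
qed

lemma distr_shift_stationary: "distr stationary stationary T = stationary"
proof -
  have u: "(\<lambda>x k. x (k - int 1)) = unshift" by (auto simp: unshift_def)
  have m [measurable_cong]: "sets stationary = sets cantor" by (simp add: stationary_def sets_bernoulli)
  have inv: "distr stationary cantor unshift = stationary"
    unfolding stationary_def u[symmetric] by (rule distr_translate)
  have "distr stationary stationary T = distr (distr stationary cantor unshift) cantor T"
    unfolding inv by (rule distr_cong) (simp_all add: m)
  also have "\<dots> = distr stationary cantor (\<lambda>x. x)"
    by (subst distr_distr) (auto simp: comp_def)
  also have "\<dots> = stationary" by (rule distr_id2) (simp add: m)
  finally show ?thesis .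
qed

lemma type_II1_of_summable:
  assumes "ergodic M T" "summable (\<lambda>n. (bias n)\<^sup>2)"
  shows "type_II1 M T"
  unfolding type_II1_def
  using assms absolutely_continuous_stationary distr_shift_stationary prob_space_bernoulli
  by (intro conjI exI[of _ stationary]) (auto simp: stationary_def sets_bernoulli sets_M)

end

section \<open>The types of half-stationary Bernoulli shifts\<close>

no_notation bernoulli_product ("\<mu>")
no_notation full_shift ("T")

theorem corollary3p3:
  fixes P :: "int \<Rightarrow> bool pmf"
  assumes "half_stationary P"
    and "nonsingular (bernoulli_product P) full_shift"
    and "conservative (bernoulli_product P) full_shift"
    and "ergodic (bernoulli_product P) full_shift"
  shows "type_III1 (bernoulli_product P) full_shift \<or> type_II1 (bernoulli_product P) full_shift"
proof -
  obtain p :: real where p: "0 < p" "p < 1" "\<And>k. k \<le> 0 \<Longrightarrow> pmf (P k) False = p"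
    using assms(1) unfolding half_stationary_def by blast
  interpret half_stationary_shift P p
    by unfold_locales (use assms(2) p in auto)
  show ?thesis
  proof (cases "summable (\<lambda>n. (bias n)\<^sup>2)")
    case True
    then show ?thesis using type_II1_of_summable assms(4) by (simp add: M_def)
  next
    case False
    then show ?thesis using maharam_ergodic assms(3,4) by (simp add: M_def type_III1_def)
  qed
qed

end
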